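(* Let $(\mathbf{u}^{m+1},p^{m+1},\phi^{m+1},\mu^{m+1})$ be any solution of the discrete scheme (S1)--(S4) (described in the context) for the data $(\mathbf{u}^m,\phi^m,\mu^m)$. Then the following discrete energy law holds: $$\begin{aligned} &\delta_tE(\mathbf u^{m+1},\Pi^h_1\phi^{m+1})+2\big(\eta(\phi^{m})\mathbf D\mathbf u^{m+1},\mathbf D\mathbf u^{m+1}\big)+b_h^{\mathrm{upw}}\big(-\nabla^0_{\mathbf n}\mu^{m+1};M(\phi^{m+1}),\Pi_0\mu^{m+1}\big)\\ &\quad+\frac{\Delta t}{2}\int_\Omega\rho(\Pi^h_1\phi^m)|\delta_t\mathbf u^{m+1}|^2+\frac{\Delta t\,\lambda\varepsilon}{2}\int_\Omega|\delta_t\nabla\Pi^h_1\phi^{m+1}|^2\\ &\quad+\frac\lambda\varepsilon\int_\Omega\Big(f(\Pi^h_1\phi^{m+1},\Pi^h_1\phi^m)\,\delta_t\Pi^h_1\phi^{m+1}-\delta_tF(\Pi^h_1\phi^{m+1})\Big)=0, \end{aligned}$$ where $$E(\mathbf u,\phi)=\int_\Omega\rho(\phi)\frac{|\mathbf u|^2}{2}+\frac{\lambda\varepsilon}{2}\int_\Omega|\nabla\phi|^2+\frac\lambda\varepsilon\int_\Omega F(\phi),\qquad F(\phi)=\tfrac14(\phi^2-1)^2 ,$$ and $\delta_tE(\mathbf u^{m+1},\Pi^h_1\phi^{m+1})=\big(E(\mathbf u^{m+1},\Pi^h_1\phi^{m+1})-E(\mathbf u^{m},\Pi^h_1\phi^{m})\big)/\Delta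 t$.
   Context: **Constants and functions.** $\Omega\subset\mathbb{R}^d$ ($d\in\{2,3\}$) is a bounded polygonal (polyhedral) domain; $0<\rho_1<\rho_2$, $\lambda>0$, $\varepsilon>0$, $\Delta t>0$; $\eta\in C^0([-1,1])$ with $\eta\ge C>0$. For a real-valued function $v$, $v_\oplus=\max\{v,0\}$, $v_\ominus=-\min\{v,0\}$. Put $\rho_{\mathrm{avg}}=\frac{\rho_1+\rho_2}{2}$, $\rho_{\mathrm{dif}}=\frac{\rho_2-\rho_1}{2}$, $\rho(\phi)=\rho_{\mathrm{avg}}+\rho_{\mathrm{dif}}\phi$, $M(\phi)=(1-\phi^2)_\oplus$, and $f(\phi_1,\phi_0)=F_i'(\phi_1)+F_e'(\phi_0)$ with $F_i(\phi)=\phi^2+\frac14$, $F_e(\phi)=\frac14\phi^4-\frac32\phi^2$ (so $F=F_i+F_e$ for $F(\phi)=\frac14(\phi^2-1)^2$). $M^\uparrow(z)=M(z)$ if $z\le0$ and $M(0)$ if $z>0$; $M^\downarrow(z)=0$ if $z\le 0$ and $M(z)-M(0)$ if $z>0$. $\mathbf{D}\mathbf{u}=\frac12(\nabla\mathbf{u}+\nabla\mathbf{u}^t)$. $(\cdot,\cdot)$ is the $L^2(\Omega)$ scalar product (Frobenius product for tensors). $\delta_t v^{m+1}=(v^{m+1}-v^m)/\Delta t$. **Mesh.** $\mathcal{T}_h$ is a shape-regular simplicial mesh of $\overline\Omega$ such that for every interior edge (face) $e=K\cap L$ the line between the barycenters of $K$ and $L$ is orthogonal to $e$; $\mathcal{D}_e(\mathcal{T}_h)>0$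 is the distance between these barycenters. $\mathcal{E}_h^{\mathrm i}$ is the set of interior edges (faces); each $e\in\mathcal{E}_h^{\mathrm i}$ has a fixed unit normal $\mathbf{n}_e$, and we write $e=K\cap L$ with $\mathbf{n}_e$ exterior to $K$ and pointing to $L$. On such $e$, $\{\!\{v\}\!\}=\frac{v_K+v_L}{2}$ and $[\![v]\!]=v_K-v_L$. **Spaces and projections.** $\mathbb{P}^{\mathrm{disc}}_k(\mathcal{T}_h)$ (resp. $\mathbb{P}^{\mathrm{cont}}_k(\mathcal{T}_h)$) is the space of discontinuous (resp. continuous) functions that are polynomials of degree at most $k$ on each $K\in\mathcal{T}_h$. $(\mathcal{U}_h,\mathcal{P}_h)$ is an inf-sup compatible (velocity, pressure) pair of finite-dimensional spaces with $\mathcal{U}_h\subset(C^0(\overline\Omega)\cap H^1_0(\Omega))^d$ and $\mathbb{P}^{\mathrm{disc}}_0(\mathcal{T}_h)\subset\mathcal{P}_h$. The mass-lumping product on $\mathbb{P}^{\mathrm{cont}}_1(\mathcal{T}_h)$ is $(\varphi,\psi)_h=\frac1{d+1}\sum_{K}|K|\sum_{j=1}^{d+1}\varphi(x_{j,K})\psi(x_{j,K})$, $x_{j,K}$ being the vertices of $K$. For $g\in L^1(\Omega)$: $\Pi_0g\in\mathbb{P}^{\mathrm{disc}}_0(\mathcal{T}_h)$ with $(\Pi_0g,\overline w)=(g,\overline w)$ for all $\overline w\in\mathbb{P}^{\mathrm{disc}}_0(\mathcal{T}_h)$; $\Pi_1g\in\mathbb{P}^{\mathrm{cont}}_1(\mathcal{T}_h)$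 with $(\Pi_1g,\overline v)=(g,\overline v)$ for all $\overline v\in\mathbb{P}^{\mathrm{cont}}_1(\mathcal{T}_h)$ (applied componentwise to vector fields); $\Pi^h_1g\in\mathbb{P}^{\mathrm{cont}}_1(\mathcal{T}_h)$ with $(\Pi^h_1g,\overline v)_h=(g,\overline v)$ for all $\overline v\in\mathbb{P}^{\mathrm{cont}}_1(\mathcal{T}_h)$. **Forms** (differential operators are taken elementwise where needed): - $c_h(\phi,\mu,\overline{\mathbf u})=-\int_\Omega\nabla\cdot(\phi\overline{\mathbf u})\mu-\sum_{e\in\mathcal{E}_h^{\mathrm i}}\int_e(\overline{\mathbf u}\cdot\mathbf{n}_e)\{\!\{\phi\}\!\}[\![\mu]\!]$; - $a_h^{\mathrm{upw}}(\mathbf u;\phi,\overline\phi)=\sum_{e\in\mathcal{E}_h^{\mathrm i},e=K\cap L}\int_e\big((\mathbf u\cdot\mathbf n_e)_\oplus\phi_K-(\mathbf u\cdot\mathbf n_e)_\ominus\phi_L\big)[\![\overline\phi]\!]$; - $b_h^{\mathrm{upw}}(-\nabla^0_{\mathbf n}\mu;M(\phi),\overline\phi)=\sum_{e\in\mathcal{E}_h^{\mathrm i},e=K\cap L}\frac1{\mathcal{D}_e(\mathcal{T}_h)}\int_e\big([\![\Pi_0\mu]\!]_\oplus(M^\uparrow(\phi_K)+M^\downarrow(\phi_L))_\oplus-[\![\Pi_0\mu]\!]_\ominus(M^\uparrow(\phi_L)+M^\downarrow(\phi_K))_\oplus\big)[\![\overline\phi]\!]$, where $\nabla^0_{\mathbf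 n}\mu|_e=-[\![\Pi_0\mu]\!]/\mathcal{D}_e(\mathcal{T}_h)$; - $s_h^1(\mathbf u_1,\mathbf u_0,\phi_1,\phi_0,\mu,\overline{\mathbf u})=\frac12\Big\{\big(\tfrac{\rho(\phi_1)-\rho(\phi_0)}{\Delta t},\mathbf u_1\cdot\overline{\mathbf u}\big)-\big(\rho(\phi_0)\mathbf u_0-\rho_{\mathrm{dif}}M(\phi_0)\Pi_1(\nabla\mu),\nabla(\mathbf u_1\cdot\overline{\mathbf u})\big)\Big\}$; - $s_h^2(\mathbf u,\phi,\mu,\overline{\mathbf u})=-\frac12\sum_{e\in\mathcal{E}_h^{\mathrm i}}\int_e(\overline{\mathbf u}\cdot\mathbf n_e)\,\mathrm{sign}(\mathbf u\cdot\mathbf n_e)[\![\phi]\!][\![\mu]\!]$. **Scheme (one time step).** Given $\mathbf u^m\in\mathcal{U}_h$, $\phi^m\in\mathbb{P}^{\mathrm{disc}}_0(\mathcal{T}_h)$ with values in $[-1,1]$, $\mu^m\in\mathbb{P}^{\mathrm{cont}}_1(\mathcal{T}_h)$, and $\mathbf J_h^m=\rho_{\mathrm{dif}}M(\Pi^h_1\phi^m)\Pi_1(\nabla\mu^m)$, find $\mathbf u^{m+1}\in\mathcal{U}_h$, $p^{m+1}\in\mathcal{P}_h$ with $\int_\Omega p^{m+1}=0$, $\phi^{m+1}\in\mathbb{P}^{\mathrm{disc}}_0(\mathcal{T}_h)$, $\mu^{m+1}\in\mathbb{P}^{\mathrm{cont}}_1(\mathcal{T}_h)$ such that, for all $\overline{\mathbf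 u}\in\mathcal{U}_h$, $\overline p\in\mathcal{P}_h$, $\overline\phi\in\mathbb{P}^{\mathrm{disc}}_0(\mathcal{T}_h)$, $\overline\mu\in\mathbb{P}^{\mathrm{cont}}_1(\mathcal{T}_h)$: (S1) $(\rho(\Pi^h_1\phi^m)\delta_t\mathbf u^{m+1},\overline{\mathbf u})+([(\rho(\Pi^h_1\phi^m)\mathbf u^m-\mathbf J^m_h)\cdot\nabla]\mathbf u^{m+1},\overline{\mathbf u})+2(\eta(\phi^m)\mathbf D\mathbf u^{m+1},\mathbf D\overline{\mathbf u})-(p^{m+1},\nabla\cdot\overline{\mathbf u})+c_h(\phi^{m+1},\Pi_0\mu^{m+1},\overline{\mathbf u})+s_h^1(\mathbf u^{m+1},\mathbf u^m,\Pi^h_1\phi^{m+1},\Pi^h_1\phi^m,\mu^m,\overline{\mathbf u})+s_h^2(\mathbf u^{m+1},\phi^{m+1},\Pi_0\mu^{m+1},\overline{\mathbf u})=0$; (S2) $(\nabla\cdot\mathbf u^{m+1},\overline p)=0$; (S3) $(\delta_t\phi^{m+1},\overline\phi)+a_h^{\mathrm{upw}}(\mathbf u^{m+1};\phi^{m+1},\overline\phi)+b_h^{\mathrm{upw}}(-\nabla^0_{\mathbf n}\mu^{m+1};M(\phi^{m+1}),\overline\phi)=0$; (S4) $\lambda\varepsilon(\nabla\Pi^h_1\phi^{m+1},\nabla\overline\mu)+\frac\lambda\varepsilon(f(\Pi^h_1\phi^{m+1},\Pi^h_1\phi^m),\overline\mu)-(\mu^{m+1},\overline\mu)_h=0$.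 *)

theory Defs
  imports "HOL-Analysis.Analysis"
begin

section \<open>Lebesgue and Sobolev spaces on an open set\<close>

definition ip :: "(real^'d) set \<Rightarrow> (real^'d \<Rightarrow> 'b::euclidean_space) \<Rightarrow> (real^'d \<Rightarrow> 'b) \<Rightarrow> real"
  where "ip \<Omega> f g = (LINT x:\<Omega>|lebesgue. f x \<bullet> g x)"

definition L2 :: "(real^'d) set \<Rightarrow> (real^'d \<Rightarrow> 'b::euclidean_space) set"
  where "L2 \<Omega> = {f. set_borel_measurable lebesgue \<Omega> f \<and>
                    set_integrable lebesgue \<Omega> (\<lambda>x. (norm (f x))\<^sup>2)}"

definition L2_norm_on :: "(real^'d) set \<Rightarrow> (real^'d \<Rightarrow> 'b::euclidean_space) \<Rightarrow> real"
  where "L2_norm_on \<Omega> f = sqrt (ip \<Omega> f f)"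

text \<open>Weak derivatives and \<open>H\<^sup>1\<^sub>0\<close> follow the convention of Gilbarg and Trudinger: test functions
  are \<open>C\<^sup>1\<close> with compact support in the open set. The second argument is the gradient of the first.\<close>

definition test_function :: "(real^'d) set \<Rightarrow> (real^'d \<Rightarrow> real) \<Rightarrow> (real^'d \<Rightarrow> real^'d) \<Rightarrow> bool"
  where "test_function U \<psi> \<psi>' \<longleftrightarrow>
    (\<forall>x. GDERIV \<psi> x :> \<psi>' x) \<and> continuous_on UNIV \<psi>' \<and>
    compact (closure {x. \<psi> x \<noteq> 0}) \<and> closure {x. \<psi> x \<noteq> 0} \<subseteq> U"

definition has_weak_grad :: "(real^'d) set \<Rightarrow> (real^'d \<Rightarrow> real) \<Rightarrow> (real^'d \<Rightarrow> real^'d) \<Rightarrow> bool"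
  where "has_weak_grad U f g \<longleftrightarrow>
    (\<forall>C. compact C \<and> C \<subseteq> U \<longrightarrow> set_integrable lebesgue C f \<and> set_integrable lebesgue C g) \<and>
    (\<forall>\<psi> \<psi>'. test_function U \<psi> \<psi>' \<longrightarrow>
       (LINT x:U|lebesgue. f x *\<^sub>R \<psi>' x) = - (LINT x:U|lebesgue. \<psi> x *\<^sub>R g x))"

text \<open>A representative of the weak gradient; it is unique up to a null set.\<close>

definition wgrad :: "(real^'d) set \<Rightarrow> (real^'d \<Rightarrow> real) \<Rightarrow> real^'d \<Rightarrow> real^'d"
  where "wgrad U f = (SOME g. has_weak_grad U f g)"

definition H1 :: "(real^'d) set \<Rightarrow> (real^'d \<Rightarrow> real) set"
  where "H1 \<Omega> = {f \<in> L2 \<Omega>. \<exists>g \<in> L2 \<Omega>. has_weak_grad \<Omega> f g}"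

definition H1_0 :: "(real^'d) set \<Rightarrow> (real^'d \<Rightarrow> real) set"
  where "H1_0 \<Omega> = {f \<in> H1 \<Omega>. \<forall>r>0. \<exists>\<psi> \<psi>'. test_function \<Omega> \<psi> \<psi>' \<and>
      L2_norm_on \<Omega> (\<lambda>x. f x - \<psi> x) < r \<and> L2_norm_on \<Omega> (\<lambda>x. wgrad \<Omega> f x - \<psi>' x) < r}"

text \<open>Row \<open>i\<close> of \<open>jac \<Omega> u\<close> is the gradient of the component \<open>u\<^sub>i\<close>, so that the convective
  derivative \<open>(w \<cdot> \<nabla>) u\<close> is \<open>jac \<Omega> u *v w\<close>.\<close>

definition jac :: "(real^'d) set \<Rightarrow> (real^'d \<Rightarrow> real^'d) \<Rightarrow> real^'d \<Rightarrow> real^'d^'d"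
  where "jac \<Omega> u x = (\<chi> i. wgrad \<Omega> (\<lambda>y. u y $ i) x)"

definition sym_grad :: "(real^'d) set \<Rightarrow> (real^'d \<Rightarrow> real^'d) \<Rightarrow> real^'d \<Rightarrow> real^'d^'d"
  where "sym_grad \<Omega> u x = (1/2) *\<^sub>R (jac \<Omega> u x + transpose (jac \<Omega> u x))"

definition wdiv :: "(real^'d) set \<Rightarrow> (real^'d \<Rightarrow> real^'d) \<Rightarrow> real^'d \<Rightarrow> real"
  where "wdiv \<Omega> u x = trace (jac \<Omega> u x)"

definition H1_norm_on :: "(real^'d) set \<Rightarrow> (real^'d \<Rightarrow> real^'d) \<Rightarrow> real"
  where "H1_norm_on \<Omega> u = sqrt (ip \<Omega> u u + ip \<Omega> (jac \<Omega> u) (jac \<Omega> u))"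


section \<open>Domain and mesh\<close>

definition polyhedral_domain :: "(real^'d) set \<Rightarrow> bool"
  where "polyhedral_domain \<Omega> \<longleftrightarrow> \<Omega> \<noteq> {} \<and> open \<Omega> \<and> connected \<Omega> \<and> bounded \<Omega> \<and>
    (\<exists>\<F>. finite \<F> \<and> (\<forall>P\<in>\<F>. polytope P \<and> aff_dim P = int CARD('d) - 1) \<and> frontier \<Omega> = \<Union>\<F>)"

definition verts :: "(real^'d) set \<Rightarrow> (real^'d) set"
  where "verts K = {v. v extreme_point_of K}"

definition barycenter :: "(real^'d) set \<Rightarrow> real^'d"
  where "barycenter K = (\<Sum>v\<in>verts K. v) /\<^sub>R real (card (verts K))"

definition inradius :: "(real^'d) set \<Rightarrow> real"
  where "inradius K = Sup {r. \<exists>x. cball x r \<subseteq> K}"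

definition shape_regular :: "real \<Rightarrow> (real^'d) set set \<Rightarrow> bool"
  where "shape_regular \<sigma> \<T> \<longleftrightarrow> (\<forall>K\<in>\<T>. diameter K \<le> \<sigma> * inradius K)"

definition simplicial_mesh :: "(real^'d) set \<Rightarrow> (real^'d) set set \<Rightarrow> bool"
  where "simplicial_mesh \<Omega> \<T> \<longleftrightarrow> triangulation \<T> \<and> (\<forall>K\<in>\<T>. int CARD('d) simplex K) \<and>
    \<Union>\<T> = closure \<Omega> \<and> (\<forall>K\<in>\<T>. interior K \<subseteq> \<Omega>)"

definition interior_faces :: "(real^'d) set \<Rightarrow> (real^'d) set set \<Rightarrow> (real^'d) set set"
  where "interior_faces \<Omega> \<T> = {e. \<exists>K\<in>\<T>. \<exists>L\<in>\<T>. K \<noteq> L \<and> e = K \<inter> L \<and>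
     e facet_of K \<and> e facet_of L \<and> \<not> e \<subseteq> frontier \<Omega>}"

definition unit_normals :: "(real^'d) set \<Rightarrow> (real^'d) set set \<Rightarrow> ((real^'d) set \<Rightarrow> real^'d) \<Rightarrow> bool"
  where "unit_normals \<Omega> \<T> \<nu> \<longleftrightarrow> (\<forall>e\<in>interior_faces \<Omega> \<T>. norm (\<nu> e) = 1 \<and>
     (\<forall>x\<in>e. \<forall>y\<in>e. orthogonal (\<nu> e) (x - y)))"

text \<open>Interior faces \<open>e = K \<inter> L\<close> encoded as pairs \<open>(K, L)\<close>, oriented so that \<open>\<nu> e\<close> is exterior
  to \<open>K\<close> and points to \<open>L\<close>; every interior face occurs exactly once.\<close>

definition oriented_faces ::
    "(real^'d) set \<Rightarrow> (real^'d) set set \<Rightarrow> ((real^'d) set \<Rightarrow> real^'d) \<Rightarrow> ((real^'d) set \<times> (real^'d) set) set"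
  where "oriented_faces \<Omega> \<T> \<nu> = {(K, L). K \<in> \<T> \<and> L \<in> \<T> \<and> K \<noteq> L \<and>
     (K \<inter> L) facet_of K \<and> (K \<inter> L) facet_of L \<and> \<not> K \<inter> L \<subseteq> frontier \<Omega> \<and>
     (\<forall>x\<in>K. \<forall>y\<in>K \<inter> L. \<nu> (K \<inter> L) \<bullet> (x - y) \<le> 0) \<and>
     (\<forall>x\<in>L. \<forall>y\<in>K \<inter> L. \<nu> (K \<inter> L) \<bullet> (x - y) \<ge> 0)}"

definition barycenters_orthogonal :: "(real^'d) set \<Rightarrow> (real^'d) set set \<Rightarrow> bool"
  where "barycenters_orthogonal \<Omega> \<T> \<longleftrightarrow> (\<forall>K\<in>\<T>. \<forall>L\<in>\<T>. K \<noteq> L \<longrightarrow> K \<inter> L \<in> interior_faces \<Omega> \<T> \<longrightarrow>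
     (\<forall>x\<in>K \<inter> L. \<forall>y\<in>K \<inter> L. orthogonal (barycenter L - barycenter K) (x - y)))"

text \<open>Integral over a flat face \<open>e\<close> with unit normal \<open>\<nu>\<close> with respect to the surface measure:
  by Fubini, the latter is the \<open>d\<close>-dimensional Lebesgue measure on the right prism of height 1
  over \<open>e\<close>, projected orthogonally onto \<open>e\<close>.\<close>

definition face_integral :: "real^'d \<Rightarrow> (real^'d) set \<Rightarrow> (real^'d \<Rightarrow> real) \<Rightarrow> real"
  where "face_integral \<nu> e g =
    (LINT y:{x + t *\<^sub>R \<nu> | x t. x \<in> e \<and> t \<in> {0..1}}|lebesgue. g (closest_point e y))"

text \<open>Value at \<open>x\<close> of the trace on \<open>K\<close> of an elementwise defined function.\<close>

definition trace_on :: "(real^'d) set \<Rightarrow> (real^'d \<Rightarrow> real) \<Rightarrow> real^'d \<Rightarrow> real"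
  where "trace_on K v x = Lim (at x within interior K) v"

definition avg :: "(real^'d) set \<Rightarrow> (real^'d) set \<Rightarrow> (real^'d \<Rightarrow> real) \<Rightarrow> real^'d \<Rightarrow> real"
  where "avg K L v x = (trace_on K v x + trace_on L v x) / 2"

definition jump :: "(real^'d) set \<Rightarrow> (real^'d) set \<Rightarrow> (real^'d \<Rightarrow> real) \<Rightarrow> real^'d \<Rightarrow> real"
  where "jump K L v x = trace_on K v x - trace_on L v x"

text \<open>Elementwise differential operators. The interiors of the elements are disjoint, so at most
  one summand is nonzero.\<close>

definition egrad :: "(real^'d) set set \<Rightarrow> (real^'d \<Rightarrow> real) \<Rightarrow> real^'d \<Rightarrow> real^'d"
  where "egrad \<T> f x = (\<Sum>K\<in>\<T>. indicator (interior K) x *\<^sub>R wgrad (interior K) f x)"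

definition ediv :: "(real^'d) set set \<Rightarrow> (real^'d \<Rightarrow> real^'d) \<Rightarrow> real^'d \<Rightarrow> real"
  where "ediv \<T> w x = (\<Sum>i\<in>UNIV. egrad \<T> (\<lambda>y. w y $ i) x $ i)"


section \<open>Discrete spaces and projections\<close>

text \<open>The elements of the discrete spaces are represented by genuine functions: piecewise constants
  vanish off the element interiors, continuous piecewise affine functions vanish off the closure
  of the domain. This makes the representation unique.\<close>

definition P0disc :: "(real^'d) set set \<Rightarrow> (real^'d \<Rightarrow> real) set"
  where "P0disc \<T> = {v. (\<forall>K\<in>\<T>. \<exists>c. \<forall>x\<in>interior K. v x = c) \<and>
                        (\<forall>x. x \<notin> (\<Union>K\<in>\<T>. interior K) \<longrightarrow> v x = 0)}"

definition P1cont :: "(real^'d) set \<Rightarrow> (real^'d) set set \<Rightarrow> (real^'d \<Rightarrow> real) set"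
  where "P1cont \<Omega> \<T> = {v. continuous_on (closure \<Omega>) v \<and>
                          (\<forall>K\<in>\<T>. \<exists>a b. \<forall>x\<in>K. v x = a \<bullet> x + b) \<and>
                          (\<forall>x. x \<notin> closure \<Omega> \<longrightarrow> v x = 0)}"

definition fin_dim_space :: "('a \<Rightarrow> 'b::real_vector) set \<Rightarrow> bool"
  where "fin_dim_space V \<longleftrightarrow>
    (\<exists>B. finite B \<and> V = range (\<lambda>(c::('a \<Rightarrow> 'b) \<Rightarrow> real) x. \<Sum>b\<in>B. c b *\<^sub>R b x))"

text \<open>The space of pressures contains the constants, so the inf-sup condition concerns its
  elements with vanishing mean.\<close>

definition inf_sup_compatible ::
    "(real^'d) set \<Rightarrow> (real^'d \<Rightarrow> real^'d) set \<Rightarrow> (real^'d \<Rightarrow> real) set \<Rightarrow> bool"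
  where "inf_sup_compatible \<Omega> U P \<longleftrightarrow> (\<exists>\<beta>>0. \<forall>p\<in>P.
     (LINT x:\<Omega>|lebesgue. p x) = 0 \<longrightarrow> L2_norm_on \<Omega> p > 0 \<longrightarrow>
     ereal (\<beta> * L2_norm_on \<Omega> p) \<le>
       (SUP v\<in>{v\<in>U. H1_norm_on \<Omega> v > 0}. ereal (ip \<Omega> p (wdiv \<Omega> v) / H1_norm_on \<Omega> v)))"

definition lumped :: "(real^'d) set set \<Rightarrow> (real^'d \<Rightarrow> real) \<Rightarrow> (real^'d \<Rightarrow> real) \<Rightarrow> real"
  where "lumped \<T> \<phi> \<psi> = 1 / (real CARD('d) + 1) *
     (\<Sum>K\<in>\<T>. measure lebesgue K * (\<Sum>v\<in>verts K. \<phi> v * \<psi> v))"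

definition Pi0 :: "(real^'d) set \<Rightarrow> (real^'d) set set \<Rightarrow> (real^'d \<Rightarrow> real) \<Rightarrow> real^'d \<Rightarrow> real"
  where "Pi0 \<Omega> \<T> g = (THE w. w \<in> P0disc \<T> \<and> (\<forall>v\<in>P0disc \<T>. ip \<Omega> w v = ip \<Omega> g v))"

definition Pi1 :: "(real^'d) set \<Rightarrow> (real^'d) set set \<Rightarrow> (real^'d \<Rightarrow> real) \<Rightarrow> real^'d \<Rightarrow> real"
  where "Pi1 \<Omega> \<T> g = (THE w. w \<in> P1cont \<Omega> \<T> \<and> (\<forall>v\<in>P1cont \<Omega> \<T>. ip \<Omega> w v = ip \<Omega> g v))"

definition Pi1_vec ::
    "(real^'d) set \<Rightarrow> (real^'d) set set \<Rightarrow> (real^'d \<Rightarrow> real^'d) \<Rightarrow> real^'d \<Rightarrow> real^'d"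
  where "Pi1_vec \<Omega> \<T> g x = (\<chi> i. Pi1 \<Omega> \<T> (\<lambda>y. g y $ i) x)"

definition Pi1h :: "(real^'d) set \<Rightarrow> (real^'d) set set \<Rightarrow> (real^'d \<Rightarrow> real) \<Rightarrow> real^'d \<Rightarrow> real"
  where "Pi1h \<Omega> \<T> g = (THE w. w \<in> P1cont \<Omega> \<T> \<and> (\<forall>v\<in>P1cont \<Omega> \<T>. lumped \<T> w v = ip \<Omega> g v))"


section \<open>Constitutive functions\<close>

definition pos_part :: "real \<Rightarrow> real" where "pos_part v = max v 0"
definition neg_part :: "real \<Rightarrow> real" where "neg_part v = - min v 0"

definition rho_dif :: "real \<Rightarrow> real \<Rightarrow> real" where "rho_dif \<rho>\<^sub>1 \<rho>\<^sub>2 = (\<rho>\<^sub>2 - \<rho>\<^sub>1) / 2"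
definition rho :: "real \<Rightarrow> real \<Rightarrow> real \<Rightarrow> real"
  where "rho \<rho>\<^sub>1 \<rho>\<^sub>2 \<phi> = (\<rho>\<^sub>1 + \<rho>\<^sub>2) / 2 + rho_dif \<rho>\<^sub>1 \<rho>\<^sub>2 * \<phi>"

definition mob :: "real \<Rightarrow> real" where "mob \<phi> = pos_part (1 - \<phi>\<^sup>2)"
definition mob_up :: "real \<Rightarrow> real" where "mob_up z = (if z \<le> 0 then mob z else mob 0)"
definition mob_down :: "real \<Rightarrow> real" where "mob_down z = (if z \<le> 0 then 0 else mob z - mob 0)"

definition F_pot :: "real \<Rightarrow> real" where "F_pot \<phi> = 1/4 * (\<phi>\<^sup>2 - 1)\<^sup>2"
definition F_i :: "real \<Rightarrow> real" where "F_i \<phi> = \<phi>\<^sup>2 + 1/4"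
definition F_e :: "real \<Rightarrow> real" where "F_e \<phi> = 1/4 * \<phi>^4 - 3/2 * \<phi>\<^sup>2"
definition f_pot :: "real \<Rightarrow> real \<Rightarrow> real" where "f_pot \<phi>\<^sub>1 \<phi>\<^sub>0 = deriv F_i \<phi>\<^sub>1 + deriv F_e \<phi>\<^sub>0"

definition delta :: "real \<Rightarrow> ('a \<Rightarrow> 'b::real_vector) \<Rightarrow> ('a \<Rightarrow> 'b) \<Rightarrow> 'a \<Rightarrow> 'b"
  where "delta \<Delta>t v\<^sub>1 v\<^sub>0 x = (v\<^sub>1 x - v\<^sub>0 x) /\<^sub>R \<Delta>t"


section \<open>Discrete forms and energy\<close>

definition c_h :: "(real^'d) set \<Rightarrow> (real^'d) set set \<Rightarrow> ((real^'d) set \<Rightarrow> real^'d) \<Rightarrow>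
    (real^'d \<Rightarrow> real) \<Rightarrow> (real^'d \<Rightarrow> real) \<Rightarrow> (real^'d \<Rightarrow> real^'d) \<Rightarrow> real"
  where "c_h \<Omega> \<T> \<nu> \<phi> \<mu> v =
    - (LINT x:\<Omega>|lebesgue. ediv \<T> (\<lambda>y. \<phi> y *\<^sub>R v y) x * \<mu> x)
    - (\<Sum>(K, L)\<in>oriented_faces \<Omega> \<T> \<nu>. face_integral (\<nu> (K \<inter> L)) (K \<inter> L)
         (\<lambda>x. (v x \<bullet> \<nu> (K \<inter> L)) * avg K L \<phi> x * jump K L \<mu> x))"

definition a_upw :: "(real^'d) set \<Rightarrow> (real^'d) set set \<Rightarrow> ((real^'d) set \<Rightarrow> real^'d) \<Rightarrow>
    (real^'d \<Rightarrow> real^'d) \<Rightarrow> (real^'d \<Rightarrow> real) \<Rightarrow> (real^'d \<Rightarrow> real) \<Rightarrow> real"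
  where "a_upw \<Omega> \<T> \<nu> u \<phi> \<phi>' =
    (\<Sum>(K, L)\<in>oriented_faces \<Omega> \<T> \<nu>. face_integral (\<nu> (K \<inter> L)) (K \<inter> L)
       (\<lambda>x. (pos_part (u x \<bullet> \<nu> (K \<inter> L)) * trace_on K \<phi> x
            - neg_part (u x \<bullet> \<nu> (K \<inter> L)) * trace_on L \<phi> x) * jump K L \<phi>' x))"

text \<open>\<open>b_upw \<Omega> \<T> \<nu> \<mu> \<phi> \<phi>'\<close> stands for the form written with first arguments
  \<open>- \<nabla>\<^sup>0\<^sub>n \<mu>\<close> and \<open>M(\<phi>)\<close>, and test function \<open>\<phi>'\<close>.\<close>

definition b_upw :: "(real^'d) set \<Rightarrow> (real^'d) set set \<Rightarrow> ((real^'d) set \<Rightarrow> real^'d) \<Rightarrow>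
    (real^'d \<Rightarrow> real) \<Rightarrow> (real^'d \<Rightarrow> real) \<Rightarrow> (real^'d \<Rightarrow> real) \<Rightarrow> real"
  where "b_upw \<Omega> \<T> \<nu> \<mu> \<phi> \<phi>' =
    (\<Sum>(K, L)\<in>oriented_faces \<Omega> \<T> \<nu>.
       1 / dist (barycenter K) (barycenter L) * face_integral (\<nu> (K \<inter> L)) (K \<inter> L)
       (\<lambda>x. (pos_part (jump K L (Pi0 \<Omega> \<T> \<mu>) x)
              * pos_part (mob_up (trace_on K \<phi> x) + mob_down (trace_on L \<phi> x))
            - neg_part (jump K L (Pi0 \<Omega> \<T> \<mu>) x)
              * pos_part (mob_up (trace_on L \<phi> x) + mob_down (trace_on K \<phi> x))) * jump K L \<phi>' x))"

definition s1_h :: "(real^'d) set \<Rightarrow> (real^'d) set set \<Rightarrow> real \<Rightarrow> real \<Rightarrow> real \<Rightarrow>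
    (real^'d \<Rightarrow> real^'d) \<Rightarrow> (real^'d \<Rightarrow> real^'d) \<Rightarrow> (real^'d \<Rightarrow> real) \<Rightarrow> (real^'d \<Rightarrow> real) \<Rightarrow>
    (real^'d \<Rightarrow> real) \<Rightarrow> (real^'d \<Rightarrow> real^'d) \<Rightarrow> real"
  where "s1_h \<Omega> \<T> \<rho>\<^sub>1 \<rho>\<^sub>2 \<Delta>t u\<^sub>1 u\<^sub>0 \<phi>\<^sub>1 \<phi>\<^sub>0 \<mu> v = 1/2 *
    (ip \<Omega> (\<lambda>x. (rho \<rho>\<^sub>1 \<rho>\<^sub>2 (\<phi>\<^sub>1 x) - rho \<rho>\<^sub>1 \<rho>\<^sub>2 (\<phi>\<^sub>0 x)) / \<Delta>t) (\<lambda>x. u\<^sub>1 x \<bullet> v x)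
     - ip \<Omega> (\<lambda>x. rho \<rho>\<^sub>1 \<rho>\<^sub>2 (\<phi>\<^sub>0 x) *\<^sub>R u\<^sub>0 x
                 - (rho_dif \<rho>\<^sub>1 \<rho>\<^sub>2 * mob (\<phi>\<^sub>0 x)) *\<^sub>R Pi1_vec \<Omega> \<T> (egrad \<T> \<mu>) x)
            (wgrad \<Omega> (\<lambda>x. u\<^sub>1 x \<bullet> v x)))"

definition s2_h :: "(real^'d) set \<Rightarrow> (real^'d) set set \<Rightarrow> ((real^'d) set \<Rightarrow> real^'d) \<Rightarrow>
    (real^'d \<Rightarrow> real^'d) \<Rightarrow> (real^'d \<Rightarrow> real) \<Rightarrow> (real^'d \<Rightarrow> real) \<Rightarrow> (real^'d \<Rightarrow> real^'d) \<Rightarrow> real"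
  where "s2_h \<Omega> \<T> \<nu> u \<phi> \<mu> v = - 1/2 *
    (\<Sum>(K, L)\<in>oriented_faces \<Omega> \<T> \<nu>. face_integral (\<nu> (K \<inter> L)) (K \<inter> L)
       (\<lambda>x. (v x \<bullet> \<nu> (K \<inter> L)) * sgn (u x \<bullet> \<nu> (K \<inter> L)) * jump K L \<phi> x * jump K L \<mu> x))"

definition energy :: "(real^'d) set \<Rightarrow> (real^'d) set set \<Rightarrow> real \<Rightarrow> real \<Rightarrow> real \<Rightarrow> real \<Rightarrow>
    (real^'d \<Rightarrow> real^'d) \<Rightarrow> (real^'d \<Rightarrow> real) \<Rightarrow> real"
  where "energy \<Omega> \<T> \<rho>\<^sub>1 \<rho>\<^sub>2 lam \<epsilon> u \<phi> =
      (LINT x:\<Omega>|lebesgue. rho \<rho>\<^sub>1 \<rho>\<^sub>2 (\<phi> x) * ((norm (u x))\<^sup>2 / 2))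
    + lam * \<epsilon> / 2 * (LINT x:\<Omega>|lebesgue. (norm (egrad \<T> \<phi> x))\<^sup>2)
    + lam / \<epsilon> * (LINT x:\<Omega>|lebesgue. F_pot (\<phi> x))"

end

theory Submission
  imports Defs
begin

text \<open>Test the momentum equation with \<open>u\<^sub>1\<close>, the phase equation with \<open>\<Pi>\<^sub>0 \<mu>\<^sub>1\<close> and the equation for
  the chemical potential with \<open>\<delta>\<^sub>t \<Phi>\<^sub>1\<close>, and add. The gradient part of \<open>s\<^sup>1\<close> cancels the convective
  term, because \<open>\<nabla>\<bar>u\<^sub>1\<bar>\<^sup>2 = 2 (\<nabla>u\<^sub>1)\<^sup>t u\<^sub>1\<close>. Since \<open>\<phi>\<^sub>1 \<Pi>\<^sub>0 \<mu>\<^sub>1\<close> is piecewise constant, it is an admissible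
  pressure, so the volume part of \<open>c\<^sub>h\<close> vanishes and its face part together with \<open>s\<^sup>2\<close> is minus the
  upwind form of the phase equation. The time increments are polarization identities. The product rule
  for the weak gradient rests on the approximability by test functions in \<open>H\<^sup>1\<^sub>0\<close>; the divergence
  theorem on the elements is not needed.\<close>

section \<open>Weak derivatives\<close>

text \<open>The phase equation and the potential equation are coupled only through the projections.
  Because \<open>Pi1h\<close> is defined by the lumped product, testing with the increment of
  \<open>Pi1h\<close> amounts to pairing \<open>\<mu>\<^sub>1\<close> with the increment of the
  piecewise constant phase in L^2, and for a piecewise constant partner \<open>\<mu>\<^sub>1\<close>
  may be replaced by its \<open>Pi0\<close> projection. The analytic obstacle is that
  \<open>wgrad\<close> is an arbitrary choice among weak gradients. Gradients of products,
  differences and restrictions to elements are therefore comparable only almost everywhere, and only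
  once weak gradients are known to be unique; this is why the fundamental lemma of the calculus of
  variations is proved for \<open>C^1\<close> test functions. Similarly, \<open>Pi0\<close> and
  \<open>Pi1h\<close> are definite descriptions, so their defining equations become available only
  through an existence and uniqueness theorem. The convective term and the gradient part of
  \<open>s1_h\<close> are compared through integrands that agree almost everywhere, and such
  integrals coincide whether or not the integrands are integrable.\<close>

text \<open>Preimages under \<open>f\<close> and \<open>g\<close> differ only inside a null set, and
  every subset of a null set is measurable because \<open>lebesgue\<close> is complete.\<close>

lemma measurable_lebesgue_cong_AE:
  fixes f g :: "'a::euclidean_space \<Rightarrow> 'b::euclidean_space"
  assumes ae: "AE x in lebesgue. f x = g x" and g: "g \<in> borel_measurable lebesgue"
  shows "f \<in> borel_measurable lebesgue"
proof (rule measurableI)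
  fix S :: "'b set" assume S: "S \<in> sets borel"
  obtain N where N: "N \<in> null_sets lebesgue" "{x \<in> space lebesgue. f x \<noteq> g x} \<subseteq> N"
    using ae unfolding eventually_ae_filter by auto
  have sub: "f -` S \<inter> N \<in> null_sets lebesgue"
    using N(1) by (meson inf_le2 negligible_iff_null_sets negligible_subset)
  have "f -` S \<inter> space lebesgue = ((g -` S \<inter> space lebesgue) - N) \<union> (f -` S \<inter> N)"
    using N(2) by auto
  moreover have "(g -` S \<inter> space lebesgue) - N \<in> sets lebesgue"
    using N(1) measurable_sets[OF g S] by (metis null_setsD2 sets.Diff)
  ultimately show "f -` S \<inter> space lebesgue \<in> sets lebesgue"
    using null_setsD2[OF sub] by (metis sets.Un)
qed simp

lemma integrable_lebesgue_cong_AE: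
  fixes f g :: "'a::euclidean_space \<Rightarrow> 'b::euclidean_space"
  assumes ae: "AE x in lebesgue. f x = g x" and g: "integrable lebesgue g"
  shows "integrable lebesgue f"
proof -
  have "g \<in> borel_measurable lebesgue"
    using g by (rule borel_measurable_integrable)
  moreover from this have "f \<in> borel_measurable lebesgue"
    by (rule measurable_lebesgue_cong_AE[OF ae])
  ultimately show ?thesis
    using g integrable_cong_AE[OF _ _ ae] by blast
qed

text \<open>Completeness transfers integrability in both directions, so either both integrals are
  genuine or both take the default value 0. The resulting exchange rule is free of measurability
  side conditions, as suits integrands built from chosen weak gradients.\<close>

lemma integral_lebesgue_cong_AE:
  fixes f g :: "'a::euclidean_space \<Rightarrow> 'b::euclidean_space"
  assumes ae: "AE x in lebesgue. f x = g x"
  shows "integral\<^sup>L lebesgue f = integral\<^sup>L lebesgue g"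
proof (cases "integrable lebesgue g")
  case True
  then have "f \<in> borel_measurable lebesgue" "g \<in> borel_measurable lebesgue"
    using integrable_lebesgue_cong_AE[OF ae True] by (auto dest: borel_measurable_integrable)
  then show ?thesis
    using ae by (rule integral_cong_AE)
next
  case False
  have "AE x in lebesgue. g x = f x"
    using ae by eventually_elim (rule sym)
  then have "\<not> integrable lebesgue f"
    using integrable_lebesgue_cong_AE False by auto
  then show ?thesis
    using False by (simp add: not_integrable_integral_eq)
qed

lemma LINT_lebesgue_cong_AE:
  fixes f g :: "'a::euclidean_space \<Rightarrow> 'b::euclidean_space"
  assumes "AE x in lebesgue. x \<in> A \<longrightarrow> f x = g x"
  shows "(LINT x:A|lebesgue. f x) = (LINT x:A|lebesgue. g x)"
  unfolding set_lebesgue_integral_def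
  by (rule integral_lebesgue_cong_AE, use assms in eventually_elim) (auto simp: indicator_def)

lemma set_integrable_lebesgue_cong_AE:
  fixes f g :: "'a::euclidean_space \<Rightarrow> 'b::euclidean_space"
  assumes "set_integrable lebesgue A g" "AE x in lebesgue. x \<in> A \<longrightarrow> f x = g x"
  shows "set_integrable lebesgue A f"
  using assms(1) unfolding set_integrable_def
  by (rule integrable_lebesgue_cong_AE[rotated], use assms(2) in eventually_elim) (auto simp: indicator_def)

section \<open>The fundamental lemma of the calculus of variations\<close>

text \<open>Sets \<open>{q > 0}\<close> with \<open>q\<close> nonnegative and \<open>C\<^sup>1\<close> contain the half spaces and the balls and are closed
  under intersection, so they generate the Borel sets and their indicators are limits of \<open>C\<^sup>1\<close> functions.\<close>

definition positivity_set :: "'a::euclidean_space set \<Rightarrow> bool"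
  where "positivity_set V \<longleftrightarrow>
    (\<exists>q q'. (\<forall>x. GDERIV q x :> q' x) \<and> continuous_on UNIV q' \<and> (\<forall>x. q x \<ge> 0) \<and> V = {x. q x > 0})"

text \<open>The product of the two nonnegative witnesses is again \<open>C^1\<close> and is positive
  exactly where both factors are.\<close>

lemma positivity_set_Int:
  assumes "positivity_set V" "positivity_set W"
  shows "positivity_set (V \<inter> W)"
proof -
  obtain q q' where q: "\<And>x. GDERIV q x :> q' x" "continuous_on UNIV q'" "\<And>x. q x \<ge> 0" "V = {x. q x > 0}"
    using assms(1) unfolding positivity_set_def by blast
  obtain r r' where r: "\<And>x. GDERIV r x :> r' x" "continuous_on UNIV r'" "\<And>x. r x \<ge> 0" "W = {x. r x > 0}"
    using assms(2) unfolding positivity_set_def by blast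
  have c: "continuous_on UNIV q" "continuous_on UNIV r"
    using q(1) r(1) by (auto intro!: continuous_at_imp_continuous_on has_derivative_continuous simp: gderiv_def)
  show ?thesis
    unfolding positivity_set_def
  proof (intro exI conjI allI)
    show "GDERIV (\<lambda>x. q x * r x) x :> q x *\<^sub>R r' x + r x *\<^sub>R q' x" for x
      by (intro GDERIV_mult q r)
    show "V \<inter> W = {x. q x * r x > 0}"
      using q(3) r(3) by (auto simp: q(4) r(4) zero_less_mult_iff dest: leD)
  qed (use q r c in \<open>auto intro!: continuous_intros\<close>)
qed

text \<open>Squaring smooths the kink of the positive part: at 0 the difference quotient is at most
  \<open>\<bar>h\<bar>\<close> in absolute value.\<close>

lemma DERIV_pos_square: "DERIV (\<lambda>t::real. (max 0 t)\<^sup>2) t :> 2 * max 0 t"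
proof (cases "t = 0")
  case False
  have "\<forall>\<^sub>F s in nhds t. (max 0 s)\<^sup>2 = (if t > 0 then s\<^sup>2 else 0)"
  proof (cases "t > 0")
    case True
    then show ?thesis
      using eventually_nhds_in_open[of "{0<..}" t] by (auto elim!: eventually_mono)
  next
    case neg: False
    then show ?thesis
      using False eventually_nhds_in_open[of "{..<0}" t] by (auto elim!: eventually_mono)
  qed
  moreover have "DERIV (\<lambda>s. if t > 0 then s\<^sup>2 else 0) t :> 2 * max 0 t"
    by (cases "t > 0") (auto intro!: derivative_eq_intros)
  ultimately show ?thesis
    by (subst DERIV_cong_ev[OF refl _ refl])
next
  case True
  have "((\<lambda>h. (max 0 h)\<^sup>2 / h) \<longlongrightarrow> 0) (at (0::real))"
  proof (rule Lim_null_comparison[where g = abs])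
    show "\<forall>\<^sub>F h in at (0::real). norm ((max 0 h)\<^sup>2 / h) \<le> \<bar>h\<bar>"
      by (auto simp: max_def power2_eq_square)
    show "(abs \<longlongrightarrow> 0) (at (0::real))"
      using tendsto_rabs[OF tendsto_ident_at, of 0 UNIV] by simp
  qed
  then show ?thesis
    using True by (simp add: DERIV_def)
qed

text \<open>The squared positive part of \<open>g\<close> is a nonnegative \<open>C^1\<close>
  witness with the same superlevel set, so the sign condition costs nothing.\<close>

lemma positivity_set_superlevel:
  fixes g :: "'a::euclidean_space \<Rightarrow> real"
  assumes g: "\<And>x. GDERIV g x :> g' x" and g': "continuous_on UNIV g'"
  shows "positivity_set {x. g x > 0}"
  unfolding positivity_set_def
proof (intro exI conjI allI)
  have "continuous_on UNIV g"
    using g by (auto intro!: continuous_at_imp_continuous_on has_derivative_continuous simp: gderiv_def)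
  then show "continuous_on UNIV (\<lambda>x. (2 * max 0 (g x)) *\<^sub>R g' x)"
    using g' by (intro continuous_intros)
  show "GDERIV (\<lambda>x. (max 0 (g x))\<^sup>2) x :> (2 * max 0 (g x)) *\<^sub>R g' x" for x
    by (rule GDERIV_DERIV_compose[OF g DERIV_pos_square])
qed (auto simp: max_def)

lemma positivity_set_halfspace: "positivity_set {x::'a::euclidean_space. a < x \<bullet> i}"
proof -
  have "GDERIV (\<lambda>x. x \<bullet> i - a) x :> i" for x
    unfolding gderiv_def by (auto intro!: derivative_eq_intros)
  from positivity_set_superlevel[of "\<lambda>x. x \<bullet> i - a" "\<lambda>_. i", OF this] show ?thesis
    by simp
qed

lemma positivity_set_ball: 
  assumes "r > 0" shows "positivity_set (ball (c::'a::euclidean_space) r)"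
proof -
  have "GDERIV (\<lambda>x. r\<^sup>2 - (x - c) \<bullet> (x - c)) x :> (-2) *\<^sub>R (x - c)" for x
    unfolding gderiv_def by (auto intro!: derivative_eq_intros simp: inner_commute algebra_simps)
  moreover have "ball c r = {x. r\<^sup>2 - (x - c) \<bullet> (x - c) > 0}"
    using assms by (auto simp: dist_norm norm_minus_commute power2_norm_eq_inner[symmetric]
        intro: power_strict_mono dest: power2_less_imp_less)
  ultimately show ?thesis
    by (simp only:) (rule positivity_set_superlevel, auto intro!: continuous_intros)
qed

lemma open_positivity_set: "positivity_set V \<Longrightarrow> open V"
proof -
  assume "positivity_set V"
  then obtain q q' where q: "\<And>x. GDERIV q x :> q' x" "V = {x. q x > 0}"
    unfolding positivity_set_def by blast
  then have "continuous_on UNIV q" 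
    by (auto intro!: continuous_at_imp_continuous_on has_derivative_continuous simp: gderiv_def)
  then show "open V"
    unfolding q(2) by (intro open_Collect_less continuous_intros)
qed

text \<open>The functions n q / (1 + n q) are \<open>C^1\<close>, lie between 0 and 1, vanish off
  \<open>V\<close> and tend to its indicator as n grows. They are test functions because
  \<open>closure V\<close> is a compact subset of \<open>U\<close>, and the norm of \<open>h\<close>
  on \<open>closure V\<close> is the dominating function.\<close>

lemma integral_positivity_set_eq_0:
  fixes h :: "real^'d \<Rightarrow> 'b::euclidean_space"
  assumes V: "positivity_set V" and sub: "closure V \<subseteq> U" and cpt: "compact (closure V)"
    and h: "set_integrable lebesgue (closure V) h"
    and 0: "\<And>\<psi> \<psi>'. test_function U \<psi> \<psi>' \<Longrightarrow> (LINT x:U|lebesgue. \<psi> x *\<^sub>R h x) = 0"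
  shows "(LINT x:V|lebesgue. h x) = 0"
proof -
  obtain q q' where q: "\<And>x. GDERIV q x :> q' x" "continuous_on UNIV q'" "\<And>x. q x \<ge> 0" "V = {x. q x > 0}"
    using V unfolding positivity_set_def by blast
  have cq: "continuous_on UNIV q"
    using q(1) by (auto intro!: continuous_at_imp_continuous_on has_derivative_continuous simp: gderiv_def)
  define \<psi> where "\<psi> n x = 1 - inverse (1 + real n * q x)" for n x
  define \<psi>' where "\<psi>' n x = (real n * (inverse (1 + real n * q x))\<^sup>2) *\<^sub>R q' x" for n x
  have pos: "1 + real n * q x > 0" for n x
    using q(3)[of x] by (simp add: add_pos_nonneg)
  have outside: "\<psi> n x = 0" if "x \<notin> V" for n x
    using that q(3)[of x] unfolding \<psi>_def q(4) by simp
  have supp: "closure {x. \<psi> n x \<noteq> 0} \<subseteq> closure V" for n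
    using outside by (intro closure_mono) auto
  have "test_function U (\<psi> n) (\<psi>' n)" for n
    unfolding test_function_def
  proof (intro conjI allI)
    show "GDERIV (\<psi> n) x :> \<psi>' n x" for x
    proof -
      have "GDERIV (\<lambda>x. real n * q x) x :> real n *\<^sub>R q' x + q x *\<^sub>R 0"
        by (intro GDERIV_mult GDERIV_const q)
      then have "GDERIV (\<lambda>x. 1 + real n * q x) x :> 0 + real n *\<^sub>R q' x"
        by (intro GDERIV_add GDERIV_const) simp
      then have "GDERIV (\<lambda>x. 1 - inverse (1 + real n * q x)) x :> 0 - (- (inverse (1 + real n * q x))\<^sup>2 *\<^sub>R (0 + real n *\<^sub>R q' x))"
        using pos[of n x] by (intro GDERIV_diff GDERIV_const GDERIV_inverse) auto
      then show ?thesis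
        unfolding \<psi>_def \<psi>'_def by (simp add: mult.commute)
    qed
    have "1 + real n * q x \<noteq> 0" for x
      using pos[of n x] by simp
    then show "continuous_on UNIV (\<psi>' n)"
      unfolding \<psi>'_def using q(2) cq by (auto intro!: continuous_intros)
    show "compact (closure {x. \<psi> n x \<noteq> 0})"
      using closed_Int_compact[OF closed_closure cpt, of "{x. \<psi> n x \<noteq> 0}"] supp[of n] 
      by (simp add: Int_absorb2)
    show "closure {x. \<psi> n x \<noteq> 0} \<subseteq> U"
      using supp[of n] sub by blast
  qed
  from 0[OF this] have eq0: "(LINT x|lebesgue. indicator U x *\<^sub>R (\<psi> n x *\<^sub>R h x)) = 0" for n
    unfolding set_lebesgue_integral_def .
  have "(\<lambda>n. LINT x|lebesgue. indicator U x *\<^sub>R (\<psi> n x *\<^sub>R h x)) \<longlonglongrightarrow> (LINT x|lebesgue. indicator V x *\<^sub>R h x)"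
  proof (rule integral_dominated_convergence[where w = "\<lambda>x. norm (indicator (closure V) x *\<^sub>R h x)"])
    have hV: "(\<lambda>x. indicator (closure V) x *\<^sub>R h x) \<in> borel_measurable lebesgue"
      using h unfolding set_integrable_def by auto
    have Vm: "V \<in> sets lebesgue"
      using open_positivity_set[OF V] by auto
    have eqV: "indicator V x *\<^sub>R h x = indicator V x *\<^sub>R (indicator (closure V) x *\<^sub>R h x)" for x
      using closure_subset[of V] by (auto simp: indicator_def)
    show "(\<lambda>x. indicator V x *\<^sub>R h x) \<in> borel_measurable lebesgue"
      by (subst eqV) (intro borel_measurable_scaleR hV borel_measurable_indicator Vm)
    \<comment> \<open>Since \<open>\<psi> n\<close> vanishes off \<open>V\<close>, the indicator of
      \<open>U\<close> can be exchanged for that of \<open>closure V\<close>, on which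
      \<open>h\<close> is integrable.\<close>
    have eq\<psi>: "indicator U x *\<^sub>R (\<psi> n x *\<^sub>R h x) = \<psi> n x *\<^sub>R (indicator (closure V) x *\<^sub>R h x)" for n x
      using outside[of x n] sub closure_subset[of V] by (auto simp: indicator_def)
    have "1 + real n * q x \<noteq> 0" for x n
      using pos[of n x] by simp
    then have "continuous_on UNIV (\<psi> n)" for n
      unfolding \<psi>_def using cq by (auto intro!: continuous_intros)
    then have "\<psi> n \<in> borel_measurable borel" for n
      by (rule borel_measurable_continuous_onI)
    then have \<psi>m: "\<psi> n \<in> borel_measurable lebesgue" for n
      by (simp add: measurable_completion)
    show "(\<lambda>x. indicator U x *\<^sub>R (\<psi> n x *\<^sub>R h x)) \<in> borel_measurable lebesgue" for n
      by (subst eq\<psi>) (intro borel_measurable_scaleR hV \<psi>m)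
    show "integrable lebesgue (\<lambda>x. norm (indicator (closure V) x *\<^sub>R h x))"
      using h unfolding set_integrable_def by (rule integrable_norm)
    show "AE x in lebesgue. norm (indicator U x *\<^sub>R (\<psi> n x *\<^sub>R h x)) \<le> norm (indicator (closure V) x *\<^sub>R h x)" for n
    proof (rule AE_I2)
      fix x
      have "\<bar>\<psi> n x\<bar> \<le> 1"
        unfolding \<psi>_def using q(3)[of x] by (auto simp: field_simps abs_if add_pos_nonneg)
      then show "norm (indicator U x *\<^sub>R (\<psi> n x *\<^sub>R h x)) \<le> norm (indicator (closure V) x *\<^sub>R h x)"
        unfolding eq\<psi> norm_scaleR[of "\<psi> n x"] by (intro mult_left_le_one_le) auto
    qed
    show "AE x in lebesgue. (\<lambda>n. indicator U x *\<^sub>R (\<psi> n x *\<^sub>R h x)) \<longlonglongrightarrow> indicator V x *\<^sub>R h x"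
    proof (rule AE_I2)
      fix x
      have "(\<lambda>n. \<psi> n x) \<longlonglongrightarrow> indicator V x"
      proof (cases "x \<in> V")
        case True
        then have "q x > 0" using q(4) by simp
        then have "(\<lambda>n. \<psi> n x) \<longlonglongrightarrow> 1 - 0"
          unfolding \<psi>_def
          by (intro tendsto_intros tendsto_inverse_0_at_top filterlim_tendsto_add_at_top[OF tendsto_const]
              filterlim_at_top_mult_tendsto_pos[OF tendsto_const] filterlim_real_sequentially)
        then show ?thesis using True by simp
      qed (simp add: outside)
      then have "(\<lambda>n. \<psi> n x *\<^sub>R (indicator (closure V) x *\<^sub>R h x)) \<longlonglongrightarrow> indicator V x *\<^sub>R (indicator (closure V) x *\<^sub>R h x)"
        by (intro tendsto_intros)
      then show "(\<lambda>n. indicator U x *\<^sub>R (\<psi> n x *\<^sub>R h x)) \<longlonglongrightarrow> indicator V x *\<^sub>R h x"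
        unfolding eq\<psi> eqV[symmetric] .
    qed
  qed
  then show ?thesis
    unfolding eq0 set_lebesgue_integral_def using LIMSEQ_unique tendsto_const by blast
qed

lemma test_function_continuous: "test_function U \<psi> \<psi>' \<Longrightarrow> continuous_on UNIV \<psi>"
  unfolding test_function_def gderiv_def
  by (auto intro!: continuous_at_imp_continuous_on has_derivative_continuous)

lemma test_function_support: "test_function U \<psi> \<psi>' \<Longrightarrow> \<psi> x \<noteq> 0 \<Longrightarrow> x \<in> U"
  using closure_subset[of "{x. \<psi> x \<noteq> 0}"] by (auto simp: test_function_def)

text \<open>Off its closed support the function is locally zero, so uniqueness of the derivative
  forces a zero gradient.\<close>

lemma test_function_gradient_support:
  assumes "test_function U \<psi> \<psi>'" and x: "x \<notin> closure {x. \<psi> x \<noteq> 0}"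
  shows "\<psi>' x = 0"
proof -
  have "GDERIV \<psi> x :> \<psi>' x"
    using assms(1) unfolding test_function_def by blast
  moreover have "GDERIV \<psi> x :> 0"
  proof -
    have "open (- closure {x. \<psi> x \<noteq> 0})"
      by (intro open_Compl closed_closure)
    moreover have "x \<in> - closure {x. \<psi> x \<noteq> 0}"
      using x by (simp only: Compl_iff not_False_eq_True)
    moreover have "0 = \<psi> y" if "y \<in> - closure {x. \<psi> x \<noteq> 0}" for y
    proof (rule ccontr)
      assume "0 \<noteq> \<psi> y"
      then have "y \<in> {x. \<psi> x \<noteq> 0}" by simp
      from subsetD[OF closure_subset this] show False
        using that by (simp only: Compl_iff simp_thms)
    qed
    ultimately have "(\<psi> has_derivative (\<lambda>h. h \<bullet> 0)) (at x)"
      by (rule has_derivative_transform_within_open[of "\<lambda>_. 0" _ x UNIV "- closure {x. \<psi> x \<noteq> 0}", rotated]) auto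
    then show ?thesis
      unfolding gderiv_def .
  qed
  ultimately have "(\<lambda>h. h \<bullet> \<psi>' x) = (\<lambda>h. h \<bullet> 0)"
    unfolding gderiv_def by (rule has_derivative_unique)
  from fun_cong[OF this, of "\<psi>' x"] show ?thesis by simp
qed

text \<open>A countable Borel cover of finite measure keeps its measures under completion.
  Sigma-finiteness is the premise for concluding that a function with zero integral over every
  measurable set vanishes almost everywhere.\<close>

lemma sigma_finite_lebesgue: "sigma_finite_measure (lebesgue :: 'a::euclidean_space measure)"
proof
  obtain \<A> :: "'a set set" where "countable \<A>" "\<A> \<subseteq> sets lborel" "\<Union>\<A> = space lborel" "\<forall>a\<in>\<A>. emeasure lborel a \<noteq> \<infinity>"
    using sigma_finite_measure.sigma_finite_countable[OF sigma_finite_lborel] by blast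
  then show "\<exists>\<A> :: 'a set set. countable \<A> \<and> \<A> \<subseteq> sets lebesgue \<and> \<Union>\<A> = space lebesgue \<and> (\<forall>a\<in>\<A>. emeasure lebesgue a \<noteq> \<infinity>)"
    by (intro exI[of _ \<A>]) (auto simp: subset_iff)
qed

text \<open>Dynkin's pi-lambda argument: the positivity sets form an intersection-stable generator
  of the Borel sets. Cutting with \<open>B\<close>, on which \<open>h\<close> is integrable, makes
  complements and countable disjoint unions additive.\<close>

lemma LINT_positivity_sigma:
  fixes h :: "real^'d \<Rightarrow> 'b::euclidean_space"
  assumes B: "positivity_set B" and h: "set_integrable lebesgue B h"
    and 0: "\<And>V. positivity_set V \<Longrightarrow> (LINT x:V \<inter> B|lebesgue. h x) = 0"
    and A: "A \<in> sets borel"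
  shows "(LINT x:A \<inter> B|lebesgue. h x) = 0"
proof -
  have Bm: "B \<in> sets borel"
    using open_positivity_set[OF B] by auto
  have int: "set_integrable lebesgue (A \<inter> B) h" if "A \<in> sets borel" for A
    using that Bm by (intro set_integrable_subset[OF h]) auto
  define G where "G = {V :: (real^'d) set. positivity_set V}"
  have eq: "sets borel = sigma_sets UNIV G"
  proof -
    have "borel = sigma UNIV (id ` G)"
    proof (rule borel_eq_sigmaI1[OF borel_eq_halfspace_greater])
      show "X \<in> sets (sigma UNIV (id ` G))"
        if "X \<in> (\<lambda>(a, i). {x::real^'d. a < x \<bullet> i}) ` (UNIV \<times> Basis)" for X
      proof -
        have "X \<in> G"
          using that positivity_set_halfspace unfolding G_def by auto
        then show ?thesis by simp
      qed
      show "id i \<in> sets borel" if "i \<in> G" for i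
        using that open_positivity_set[of i] unfolding G_def by auto
    qed
    then show ?thesis
      by (metis id_apply image_id sets_measure_of top_greatest Pow_UNIV)
  qed
  have "Int_stable G"
    unfolding Int_stable_def G_def using positivity_set_Int by blast
  moreover have "G \<subseteq> Pow UNIV" by simp
  moreover have "A \<in> sigma_sets UNIV G" using A eq by simp
  ultimately show ?thesis
  proof (induction rule: sigma_sets_induct_disjoint)
    case (basic V)
    then show ?case using 0 unfolding G_def by simp
  next
    case empty
    then show ?case by (simp add: set_lebesgue_integral_def)
  next
    case (compl A)
    then have Am: "A \<in> sets borel" using eq by simp
    have "(LINT x:(A \<inter> B) \<union> ((UNIV - A) \<inter> B)|lebesgue. h x) 
        = (LINT x:A \<inter> B|lebesgue. h x) + (LINT x:(UNIV - A) \<inter> B|lebesgue. h x)"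
      using Am by (intro set_integral_Un int) auto
    moreover have "(A \<inter> B) \<union> ((UNIV - A) \<inter> B) = B \<inter> B" by auto
    \<comment> \<open>\<open>B\<close> is itself a positivity set, so the hypothesis taken at
      \<open>B\<close> says that the integral over the whole of \<open>B\<close> vanishes.\<close>
    ultimately show ?case
      using compl.IH 0[OF B] by simp
  next
    case (union A)
    have Am: "A i \<in> sets borel" for i using union(2) eq by auto
    have "(LINT x:(\<Union>i. A i \<inter> B)|lebesgue. h x) = (\<Sum>i. LINT x:A i \<inter> B|lebesgue. h x)"
    proof (rule lebesgue_integral_countable_add)
      show "A i \<inter> B \<in> sets lebesgue" for i
        using Am Bm by auto
      show "A i \<inter> B \<inter> (A j \<inter> B) = {}" if "i \<noteq> j" for i j
        using union(1) that unfolding disjoint_family_on_def by blast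
      show "set_integrable lebesgue (\<Union>i. A i \<inter> B) h"
        using int[of "\<Union>i. A i"] Am by (simp add: Int_UN_distrib2 Int_commute)
    qed
    then show ?case
      using union.IH by (simp add: Int_UN_distrib2 Int_commute)
  qed
qed

text \<open>The argument is local: a positivity set cut by a ball whose closed ball lies in
  \<open>U\<close> has compact closure in \<open>U\<close>, so the integrals over all Borel subsets
  of the ball vanish. The balls are then patched together.\<close>

theorem fundamental_lemma_calculus_of_variations:
  fixes h :: "real^'d \<Rightarrow> 'b::euclidean_space"
  assumes U: "open U" and h: "\<And>C. compact C \<Longrightarrow> C \<subseteq> U \<Longrightarrow> set_integrable lebesgue C h"
    and 0: "\<And>\<psi> \<psi>'. test_function U \<psi> \<psi>' \<Longrightarrow> (LINT x:U|lebesgue. \<psi> x *\<^sub>R h x) = 0"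
  shows "AE x in lebesgue. x \<in> U \<longrightarrow> h x = 0"
proof -
  have ball: "AE x in lebesgue. x \<in> ball c r \<longrightarrow> h x = 0" if "cball c r \<subseteq> U" "r > 0" for c r
  proof -
    have int: "set_integrable lebesgue (ball c r) h"
      using that by (intro set_integrable_subset[OF h[of "cball c r"]]) auto
    have borel: "(LINT x:A \<inter> ball c r|lebesgue. h x) = 0" if "A \<in> sets borel" for A
    proof (rule LINT_positivity_sigma[OF positivity_set_ball[OF \<open>r > 0\<close>] int _ that])
      fix V :: "(real^'d) set" assume V: "positivity_set V"
      have sub: "closure (V \<inter> ball c r) \<subseteq> cball c r"
        by (rule closure_minimal) auto
      then have cpt: "compact (closure (V \<inter> ball c r))"
        by (meson bounded_cball bounded_subset compact_closure bounded_Int bounded_ball)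
      have V': "positivity_set (V \<inter> ball c r)"
        by (intro positivity_set_Int V positivity_set_ball \<open>r > 0\<close>)
      have sub': "closure (V \<inter> ball c r) \<subseteq> U"
        using sub \<open>cball c r \<subseteq> U\<close> by blast
      show "(LINT x:V \<inter> ball c r|lebesgue. h x) = 0"
        by (rule integral_positivity_set_eq_0[OF V' sub' cpt h[OF cpt sub'] 0])
    qed
    have "AE x in lebesgue. indicator (ball c r) x *\<^sub>R h x = 0"
    proof (rule sigma_finite_measure.density_zero[OF sigma_finite_lebesgue])
      show "integrable lebesgue (\<lambda>x. indicator (ball c r) x *\<^sub>R h x)"
        using int unfolding set_integrable_def .
      fix A :: "(real^'d) set" assume "A \<in> sets lebesgue"
      \<comment> \<open>A Lebesgue set differs from a Borel set by a null set, which does not affect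
        the integral.\<close>
      then obtain S N N' where A: "A = S \<union> N" "N \<subseteq> N'" "N' \<in> null_sets lborel" "S \<in> sets lborel"
        by (rule sets_completionE)
      have "AE x in lborel. x \<notin> N'"
        using A(3) by (rule AE_not_in)
      then have "AE x in lebesgue. x \<notin> N'"
        by (rule AE_completion)
      then have "AE x in lebesgue. indicator A x *\<^sub>R indicator (ball c r) x *\<^sub>R h x = indicator (S \<inter> ball c r) x *\<^sub>R h x"
        by eventually_elim (use A in \<open>auto simp: indicator_def\<close>)
      then show "(LINT x:A|lebesgue. indicator (ball c r) x *\<^sub>R h x) = 0"
        using borel[of S] A(4) unfolding set_lebesgue_integral_def
        by (subst integral_lebesgue_cong_AE) auto
    qed
    then show ?thesis
      by eventually_elim (auto simp: indicator_def)
  qed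
  \<comment> \<open>By the Lindelof property countably many balls suffice, so the union of the
    exceptional sets is still null.\<close>
  define \<B> where "\<B> = {ball c r |c r. cball c r \<subseteq> U \<and> r > 0}"
  obtain \<B>' where \<B>': "\<B>' \<subseteq> \<B>" "countable \<B>'" "\<Union>\<B>' = \<Union>\<B>"
    using Lindelof[of \<B>] unfolding \<B>_def by auto
  have "U \<subseteq> \<Union>\<B>"
  proof
    fix x assume "x \<in> U"
    then obtain r where "r > 0" "cball x r \<subseteq> U"
      using U open_contains_cball by blast
    then show "x \<in> \<Union>\<B>"
      unfolding \<B>_def by (intro UnionI[of "ball x r"]) auto
  qed
  moreover have "AE x in lebesgue. \<forall>B\<in>\<B>'. x \<in> B \<longrightarrow> h x = 0"
    using \<B>' ball unfolding \<B>_def by (intro AE_ball_countable') auto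
  ultimately show ?thesis
    using \<B>'(3) by (auto elim!: eventually_mono)
qed

section \<open>Integrability against test functions and uniqueness of weak gradients\<close>

lemma has_weak_grad_locally_integrable:
  "has_weak_grad U f g \<Longrightarrow> compact C \<Longrightarrow> C \<subseteq> U \<Longrightarrow> set_integrable lebesgue C f"
  "has_weak_grad U f g \<Longrightarrow> compact C \<Longrightarrow> C \<subseteq> U \<Longrightarrow> set_integrable lebesgue C g"
  unfolding has_weak_grad_def by blast+

lemma has_weak_gradD:
  "has_weak_grad U f g \<Longrightarrow> test_function U \<psi> \<psi>' \<Longrightarrow>
    (LINT x:U|lebesgue. f x *\<^sub>R \<psi>' x) = - (LINT x:U|lebesgue. \<psi> x *\<^sub>R g x)"
  unfolding has_weak_grad_def by blast

text \<open>The factor vanishes off \<open>C\<close> and is bounded on \<open>C\<close>, so a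
  multiple of the norm of \<open>h\<close> on \<open>C\<close> dominates. The general bilinear
  product serves both a scalar test function times a field and, after flipping, a scalar times the
  gradient of a test function.\<close>

lemma set_integrable_compact_support:
  fixes h :: "real^'d \<Rightarrow> 'b::euclidean_space" and F :: "real^'d \<Rightarrow> 'b \<Rightarrow> 'c::euclidean_space"
    and \<psi> :: "real^'d \<Rightarrow> 'p::euclidean_space"
  assumes C: "compact C" "C \<subseteq> U" and h: "set_integrable lebesgue C h"
    and \<psi>: "continuous_on UNIV \<psi>" "\<And>x. x \<notin> C \<Longrightarrow> \<psi> x = 0"
    and bl: "bounded_bilinear bi" and F: "\<And>x y. F x y = bi (\<psi> x) y"
  shows "set_integrable lebesgue U (\<lambda>x. F x (h x))"
proof -
  interpret bounded_bilinear bi by fact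
  obtain K where K: "K > 0" "\<And>a b. norm (bi a b) \<le> norm a * norm b * K"
    using pos_bounded by blast
  have "compact (\<psi> ` C)"
    using C(1) \<psi>(1) by (intro compact_continuous_image) (auto intro: continuous_on_subset)
  then obtain M where M: "\<And>x. x \<in> C \<Longrightarrow> norm (\<psi> x) \<le> M" "M \<ge> 0"
    using bounded_normE compact_imp_bounded bounded_pos by (metis image_eqI less_eq_real_def)
  have eq: "indicator U x *\<^sub>R F x (h x) = bi (\<psi> x) (indicator C x *\<^sub>R h x)" for x
    using \<psi>(2)[of x] C(2) by (auto simp: indicator_def F zero_left zero_right)
  have hC: "integrable lebesgue (\<lambda>x. indicator C x *\<^sub>R h x)"
    using h unfolding set_integrable_def .
  have "integrable lebesgue (\<lambda>x. bi (\<psi> x) (indicator C x *\<^sub>R h x))"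
  proof (rule Bochner_Integration.integrable_bound)
    show "integrable lebesgue (\<lambda>x. (M * K) * norm (indicator C x *\<^sub>R h x))"
      using hC by (intro integrable_mult_right integrable_norm)
    have "\<psi> \<in> borel_measurable lebesgue"
      using \<psi>(1) by (simp add: borel_measurable_continuous_onI measurable_completion)
    moreover have "(\<lambda>x. indicator C x *\<^sub>R h x) \<in> borel_measurable lebesgue"
      using hC by auto
    moreover have "continuous_on UNIV (\<lambda>p. bi (fst p) (snd p))"
      by (intro continuous_on continuous_intros)
    ultimately show "(\<lambda>x. bi (\<psi> x) (indicator C x *\<^sub>R h x)) \<in> borel_measurable lebesgue"
      using borel_measurable_continuous_Pair[of \<psi> lebesgue "\<lambda>x. indicator C x *\<^sub>R h x" bi] by blast
    show "AE x in lebesgue. norm (bi (\<psi> x) (indicator C x *\<^sub>R h x)) \<le> norm ((M * K) * norm (indicator C x *\<^sub>R h x))"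
    proof (rule AE_I2)
      fix x
      have "norm (bi (\<psi> x) (indicator C x *\<^sub>R h x)) \<le> norm (\<psi> x) * norm (indicator C x *\<^sub>R h x) * K"
        by (rule K)
      also have "\<dots> \<le> M * norm (indicator C x *\<^sub>R h x) * K"
        using M(1)[of x] K(1) by (cases "x \<in> C") (auto intro!: mult_right_mono)
      finally show "norm (bi (\<psi> x) (indicator C x *\<^sub>R h x)) \<le> norm ((M * K) * norm (indicator C x *\<^sub>R h x))"
        using M(2) K(1) by (simp add: abs_mult mult_ac)
    qed
  qed
  then show ?thesis
    unfolding set_integrable_def eq .
qed

lemma set_integrable_test_function:
  fixes h :: "real^'d \<Rightarrow> 'b::euclidean_space"
  assumes \<psi>: "test_function U \<psi> \<psi>'"
    and h: "\<And>C. compact C \<Longrightarrow> C \<subseteq> U \<Longrightarrow> set_integrable lebesgue C h"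
  shows "set_integrable lebesgue U (\<lambda>x. \<psi> x *\<^sub>R h x)"
proof (rule set_integrable_compact_support[OF _ _ h _ _ bounded_bilinear_scaleR])
  show "\<psi> x = 0" if "x \<notin> closure {x. \<psi> x \<noteq> 0}" for x
    using that closure_subset[of "{x. \<psi> x \<noteq> 0}"] by auto
qed (use \<psi> test_function_continuous[OF \<psi>] in \<open>auto simp: test_function_def\<close>)

lemma set_integrable_test_function_gradient:
  fixes h :: "real^'d \<Rightarrow> real"
  assumes \<psi>: "test_function U \<psi> \<psi>'"
    and h: "\<And>C. compact C \<Longrightarrow> C \<subseteq> U \<Longrightarrow> set_integrable lebesgue C h"
  shows "set_integrable lebesgue U (\<lambda>x. h x *\<^sub>R \<psi>' x)"
  proof (rule set_integrable_compact_support[where F = "\<lambda>x y. y *\<^sub>R \<psi>' x", OF _ _ h _ test_function_gradient_support[OF \<psi>] bounded_bilinear.flip[OF bounded_bilinear_scaleR]])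
qed (use \<psi> in \<open>auto simp: test_function_def\<close>)

text \<open>The definition, applied to both pairs, shows that the difference of the gradients is
  annihilated by every test function; the fundamental lemma does the rest.\<close>

lemma has_weak_grad_unique:
  assumes U: "open U" and f: "has_weak_grad U f g" and f': "has_weak_grad U f' g'"
    and eq: "\<And>x. x \<in> U \<Longrightarrow> f x = f' x"
  shows "AE x in lebesgue. x \<in> U \<longrightarrow> g x = g' x"
proof -
  have "AE x in lebesgue. x \<in> U \<longrightarrow> g x - g' x = 0"
  proof (rule fundamental_lemma_calculus_of_variations[OF U])
    show "set_integrable lebesgue C (\<lambda>x. g x - g' x)" if "compact C" "C \<subseteq> U" for C
      using has_weak_grad_locally_integrable[OF f that] has_weak_grad_locally_integrable[OF f' that] by auto
    fix \<psi> \<psi>' assume \<psi>: "test_function U \<psi> \<psi>'"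
    have "(LINT x:U|lebesgue. \<psi> x *\<^sub>R (g x - g' x)) = (LINT x:U|lebesgue. \<psi> x *\<^sub>R g x) - (LINT x:U|lebesgue. \<psi> x *\<^sub>R g' x)"
      unfolding scaleR_diff_right
      using f f' by (intro set_integral_diff(2) set_integrable_test_function[OF \<psi>]) (auto intro: has_weak_grad_locally_integrable)
    moreover have "(LINT x:U|lebesgue. f x *\<^sub>R \<psi>' x) = (LINT x:U|lebesgue. f' x *\<^sub>R \<psi>' x)"
      using U eq by (intro set_lebesgue_integral_cong) auto
    ultimately show "(LINT x:U|lebesgue. \<psi> x *\<^sub>R (g x - g' x)) = 0"
      using has_weak_gradD[OF f \<psi>] has_weak_gradD[OF f' \<psi>] by simp
  qed
  then show ?thesis by simp
qed

lemma has_weak_grad_wgrad: "has_weak_grad U f g \<Longrightarrow> has_weak_grad U f (wgrad U f)"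
  unfolding wgrad_def by (rule someI[of "has_weak_grad U f"])

text \<open>The bridge from the choice operator to computation: exhibiting any weak gradient
  determines \<open>wgrad\<close> up to a null set.\<close>

lemma wgrad_AE_eq:
  "open U \<Longrightarrow> has_weak_grad U f g \<Longrightarrow> AE x in lebesgue. x \<in> U \<longrightarrow> wgrad U f x = g x"
  by (rule has_weak_grad_unique[OF _ has_weak_grad_wgrad]) auto

section \<open>Integration by parts for continuously differentiable functions\<close>

lemma set_integrable_continuous_compact:
  fixes h :: "'a::euclidean_space \<Rightarrow> 'b::euclidean_space"
  assumes "compact C" "continuous_on C h"
  shows "set_integrable lebesgue C h"
proof -
  have "integrable lborel (\<lambda>x. indicator C x *\<^sub>R h x)"
    by (rule borel_integrable_compact[OF assms])
  then show ?thesis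
    unfolding set_integrable_def using integrable_completion borel_measurable_integrable by blast
qed

lemma continuous_compact_support_integrable:
  fixes h :: "'a::euclidean_space \<Rightarrow> 'b::euclidean_space"
  assumes h: "continuous_on UNIV h" and C: "compact C" and 0: "\<And>x. x \<notin> C \<Longrightarrow> h x = 0"
  shows "integrable lborel h" "integrable lebesgue h"
proof -
  have "integrable lborel (\<lambda>x. indicator C x *\<^sub>R h x)"
    using h C by (intro borel_integrable_compact) (auto intro: continuous_on_subset)
  moreover have "indicator C x *\<^sub>R h x = h x" for x
    using 0[of x] by (cases "x \<in> C") auto
  ultimately show *: "integrable lborel h" by simp
  then show "integrable lebesgue h"
    by (simp add: integrable_completion)
qed

lemma continuous_compact_support_bounded:
  fixes h :: "'a::euclidean_space \<Rightarrow> 'b::euclidean_space"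
  assumes h: "continuous_on UNIV h" and C: "compact C" and 0: "\<And>x. x \<notin> C \<Longrightarrow> h x = 0"
  obtains M where "M > 0" "\<And>x. norm (h x) \<le> M"
proof -
  have "compact (h ` C)"
    using h C by (intro compact_continuous_image) (auto intro: continuous_on_subset)
  then obtain M where M: "M > 0" "\<forall>y\<in>h ` C. norm y \<le> M"
    using compact_imp_bounded bounded_pos by blast
  have "norm (h x) \<le> M" for x
    using M 0[of x] by (cases "x \<in> C") auto
  then show thesis using that M by blast
qed

text \<open>The difference quotients of \<open>\<psi>\<close> have integral zero by translation invariance and converge
  to the directional derivative.\<close>

lemma integral_test_function_gradient:
  assumes "test_function U \<psi> \<psi>'"
  shows "(LINT x|lebesgue. \<psi>' x) = 0"
proof -
  define C where "C = closure {x. \<psi> x \<noteq> 0}"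
  have d: "\<And>x. GDERIV \<psi> x :> \<psi>' x" and c': "continuous_on UNIV \<psi>'" and C: "compact C"
    using assms unfolding test_function_def C_def by blast+
  have c: "continuous_on UNIV \<psi>"
    using assms by (rule test_function_continuous)
  have 0: "\<psi> x = 0" if "x \<notin> C" for x
  proof (rule ccontr)
    assume "\<psi> x \<noteq> 0"
    then have "x \<in> {x. \<psi> x \<noteq> 0}" by simp
    from subsetD[OF closure_subset this] show False using that unfolding C_def by contradiction
  qed
  have zero': "\<psi>' x = 0" if "x \<notin> C" for x
    using test_function_gradient_support[OF assms] that unfolding C_def by simp
  obtain M where M: "M > 0" "\<And>x. norm (\<psi>' x) \<le> M"
    using continuous_compact_support_bounded[OF c' C zero'] by blast
  \<comment> \<open>The mean value inequality bounds all difference quotients uniformly, as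
    dominated convergence requires.\<close>
  have lip: "\<bar>\<psi> x - \<psi> y\<bar> \<le> M * norm (x - y)" for x y
  proof -
    have "onorm (\<lambda>h. h \<bullet> \<psi>' z) \<le> M" for z
    proof (rule onorm_bound)
      fix h
      have "norm (h \<bullet> \<psi>' z) \<le> norm h * norm (\<psi>' z)"
        by (simp add: Cauchy_Schwarz_ineq2)
      also have "\<dots> \<le> norm h * M"
        by (intro mult_left_mono M) auto
      finally show "norm (h \<bullet> \<psi>' z) \<le> M * norm h"
        by (simp add: mult.commute)
    qed (use M in auto)
    then have "norm (\<psi> x - \<psi> y) \<le> M * norm (x - y)"
      using d by (intro differentiable_bound[of UNIV]) (auto simp: gderiv_def)
    then show ?thesis by simp
  qed
  obtain R where R: "\<And>x. x \<in> C \<Longrightarrow> norm x \<le> R"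
    using compact_imp_bounded[OF C] bounded_iff by metis
  have int': "integrable lborel \<psi>'"
    using continuous_compact_support_integrable(1)[OF c' C zero'] .
  have int: "integrable lborel \<psi>"
    using continuous_compact_support_integrable(1)[OF c C 0] .
  have "(LINT x|lborel. \<psi>' x) \<bullet> e = 0" for e
  proof -
    define s where "s n x = real (Suc n) * (\<psi> (e /\<^sub>R real (Suc n) + x) - \<psi> x)" for n x
    have transl: "integrable lborel (\<lambda>x. \<psi> (a + x))" "(LINT x|lborel. \<psi> (a + x)) = (LINT x|lborel. \<psi> x)" for a
    proof -
      have m: "(+) a \<in> lborel \<rightarrow>\<^sub>M borel" "\<psi> \<in> borel_measurable borel"
        using c by (auto intro: borel_measurable_continuous_onI)
      show "integrable lborel (\<lambda>x. \<psi> (a + x))"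
        using integrable_distr_eq[OF m] int by (simp add: lborel_distr_plus)
      show "(LINT x|lborel. \<psi> (a + x)) = (LINT x|lborel. \<psi> x)"
        using integral_distr[OF m] by (simp add: lborel_distr_plus)
    qed
    have s0: "(LINT x|lborel. s n x) = 0" for n
      unfolding s_def using transl int by simp
    have "(\<lambda>n. LINT x|lborel. s n x) \<longlonglongrightarrow> (LINT x|lborel. e \<bullet> \<psi>' x)"
    \<comment> \<open>The shifts have length at most \<open>norm e\<close> and \<open>C\<close> lies
      in the ball of radius \<open>R\<close>, so all quotients vanish off the ball of radius
      \<open>R + norm e\<close>.\<close>
    proof (rule integral_dominated_convergence[where w = "\<lambda>x. indicator (cball 0 (R + norm e)) x *\<^sub>R (M * norm e)"])
      show "(\<lambda>x. e \<bullet> \<psi>' x) \<in> borel_measurable lborel"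
        using c' by (simp add: borel_measurable_continuous_onI continuous_on_inner)
      have "s n \<in> borel_measurable lborel" for n
        unfolding s_def using transl int by (intro borel_measurable_integrable) simp
      then show "(\<lambda>x. s n x) \<in> borel_measurable lborel" for n by simp
      show "integrable lborel (\<lambda>x. indicator (cball 0 (R + norm e)) x *\<^sub>R (M * norm e))"
        by (rule borel_integrable_compact) auto
      show "AE x in lborel. norm (s n x) \<le> indicator (cball 0 (R + norm e)) x *\<^sub>R (M * norm e)" for n
      proof (rule AE_I2)
        fix x :: "real^'a"
        have b: "norm (e /\<^sub>R real (Suc n)) \<le> norm e"
          by (simp add: field_simps mult_left_le)
        show "norm (s n x) \<le> indicator (cball 0 (R + norm e)) x *\<^sub>R (M * norm e)"
        proof (cases "x \<in> cball 0 (R + norm e)")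
          case True
          have "norm (s n x) \<le> real (Suc n) * (M * norm (e /\<^sub>R real (Suc n)))"
            using lip[of "e /\<^sub>R real (Suc n) + x" x] unfolding s_def by (simp add: abs_mult)
          also have "\<dots> = M * norm e" by simp
          finally show ?thesis using True by simp
        next
          case False
          then have "norm x > R + norm e" by simp
          moreover have "norm x \<le> norm (e /\<^sub>R real (Suc n) + x) + norm (e /\<^sub>R real (Suc n))"
            using norm_triangle_ineq4[of "e /\<^sub>R real (Suc n) + x" "e /\<^sub>R real (Suc n)"] by simp
          ultimately have "norm (e /\<^sub>R real (Suc n) + x) > R" "norm x > R"
            using b norm_ge_zero[of e] by linarith+
          then have "e /\<^sub>R real (Suc n) + x \<notin> C" "x \<notin> C"
            using R[of x] R[of "e /\<^sub>R real (Suc n) + x"] by linarith+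
          then show ?thesis
            using False 0 unfolding s_def by simp
        qed
      qed
      show "AE x in lborel. (\<lambda>n. s n x) \<longlonglongrightarrow> e \<bullet> \<psi>' x"
      proof (rule AE_I2)
        fix x :: "real^'a"
        have "((\<lambda>t. \<psi> (t *\<^sub>R e + x)) has_derivative (\<lambda>t. (t *\<^sub>R e) \<bullet> \<psi>' x)) (at 0)"
          using d[of x] unfolding gderiv_def
          by (intro has_derivative_compose[where f = "\<lambda>t. t *\<^sub>R e + x" and g = \<psi>]) (auto intro!: derivative_eq_intros)
        then have "DERIV (\<lambda>t. \<psi> (t *\<^sub>R e + x)) 0 :> e \<bullet> \<psi>' x"
          by (simp add: has_field_derivative_def mult_commute_abs)
        then have "(\<lambda>h. (\<psi> (h *\<^sub>R e + x) - \<psi> x) / h) \<midarrow>0\<rightarrow> e \<bullet> \<psi>' x"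
          by (simp add: DERIV_def)
        moreover have "filterlim (\<lambda>n. inverse (real (Suc n))) (at 0) sequentially"
          by (intro filterlim_atI LIMSEQ_inverse_real_of_nat) simp
        ultimately have "(\<lambda>n. (\<psi> (inverse (real (Suc n)) *\<^sub>R e + x) - \<psi> x) / inverse (real (Suc n))) \<longlonglongrightarrow> e \<bullet> \<psi>' x"
          by (rule filterlim_compose)
        then show "(\<lambda>n. s n x) \<longlonglongrightarrow> e \<bullet> \<psi>' x"
          unfolding s_def by (simp add: field_simps)
      qed
    qed
    then have "(LINT x|lborel. e \<bullet> \<psi>' x) = 0"
      unfolding s0 using LIMSEQ_unique tendsto_const by blast
    then show ?thesis
      using int' by (simp add: inner_commute)
  qed
  \<comment> \<open>A vector orthogonal to every \<open>e\<close> is orthogonal to itself.\<close>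
  from this[of "LINT x|lborel. \<psi>' x"] have "(LINT x|lborel. \<psi>' x) = 0"
    by simp
  moreover have "\<psi>' \<in> borel_measurable lborel"
    using c' by (simp add: borel_measurable_continuous_onI)
  ultimately show ?thesis
    by (simp add: integral_completion)
qed

text \<open>The support of the product lies in that of \<open>\<psi>\<close>, so only smoothness is
  asked of \<open>f\<close>. With \<open>f\<close> a test function as well, this also gives products
  of test functions.\<close>

lemma test_function_mult:
  assumes f: "\<And>x. GDERIV f x :> f' x" "continuous_on UNIV f'" and \<psi>: "test_function U \<psi> \<psi>'"
  shows "test_function U (\<lambda>x. f x * \<psi> x) (\<lambda>x. f x *\<^sub>R \<psi>' x + \<psi> x *\<^sub>R f' x)"
  unfolding test_function_def
proof (intro conjI allI)
  show "GDERIV (\<lambda>x. f x * \<psi> x) x :> f x *\<^sub>R \<psi>' x + \<psi> x *\<^sub>R f' x" for x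
    using \<psi> f(1) unfolding test_function_def by (intro GDERIV_mult) auto
  have "continuous_on UNIV f"
    using f(1) by (auto intro!: continuous_at_imp_continuous_on has_derivative_continuous simp: gderiv_def)
  then show "continuous_on UNIV (\<lambda>x. f x *\<^sub>R \<psi>' x + \<psi> x *\<^sub>R f' x)"
    using \<psi> f(2) test_function_continuous[OF \<psi>] unfolding test_function_def by (intro continuous_intros) auto
  have sub: "closure {x. f x * \<psi> x \<noteq> 0} \<subseteq> closure {x. \<psi> x \<noteq> 0}"
    by (intro closure_mono) auto
  then show "closure {x. f x * \<psi> x \<noteq> 0} \<subseteq> U"
    using \<psi> unfolding test_function_def by blast
  have "compact (closure {x. \<psi> x \<noteq> 0})"
    using \<psi> unfolding test_function_def by blast
  from closed_Int_compact[OF closed_closure this, of "{x. f x * \<psi> x \<noteq> 0}"]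
  show "compact (closure {x. f x * \<psi> x \<noteq> 0})"
    by (simp only: Int_absorb2[OF sub])
qed

text \<open>The product of \<open>f\<close> and a test function is again a test function, and the
  integral of its gradient is zero; this is integration by parts without a boundary.\<close>

lemma has_weak_grad_C1:
  assumes U: "open U" and f: "\<And>x. GDERIV f x :> f' x" "continuous_on UNIV f'"
  shows "has_weak_grad U f f'"
  unfolding has_weak_grad_def
proof (intro conjI allI impI)
  have cf: "continuous_on UNIV f"
    using f(1) by (auto intro!: continuous_at_imp_continuous_on has_derivative_continuous simp: gderiv_def)
  have int: "set_integrable lebesgue C f" "set_integrable lebesgue C f'" if "compact C" for C
    using that cf f(2) by (auto intro!: set_integrable_continuous_compact intro: continuous_on_subset)
  show "set_integrable lebesgue C f" "set_integrable lebesgue C f'" if "compact C \<and> C \<subseteq> U" for C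
    using that int by auto
  fix \<psi> \<psi>' assume \<psi>: "test_function U \<psi> \<psi>'"
  have i: "set_integrable lebesgue U (\<lambda>x. f x *\<^sub>R \<psi>' x)" "set_integrable lebesgue U (\<lambda>x. \<psi> x *\<^sub>R f' x)"
    using int
    by (auto intro!: set_integrable_test_function[OF \<psi>] set_integrable_test_function_gradient[OF \<psi>])
  have "(LINT x:U|lebesgue. f x *\<^sub>R \<psi>' x + \<psi> x *\<^sub>R f' x) = (LINT x|lebesgue. f x *\<^sub>R \<psi>' x + \<psi> x *\<^sub>R f' x)"
    unfolding set_lebesgue_integral_def
  proof (intro Bochner_Integration.integral_cong refl)
    fix x
    show "indicator U x *\<^sub>R (f x *\<^sub>R \<psi>' x + \<psi> x *\<^sub>R f' x) = f x *\<^sub>R \<psi>' x + \<psi> x *\<^sub>R f' x"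
    proof (cases "x \<in> U")
      case False
      then have "x \<notin> closure {x. \<psi> x \<noteq> 0}"
        using \<psi> unfolding test_function_def by blast
      then show ?thesis
        using False test_function_gradient_support[OF \<psi>] test_function_support[OF \<psi>, of x] by auto
    qed simp
  qed
  also have "\<dots> = 0"
    using integral_test_function_gradient[OF test_function_mult[OF f \<psi>]] .
  finally show "(LINT x:U|lebesgue. f x *\<^sub>R \<psi>' x) = - (LINT x:U|lebesgue. \<psi> x *\<^sub>R f' x)"
    using i by (simp add: eq_neg_iff_add_eq_0)
qed

section \<open>Elementary calculus of weak gradients\<close>

lemma has_weak_grad_cong:
  fixes f f' :: "real^'d \<Rightarrow> real"
  assumes "open U" and eq: "\<And>x. x \<in> U \<Longrightarrow> f x = f' x" and g: "has_weak_grad U f g"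
  shows "has_weak_grad U f' g"
proof -
  have "set_integrable lebesgue C f = set_integrable lebesgue C f'" if "C \<subseteq> U" for C
    using that eq by (intro set_integrable_cong) auto
  moreover have "(LINT x:U|lebesgue. f x *\<^sub>R \<psi>' x) = (LINT x:U|lebesgue. f' x *\<^sub>R \<psi>' x)" for \<psi>' :: "real^'d \<Rightarrow> real^'d"
    using eq \<open>open U\<close> by (intro set_lebesgue_integral_cong) auto
  ultimately show ?thesis
    using g unfolding has_weak_grad_def by auto
qed

lemma test_function_mono: "test_function V \<psi> \<psi>' \<Longrightarrow> V \<subseteq> U \<Longrightarrow> test_function U \<psi> \<psi>'"
  unfolding test_function_def by (auto dest: subset_trans)

text \<open>A test function of \<open>V\<close>, together with its gradient, vanishes off
  \<open>V\<close>, so testing on \<open>V\<close> is a special case of testing on \<open>U\<close>.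
  This relates gradients chosen on an element to those chosen on the whole domain.\<close>

lemma has_weak_grad_subset:
  assumes VU: "V \<subseteq> U" and g: "has_weak_grad U f g"
  shows "has_weak_grad V f g"
  unfolding has_weak_grad_def
proof (intro conjI allI impI)
  show "set_integrable lebesgue C f" "set_integrable lebesgue C g" if "compact C \<and> C \<subseteq> V" for C
    using that VU has_weak_grad_locally_integrable[OF g, of C] by auto
  fix \<psi> \<psi>' assume \<psi>: "test_function V \<psi> \<psi>'"
  have 0: "\<psi> x = 0" "\<psi>' x = 0" if "x \<notin> V" for x
  proof -
    have "x \<notin> closure {x. \<psi> x \<noteq> 0}"
      using that \<psi> unfolding test_function_def by blast
    then show "\<psi>' x = 0" "\<psi> x = 0"
      using that test_function_gradient_support[OF \<psi>] test_function_support[OF \<psi>, of x] by auto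
  qed
  have "indicator V x *\<^sub>R (f x *\<^sub>R \<psi>' x) = indicator U x *\<^sub>R (f x *\<^sub>R \<psi>' x)" 
       "indicator V x *\<^sub>R (\<psi> x *\<^sub>R g x) = indicator U x *\<^sub>R (\<psi> x *\<^sub>R g x)" for x
    using 0[of x] VU by (auto simp: indicator_def)
  then show "(LINT x:V|lebesgue. f x *\<^sub>R \<psi>' x) = - (LINT x:V|lebesgue. \<psi> x *\<^sub>R g x)"
    using has_weak_gradD[OF g test_function_mono[OF \<psi> VU]] unfolding set_lebesgue_integral_def by (simp only:)
qed

lemma has_weak_grad_add:
  assumes f: "has_weak_grad U f f'" and g: "has_weak_grad U g g'"
  shows "has_weak_grad U (\<lambda>x. f x + g x) (\<lambda>x. f' x + g' x)"
  unfolding has_weak_grad_def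
proof (intro conjI allI impI)
  show "set_integrable lebesgue C (\<lambda>x. f x + g x)" "set_integrable lebesgue C (\<lambda>x. f' x + g' x)" if "compact C \<and> C \<subseteq> U" for C
    using that has_weak_grad_locally_integrable[OF f, of C] has_weak_grad_locally_integrable[OF g, of C] by auto
  fix \<psi> \<psi>' assume \<psi>: "test_function U \<psi> \<psi>'"
  show "(LINT x:U|lebesgue. (f x + g x) *\<^sub>R \<psi>' x) = - (LINT x:U|lebesgue. \<psi> x *\<^sub>R (f' x + g' x))"
    unfolding scaleR_add_left scaleR_add_right
    using has_weak_grad_locally_integrable[OF f] has_weak_grad_locally_integrable[OF g]
    by (subst (1 2) set_integral_add(2))
       (auto intro!: set_integrable_test_function[OF \<psi>] set_integrable_test_function_gradient[OF \<psi>]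
         simp: has_weak_gradD[OF f \<psi>] has_weak_gradD[OF g \<psi>])
qed

lemma has_weak_grad_cmult:
  assumes f: "has_weak_grad U f f'"
  shows "has_weak_grad U (\<lambda>x. c * f x) (\<lambda>x. c *\<^sub>R f' x)"
  unfolding has_weak_grad_def
proof (intro conjI allI impI)
  show "set_integrable lebesgue C (\<lambda>x. c * f x)" "set_integrable lebesgue C (\<lambda>x. c *\<^sub>R f' x)" if "compact C \<and> C \<subseteq> U" for C
    using that has_weak_grad_locally_integrable[OF f, of C] by auto
  fix \<psi> \<psi>' assume \<psi>: "test_function U \<psi> \<psi>'"
  have "(LINT x:U|lebesgue. (c * f x) *\<^sub>R \<psi>' x) = c *\<^sub>R (LINT x:U|lebesgue. f x *\<^sub>R \<psi>' x)"
    by (simp only: scaleR_scaleR[symmetric] set_integral_scaleR_right)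
  moreover have "(LINT x:U|lebesgue. \<psi> x *\<^sub>R (c *\<^sub>R f' x)) = c *\<^sub>R (LINT x:U|lebesgue. \<psi> x *\<^sub>R f' x)"
    by (simp only: scaleR_left_commute[of _ c] set_integral_scaleR_right)
  ultimately show "(LINT x:U|lebesgue. (c * f x) *\<^sub>R \<psi>' x) = - (LINT x:U|lebesgue. \<psi> x *\<^sub>R (c *\<^sub>R f' x))"
    using has_weak_gradD[OF f \<psi>] by simp
qed

lemma has_weak_grad_sum:
  assumes "finite I" "\<And>i. i \<in> I \<Longrightarrow> has_weak_grad U (f i) (f' i)"
  shows "has_weak_grad U (\<lambda>x. \<Sum>i\<in>I. f i x) (\<lambda>x. \<Sum>i\<in>I. f' i x)"
  using assms
proof (induction I)
  case empty
  show ?case by (simp add: has_weak_grad_def set_lebesgue_integral_def set_integrable_def)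
next
  case (insert i I)
  then show ?case by (simp add: has_weak_grad_add)
qed

section \<open>Square integrable functions and the product rule\<close>

lemma L2_iff:
  fixes f :: "real^'d \<Rightarrow> 'b::euclidean_space"
  shows "f \<in> L2 \<Omega> \<longleftrightarrow> (\<lambda>x. indicator \<Omega> x *\<^sub>R f x) \<in> borel_measurable lebesgue \<and>
    integrable lebesgue (\<lambda>x. (norm (indicator \<Omega> x *\<^sub>R f x))\<^sup>2)"
proof -
  have "indicator \<Omega> x *\<^sub>R (norm (f x))\<^sup>2 = (norm (indicator \<Omega> x *\<^sub>R f x))\<^sup>2" for x
    by (simp add: indicator_def)
  then show ?thesis
    unfolding L2_def set_borel_measurable_def set_integrable_def by simp
qed

lemma L2_add:
  fixes f g :: "real^'d \<Rightarrow> 'b::euclidean_space"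
  assumes f: "f \<in> L2 \<Omega>" and g: "g \<in> L2 \<Omega>"
  shows "(\<lambda>x. f x + g x) \<in> L2 \<Omega>"
  unfolding L2_iff
proof
  let ?f = "\<lambda>x. indicator \<Omega> x *\<^sub>R f x" and ?g = "\<lambda>x. indicator \<Omega> x *\<^sub>R g x"
  have eq: "indicator \<Omega> x *\<^sub>R (f x + g x) = ?f x + ?g x" for x
    by (simp add: scaleR_add_right)
  show m: "(\<lambda>x. indicator \<Omega> x *\<^sub>R (f x + g x)) \<in> borel_measurable lebesgue"
    unfolding eq using f g unfolding L2_iff by (intro borel_measurable_add) auto
  show "integrable lebesgue (\<lambda>x. (norm (indicator \<Omega> x *\<^sub>R (f x + g x)))\<^sup>2)"
  proof (rule Bochner_Integration.integrable_bound)
    \<comment> \<open>The factors 2 come from (a + b)^2 <= 2 a^2 + 2 b^2, which is (a - b)^2 >=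
      0.\<close>
    show "integrable lebesgue (\<lambda>x. 2 * (norm (?f x))\<^sup>2 + 2 * (norm (?g x))\<^sup>2)"
      using f g unfolding L2_iff by auto
    show "(\<lambda>x. (norm (indicator \<Omega> x *\<^sub>R (f x + g x)))\<^sup>2) \<in> borel_measurable lebesgue"
      by (intro borel_measurable_power measurable_compose[OF m borel_measurable_norm])
    show "AE x in lebesgue. norm ((norm (indicator \<Omega> x *\<^sub>R (f x + g x)))\<^sup>2) \<le> norm (2 * (norm (?f x))\<^sup>2 + 2 * (norm (?g x))\<^sup>2)"
    proof (rule AE_I2)
      fix x
      have "(norm (?f x + ?g x))\<^sup>2 \<le> (norm (?f x) + norm (?g x))\<^sup>2"
        by (intro power_mono norm_triangle_ineq) simp
      also have "\<dots> \<le> 2 * (norm (?f x))\<^sup>2 + 2 * (norm (?g x))\<^sup>2"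
        using zero_le_power2[of "norm (?f x) - norm (?g x)"] by (simp only: power2_sum power2_diff)
      finally show "norm ((norm (indicator \<Omega> x *\<^sub>R (f x + g x)))\<^sup>2) \<le> norm (2 * (norm (?f x))\<^sup>2 + 2 * (norm (?g x))\<^sup>2)"
        unfolding eq by simp
    qed
  qed
qed

text \<open>Multiplication by a bounded measurable factor enlarges the norm pointwise by at most a
  constant. Both orders of scaling, number times field and field times number, are
  instances.\<close>

lemma L2_bounded_bilinear:
  fixes f :: "real^'d \<Rightarrow> 'b::euclidean_space" and h :: "real^'d \<Rightarrow> 'c::euclidean_space"
    and bi :: "'c \<Rightarrow> 'b \<Rightarrow> 'e::euclidean_space"
  assumes bi: "bounded_bilinear bi" and f: "f \<in> L2 \<Omega>"
    and h: "h \<in> borel_measurable lebesgue" and M: "\<And>x. norm (h x) \<le> M"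
  shows "(\<lambda>x. bi (h x) (f x)) \<in> L2 \<Omega>"
  unfolding L2_iff
proof
  interpret bounded_bilinear bi by fact
  obtain K where K: "K > 0" "\<And>a b. norm (bi a b) \<le> norm a * norm b * K"
    using pos_bounded by blast
  let ?f = "\<lambda>x. indicator \<Omega> x *\<^sub>R f x"
  have eq: "indicator \<Omega> x *\<^sub>R bi (h x) (f x) = bi (h x) (?f x)" for x
    by (simp add: scaleR_right)
  have "continuous_on UNIV (\<lambda>p. bi (fst p) (snd p))"
    by (intro continuous_on continuous_intros)
  then show m: "(\<lambda>x. indicator \<Omega> x *\<^sub>R bi (h x) (f x)) \<in> borel_measurable lebesgue"
    unfolding eq using f h borel_measurable_continuous_Pair[of h lebesgue ?f bi] unfolding L2_iff by blast
  show "integrable lebesgue (\<lambda>x. (norm (indicator \<Omega> x *\<^sub>R bi (h x) (f x)))\<^sup>2)"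
  proof (rule Bochner_Integration.integrable_bound)
    show "integrable lebesgue (\<lambda>x. (M * K)\<^sup>2 * (norm (?f x))\<^sup>2)"
      using f unfolding L2_iff by auto
    show "(\<lambda>x. (norm (indicator \<Omega> x *\<^sub>R bi (h x) (f x)))\<^sup>2) \<in> borel_measurable lebesgue"
      by (intro borel_measurable_power measurable_compose[OF m borel_measurable_norm])
    show "AE x in lebesgue. norm ((norm (indicator \<Omega> x *\<^sub>R bi (h x) (f x)))\<^sup>2) \<le> norm ((M * K)\<^sup>2 * (norm (?f x))\<^sup>2)"
    proof (rule AE_I2)
      fix x
      have "norm (bi (h x) (?f x)) \<le> norm (h x) * norm (?f x) * K"
        by (rule K)
      also have "\<dots> \<le> M * norm (?f x) * K"
        using K M by (intro mult_right_mono) auto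
      finally have "(norm (bi (h x) (?f x)))\<^sup>2 \<le> (M * norm (?f x) * K)\<^sup>2"
        by (intro power_mono) auto
      also have "\<dots> = (M * K)\<^sup>2 * (norm (?f x))\<^sup>2"
        by (simp only: power_mult_distrib mult_ac)
      finally show "norm ((norm (indicator \<Omega> x *\<^sub>R bi (h x) (f x)))\<^sup>2) \<le> norm ((M * K)\<^sup>2 * (norm (?f x))\<^sup>2)"
        unfolding eq by simp
    qed
  qed
qed

lemma L2_cong_AE:
  fixes f g :: "real^'d \<Rightarrow> 'b::euclidean_space"
  assumes f: "f \<in> L2 \<Omega>" and ae: "AE x in lebesgue. x \<in> \<Omega> \<longrightarrow> g x = f x"
  shows "g \<in> L2 \<Omega>"
proof -
  have "AE x in lebesgue. indicator \<Omega> x *\<^sub>R g x = indicator \<Omega> x *\<^sub>R f x"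
    using ae by eventually_elim (auto simp: indicator_def)
  then have "(\<lambda>x. indicator \<Omega> x *\<^sub>R g x) \<in> borel_measurable lebesgue"
    by (rule measurable_lebesgue_cong_AE) (use f in \<open>simp only: L2_iff\<close>)
  moreover have "set_integrable lebesgue \<Omega> (\<lambda>x. (norm (g x))\<^sup>2)"
    using f ae unfolding L2_def by (auto intro!: set_integrable_lebesgue_cong_AE[of \<Omega> "\<lambda>x. (norm (f x))\<^sup>2"])
  ultimately show ?thesis
    unfolding L2_def set_borel_measurable_def by simp
qed

lemma L2_compact_support:
  fixes h :: "real^'d \<Rightarrow> 'b::euclidean_space"
  assumes h: "continuous_on UNIV h" and C: "compact C" "\<And>x. x \<notin> C \<Longrightarrow> h x = 0" and \<Omega>: "C \<subseteq> \<Omega>"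
  shows "h \<in> L2 \<Omega>"
proof -
  have eq: "indicator \<Omega> x *\<^sub>R h x = h x" for x
    using C(2)[of x] \<Omega> by (auto simp: indicator_def)
  have "integrable lebesgue (\<lambda>x. (norm (h x))\<^sup>2)"
    using h C(2) by (intro continuous_compact_support_integrable(2)[OF _ C(1)] continuous_intros) auto
  moreover have "h \<in> borel_measurable lebesgue"
    using h by (simp add: borel_measurable_continuous_onI measurable_completion)
  ultimately show ?thesis
    unfolding L2_iff eq by blast
qed

lemma test_function_L2:
  assumes "test_function U \<psi> \<psi>'"
  shows "\<psi> \<in> L2 U" "\<psi>' \<in> L2 U"
proof -
  have C: "compact (closure {x. \<psi> x \<noteq> 0})" "closure {x. \<psi> x \<noteq> 0} \<subseteq> U" "continuous_on UNIV \<psi>'"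
    using assms unfolding test_function_def by blast+
  have "\<psi> x = 0" if "x \<notin> closure {x. \<psi> x \<noteq> 0}" for x
    using that closure_subset[of "{x. \<psi> x \<noteq> 0}"] by auto
  then show "\<psi> \<in> L2 U"
    using L2_compact_support[OF test_function_continuous[OF assms] C(1) _ C(2)] by blast
  show "\<psi>' \<in> L2 U"
    by (rule L2_compact_support[OF C(3) C(1) test_function_gradient_support[OF assms] C(2)])
qed

lemma L2_minus:
  fixes f g :: "real^'d \<Rightarrow> 'b::euclidean_space"
  assumes "f \<in> L2 \<Omega>" "g \<in> L2 \<Omega>"
  shows "(\<lambda>x. f x - g x) \<in> L2 \<Omega>"
proof -
  have "(\<lambda>x. - g x) \<in> L2 \<Omega>"
    using L2_bounded_bilinear[OF bounded_bilinear_scaleR assms(2), of "\<lambda>_. -1" 1] by simp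
  from L2_add[OF assms(1) this] show ?thesis by simp
qed

lemma L2_scaleR_integrable:
  fixes f :: "real^'d \<Rightarrow> real" and g :: "real^'d \<Rightarrow> 'c::euclidean_space"
  assumes f: "f \<in> L2 \<Omega>" and g: "g \<in> L2 \<Omega>"
  shows "set_integrable lebesgue \<Omega> (\<lambda>x. f x *\<^sub>R g x)"
  unfolding set_integrable_def
proof (rule Bochner_Integration.integrable_bound)
  let ?f = "\<lambda>x. indicator \<Omega> x *\<^sub>R f x" and ?g = "\<lambda>x. indicator \<Omega> x *\<^sub>R g x"
  have eq: "indicator \<Omega> x *\<^sub>R (f x *\<^sub>R g x) = ?f x *\<^sub>R ?g x" for x
    by (simp add: indicator_def)
  show "integrable lebesgue (\<lambda>x. (norm (?f x))\<^sup>2 + (norm (?g x))\<^sup>2)"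
    using f g unfolding L2_iff by (intro Bochner_Integration.integrable_add) auto
  show "(\<lambda>x. indicator \<Omega> x *\<^sub>R (f x *\<^sub>R g x)) \<in> borel_measurable lebesgue"
    unfolding eq using borel_measurable_scaleR[OF conjunct1[OF f[unfolded L2_iff]] conjunct1[OF g[unfolded L2_iff]]] .
  show "AE x in lebesgue. norm (indicator \<Omega> x *\<^sub>R (f x *\<^sub>R g x)) \<le> norm ((norm (?f x))\<^sup>2 + (norm (?g x))\<^sup>2)"
  proof (rule AE_I2)
    fix x
    have "norm (?f x) * norm (?g x) \<le> (norm (?f x))\<^sup>2 + (norm (?g x))\<^sup>2"
      using sum_squares_bound[of "norm (?f x)" "norm (?g x)"] mult_nonneg_nonneg[OF norm_ge_zero[of "?f x"] norm_ge_zero[of "?g x"]] 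
      by linarith
    then show "norm (indicator \<Omega> x *\<^sub>R (f x *\<^sub>R g x)) \<le> norm ((norm (?f x))\<^sup>2 + (norm (?g x))\<^sup>2)"
      unfolding eq norm_scaleR[of "?f x"] by simp
  qed
qed

lemma L2_norm_on_less:
  fixes f :: "real^'d \<Rightarrow> 'b::euclidean_space"
  assumes "L2_norm_on \<Omega> f < r" "r > 0"
  shows "(LINT x:\<Omega>|lebesgue. (norm (f x))\<^sup>2) < r\<^sup>2"
proof -
  have "sqrt (LINT x:\<Omega>|lebesgue. (norm (f x))\<^sup>2) < r"
    using assms(1) unfolding L2_norm_on_def ip_def power2_norm_eq_inner .
  then show ?thesis
    using assms(2) by (metis real_sqrt_less_iff real_sqrt_abs abs_of_pos)
qed

text \<open>The inequality \<open>2 a b \<le> s a\<^sup>2 + b\<^sup>2 / s\<close> replaces that of Cauchy and Schwarz.\<close>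

lemma L2_product_bound:
  fixes f :: "real^'d \<Rightarrow> real" and g :: "real^'d \<Rightarrow> 'c::euclidean_space"
  assumes f: "f \<in> L2 \<Omega>" and g: "g \<in> L2 \<Omega>" and s: "s > 0"
  shows "norm (LINT x:\<Omega>|lebesgue. f x *\<^sub>R g x) \<le>
    s / 2 * (LINT x:\<Omega>|lebesgue. (norm (f x))\<^sup>2) + (LINT x:\<Omega>|lebesgue. (norm (g x))\<^sup>2) / (2 * s)"
proof -
  have i: "set_integrable lebesgue \<Omega> (\<lambda>x. (norm (f x))\<^sup>2)" "set_integrable lebesgue \<Omega> (\<lambda>x. (norm (g x))\<^sup>2)"
    using f g unfolding L2_def by auto
  have fg: "set_integrable lebesgue \<Omega> (\<lambda>x. norm (f x *\<^sub>R g x))"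
    by (intro set_integrable_norm L2_scaleR_integrable f g)
  have "norm (LINT x:\<Omega>|lebesgue. f x *\<^sub>R g x) \<le> (LINT x:\<Omega>|lebesgue. norm (f x *\<^sub>R g x))"
    by (intro set_integral_norm_bound L2_scaleR_integrable f g)
  also have "\<dots> \<le> (LINT x:\<Omega>|lebesgue. s / 2 * (norm (f x))\<^sup>2 + (norm (g x))\<^sup>2 / (2 * s))"
  proof (rule set_integral_mono)
    show "set_integrable lebesgue \<Omega> (\<lambda>x. norm (f x *\<^sub>R g x))" by fact
    show "set_integrable lebesgue \<Omega> (\<lambda>x. s / 2 * (norm (f x))\<^sup>2 + (norm (g x))\<^sup>2 / (2 * s))"
      using i by (intro set_integral_add(1)) auto
    fix x
    have "0 \<le> (s * norm (f x) - norm (g x))\<^sup>2 / (2 * s)"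
      using s by simp
    also have "\<dots> = s / 2 * (norm (f x))\<^sup>2 + (norm (g x))\<^sup>2 / (2 * s) - norm (f x *\<^sub>R g x)"
      using s by (simp add: power2_eq_square field_simps)
    finally show "norm (f x *\<^sub>R g x) \<le> s / 2 * (norm (f x))\<^sup>2 + (norm (g x))\<^sup>2 / (2 * s)" by simp
  qed
  also have "\<dots> = s / 2 * (LINT x:\<Omega>|lebesgue. (norm (f x))\<^sup>2) + (LINT x:\<Omega>|lebesgue. (norm (g x))\<^sup>2) / (2 * s)"
    using i by (subst set_integral_add(2)) auto
  finally show ?thesis .
qed

text \<open>\<open>H1\<close> only promises that some weak gradient is square integrable; the chosen
  one agrees with it almost everywhere and so inherits this.\<close>

lemma H1_wgrad:
  assumes "open \<Omega>" "f \<in> H1 \<Omega>"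
  shows "f \<in> L2 \<Omega>" "wgrad \<Omega> f \<in> L2 \<Omega>" "has_weak_grad \<Omega> f (wgrad \<Omega> f)"
proof -
  obtain g where g: "g \<in> L2 \<Omega>" "has_weak_grad \<Omega> f g" and f: "f \<in> L2 \<Omega>"
    using assms(2) unfolding H1_def by blast
  show "has_weak_grad \<Omega> f (wgrad \<Omega> f)"
    by (rule has_weak_grad_wgrad[OF g(2)])
  show "wgrad \<Omega> f \<in> L2 \<Omega>"
    by (rule L2_cong_AE[OF g(1) wgrad_AE_eq[OF assms(1) g(2)]])
  show "f \<in> L2 \<Omega>" by (rule f)
qed

lemma H1_0_subset_H1: "H1_0 \<Omega> \<subseteq> H1 \<Omega>"
  unfolding H1_0_def by blast

text \<open>Multiplying the test function by the test functions that approximate \<open>g\<close> reduces the product rule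
  to the definition of the weak gradient of \<open>f\<close>, without regularization.\<close>

theorem has_weak_grad_mult:
  assumes \<Omega>: "open \<Omega>" and f: "f \<in> H1 \<Omega>" and g: "g \<in> H1_0 \<Omega>"
  shows "has_weak_grad \<Omega> (\<lambda>x. f x * g x) (\<lambda>x. f x *\<^sub>R wgrad \<Omega> g x + g x *\<^sub>R wgrad \<Omega> f x)"
  unfolding has_weak_grad_def
proof (intro conjI allI impI)
  note F = H1_wgrad[OF \<Omega> f]
  note G = H1_wgrad[OF \<Omega> subsetD[OF H1_0_subset_H1 g]]
  have if1: "set_integrable lebesgue \<Omega> (\<lambda>x. f x * g x)"
    using L2_scaleR_integrable[OF F(1) G(1)] by simp
  have if2: "set_integrable lebesgue \<Omega> (\<lambda>x. f x *\<^sub>R wgrad \<Omega> g x + g x *\<^sub>R wgrad \<Omega> f x)"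
    by (intro set_integral_add(1) L2_scaleR_integrable F G)
  fix C assume C: "compact C \<and> C \<subseteq> \<Omega>"
  then have "C \<in> sets lebesgue"
    using lmeasurable_compact fmeasurableD by blast
  then show "set_integrable lebesgue C (\<lambda>x. f x * g x)"
      "set_integrable lebesgue C (\<lambda>x. f x *\<^sub>R wgrad \<Omega> g x + g x *\<^sub>R wgrad \<Omega> f x)"
    using C if1 if2 by (auto intro: set_integrable_subset)
next
  note F = H1_wgrad[OF \<Omega> f]
  note G = H1_wgrad[OF \<Omega> subsetD[OF H1_0_subset_H1 g]]
  fix \<psi> \<psi>' assume \<psi>: "test_function \<Omega> \<psi> \<psi>'"
  have d: "\<And>x. GDERIV \<psi> x :> \<psi>' x" and c': "continuous_on UNIV \<psi>'" and C: "compact (closure {x. \<psi> x \<noteq> 0})"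
    using \<psi> unfolding test_function_def by blast+
  have c: "continuous_on UNIV \<psi>"
    using \<psi> by (rule test_function_continuous)
  have z: "\<psi> x = 0" if "x \<notin> closure {x. \<psi> x \<noteq> 0}" for x
    using that closure_subset[of "{x. \<psi> x \<noteq> 0}"] by auto
  obtain M where M: "\<And>x. norm (\<psi> x) \<le> M"
    using continuous_compact_support_bounded[OF c C z] by blast
  obtain M' where M': "\<And>x. norm (\<psi>' x) \<le> M'"
    using continuous_compact_support_bounded[OF c' C test_function_gradient_support[OF \<psi>]] by blast
  have m: "\<psi> \<in> borel_measurable lebesgue" "\<psi>' \<in> borel_measurable lebesgue"
    using c c' by (simp_all add: borel_measurable_continuous_onI measurable_completion)
  define h where "h x = \<psi> x * f x" for x
  define k where "k x = f x *\<^sub>R \<psi>' x + \<psi> x *\<^sub>R wgrad \<Omega> f x" for x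
  have h: "h \<in> L2 \<Omega>"
    using L2_bounded_bilinear[OF bounded_bilinear_scaleR F(1) m(1) M] unfolding h_def by simp
  have k: "k \<in> L2 \<Omega>"
    unfolding k_def
    by (intro L2_add L2_bounded_bilinear[OF bounded_bilinear_scaleR F(2) m(1) M] 
        L2_bounded_bilinear[OF bounded_bilinear.flip[OF bounded_bilinear_scaleR] F(1) m(2) M'])
  have gk: "set_integrable lebesgue \<Omega> (\<lambda>x. g x *\<^sub>R k x)"
    by (rule L2_scaleR_integrable[OF G(1) k])
  have hg: "set_integrable lebesgue \<Omega> (\<lambda>x. h x *\<^sub>R wgrad \<Omega> g x)"
    by (rule L2_scaleR_integrable[OF h G(2)])
  \<comment> \<open>\<open>k\<close> is the formal gradient of \<open>h\<close>, so
    \<open>X = 0\<close> is integration by parts between \<open>h\<close> and \<open>g\<close>.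
    Expanding \<open>k\<close> turns the integrand of \<open>X\<close> into the sum of the two
    integrands of the claim.\<close>
  define X where "X = (LINT x:\<Omega>|lebesgue. h x *\<^sub>R wgrad \<Omega> g x) + (LINT x:\<Omega>|lebesgue. g x *\<^sub>R k x)"
  define H where "H = (LINT x:\<Omega>|lebesgue. (norm (h x))\<^sup>2) / 2 + (LINT x:\<Omega>|lebesgue. (norm (k x))\<^sup>2) / 2"
  have H: "H \<ge> 0"
    unfolding H_def set_lebesgue_integral_def by simp
  \<comment> \<open>With a test function \<open>\<zeta>\<close> in place of \<open>g\<close> the
    quantity is exactly zero, because the product of \<open>\<psi>\<close> and
    \<open>\<zeta>\<close> may be used to test the weak gradient of \<open>f\<close>. Only the two
    approximation errors remain.\<close>
  have bound: "norm X \<le> r * (H + 1)" if r: "r > 0" for r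
  proof -
    obtain \<zeta> \<zeta>' where \<zeta>: "test_function \<Omega> \<zeta> \<zeta>'"
      and less: "L2_norm_on \<Omega> (\<lambda>x. g x - \<zeta> x) < r" "L2_norm_on \<Omega> (\<lambda>x. wgrad \<Omega> g x - \<zeta>' x) < r"
      using g r unfolding H1_0_def by blast
    note T = test_function_L2[OF \<zeta>]
    have "test_function \<Omega> (\<lambda>x. \<psi> x * \<zeta> x) (\<lambda>x. \<psi> x *\<^sub>R \<zeta>' x + \<zeta> x *\<^sub>R \<psi>' x)"
      by (rule test_function_mult[OF d c' \<zeta>])
    from has_weak_gradD[OF F(3) this]
    have "(LINT x:\<Omega>|lebesgue. f x *\<^sub>R (\<psi> x *\<^sub>R \<zeta>' x + \<zeta> x *\<^sub>R \<psi>' x)) = - (LINT x:\<Omega>|lebesgue. (\<psi> x * \<zeta> x) *\<^sub>R wgrad \<Omega> f x)" .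
    moreover have "f x *\<^sub>R (\<psi> x *\<^sub>R \<zeta>' x + \<zeta> x *\<^sub>R \<psi>' x) = (h x *\<^sub>R \<zeta>' x + \<zeta> x *\<^sub>R k x) - (\<psi> x * \<zeta> x) *\<^sub>R wgrad \<Omega> f x" for x
      by (simp add: h_def k_def algebra_simps)
    moreover have "set_integrable lebesgue \<Omega> (\<lambda>x. (\<psi> x * \<zeta> x) *\<^sub>R wgrad \<Omega> f x)"
    proof -
      have "(\<lambda>x. \<psi> x * \<zeta> x) \<in> L2 \<Omega>"
        using L2_bounded_bilinear[OF bounded_bilinear_scaleR T(1) m(1) M] by simp
      then show ?thesis
        by (rule L2_scaleR_integrable[OF _ F(2)])
    qed
    moreover have i: "set_integrable lebesgue \<Omega> (\<lambda>x. h x *\<^sub>R \<zeta>' x)" "set_integrable lebesgue \<Omega> (\<lambda>x. \<zeta> x *\<^sub>R k x)"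
      by (intro L2_scaleR_integrable h k T)+
    ultimately have "(LINT x:\<Omega>|lebesgue. h x *\<^sub>R \<zeta>' x) + (LINT x:\<Omega>|lebesgue. \<zeta> x *\<^sub>R k x) = 0"
      by simp
    then have "X = (LINT x:\<Omega>|lebesgue. h x *\<^sub>R (wgrad \<Omega> g x - \<zeta>' x)) + (LINT x:\<Omega>|lebesgue. (g x - \<zeta> x) *\<^sub>R k x)"
      unfolding X_def scaleR_diff_right scaleR_diff_left using hg gk i by (simp add: add_eq_0_iff)
    also have "norm \<dots> \<le> norm (LINT x:\<Omega>|lebesgue. h x *\<^sub>R (wgrad \<Omega> g x - \<zeta>' x)) + norm (LINT x:\<Omega>|lebesgue. (g x - \<zeta> x) *\<^sub>R k x)"
      by (rule norm_triangle_ineq)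
    \<comment> \<open>The weights \<open>r\<close> and \<open>inverse r\<close> are chosen so that
      both errors become proportional to \<open>r\<close>.\<close>
    also have "\<dots> \<le> (r / 2 * (LINT x:\<Omega>|lebesgue. (norm (h x))\<^sup>2) + (LINT x:\<Omega>|lebesgue. (norm (wgrad \<Omega> g x - \<zeta>' x))\<^sup>2) / (2 * r))
        + (inverse r / 2 * (LINT x:\<Omega>|lebesgue. (norm (g x - \<zeta> x))\<^sup>2) + (LINT x:\<Omega>|lebesgue. (norm (k x))\<^sup>2) / (2 * inverse r))"
      using r by (intro add_mono L2_product_bound L2_minus F G T h k) auto
    also have "\<dots> \<le> (r / 2 * (LINT x:\<Omega>|lebesgue. (norm (h x))\<^sup>2) + r\<^sup>2 / (2 * r))
        + (inverse r / 2 * r\<^sup>2 + (LINT x:\<Omega>|lebesgue. (norm (k x))\<^sup>2) / (2 * inverse r))"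
      using r L2_norm_on_less[OF less(1) r] L2_norm_on_less[OF less(2) r]
      by (intro add_mono mult_left_mono divide_right_mono order_refl) (auto simp: less_imp_le)
    also have "\<dots> = r * (H + 1)"
      using r by (simp add: H_def field_simps power2_eq_square)
    finally show ?thesis .
  qed
  have "X = 0"
  proof (rule ccontr)
    assume "X \<noteq> 0"
    then have "norm X > 0" by simp
    \<comment> \<open>The tolerance \<open>norm X / (2 * (H + 1))\<close> makes the bound half of
      \<open>norm X\<close>.\<close>
    with H have "norm X \<le> norm X / (2 * (H + 1)) * (H + 1)"
      by (intro bound) auto
    also have "\<dots> = norm X / 2"
      using H by (simp add: field_simps)
    finally show False
      using \<open>norm X > 0\<close> by simp
  qed
  have i1: "set_integrable lebesgue \<Omega> (\<lambda>x. (f x * g x) *\<^sub>R \<psi>' x)"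
  proof -
    have "set_integrable lebesgue \<Omega> (\<lambda>x. f x *\<^sub>R (g x *\<^sub>R \<psi>' x))"
      by (intro L2_scaleR_integrable F
        L2_bounded_bilinear[OF bounded_bilinear.flip[OF bounded_bilinear_scaleR] G(1) m(2) M'])
    then show ?thesis by simp
  qed
  have "(f x * g x) *\<^sub>R \<psi>' x + \<psi> x *\<^sub>R (f x *\<^sub>R wgrad \<Omega> g x + g x *\<^sub>R wgrad \<Omega> f x) = h x *\<^sub>R wgrad \<Omega> g x + g x *\<^sub>R k x" for x
    by (simp add: h_def k_def algebra_simps)
  then have eq: "\<psi> x *\<^sub>R (f x *\<^sub>R wgrad \<Omega> g x + g x *\<^sub>R wgrad \<Omega> f x) = (h x *\<^sub>R wgrad \<Omega> g x + g x *\<^sub>R k x) - (f x * g x) *\<^sub>R \<psi>' x" for x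
    by (simp add: eq_diff_eq add.commute)
  have "(LINT x:\<Omega>|lebesgue. \<psi> x *\<^sub>R (f x *\<^sub>R wgrad \<Omega> g x + g x *\<^sub>R wgrad \<Omega> f x)) = X - (LINT x:\<Omega>|lebesgue. (f x * g x) *\<^sub>R \<psi>' x)"
    unfolding eq X_def using i1 hg gk by simp
  then show "(LINT x:\<Omega>|lebesgue. (f x * g x) *\<^sub>R \<psi>' x) = - (LINT x:\<Omega>|lebesgue. \<psi> x *\<^sub>R (f x *\<^sub>R wgrad \<Omega> g x + g x *\<^sub>R wgrad \<Omega> f x))"
    using \<open>X = 0\<close> by simp
qed

section \<open>The mesh and the projections\<close>

definition function_subspace :: "('a \<Rightarrow> real) set \<Rightarrow> bool"
  where "function_subspace V \<longleftrightarrow> (\<lambda>x. 0) \<in> V \<and> (\<forall>v\<in>V. \<forall>w\<in>V. (\<lambda>x. v x + w x) \<in> V) \<and>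
    (\<forall>c. \<forall>v\<in>V. (\<lambda>x. c * v x) \<in> V)"

definition linear_form_on :: "('a \<Rightarrow> real) set \<Rightarrow> (('a \<Rightarrow> real) \<Rightarrow> real) \<Rightarrow> bool"
  where "linear_form_on V l \<longleftrightarrow> (\<forall>v\<in>V. \<forall>w\<in>V. l (\<lambda>x. v x + w x) = l v + l w) \<and>
    (\<forall>c. \<forall>v\<in>V. l (\<lambda>x. c * v x) = c * l v)"

lemma function_subspaceD:
  assumes "function_subspace V" "v \<in> V" "w \<in> V"
  shows "(\<lambda>x. v x + c * w x) \<in> V" "(\<lambda>x. c * v x) \<in> V"
  using assms unfolding function_subspace_def by simp_all

lemma linear_form_onD:
  assumes "function_subspace V" "linear_form_on V l" "v \<in> V" "w \<in> V"
  shows "l (\<lambda>x. v x + c * w x) = l v + c * l w"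
  using assms unfolding function_subspace_def linear_form_on_def by simp

text \<open>Induction on the separating set \<open>S\<close>: the functions of \<open>V\<close> that vanish at one point of \<open>S\<close> form
  a hyperplane, separated by the remaining points.\<close>

lemma riesz_representation_exists:
  fixes V :: "('a \<Rightarrow> real) set"
  assumes "finite S" and "function_subspace V" and "\<And>v. v \<in> V \<Longrightarrow> linear_form_on V (B v)"
    and "\<And>v w. v \<in> V \<Longrightarrow> w \<in> V \<Longrightarrow> B v w = B w v"
    and "\<And>v. v \<in> V \<Longrightarrow> v \<noteq> (\<lambda>x. 0) \<Longrightarrow> B v v > 0"
    and "linear_form_on V l"
    and "\<And>v. v \<in> V \<Longrightarrow> (\<And>x. x \<in> S \<Longrightarrow> v x = 0) \<Longrightarrow> v = (\<lambda>x. 0)"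
  shows "\<exists>w\<in>V. \<forall>v\<in>V. B w v = l v"
  using assms
proof (induction S arbitrary: V l rule: finite_induct)
  case empty
  have 0: "(\<lambda>x. 0) \<in> V"
    using empty.prems(1) unfolding function_subspace_def by blast
  \<comment> \<open>Here the space is trivial. Linearity at 0 + (-1) 0 shows that both forms vanish
    at the zero function.\<close>
  have "B (\<lambda>x. 0) (\<lambda>x. 0) = 0" "l (\<lambda>x. 0) = 0"
    using linear_form_onD[OF empty.prems(1) empty.prems(2)[OF 0] 0 0, of "-1"]
      linear_form_onD[OF empty.prems(1) empty.prems(5) 0 0, of "-1"] by simp_all
  then have "B (\<lambda>x. 0) (\<lambda>x. 0) = l (\<lambda>x. 0)" by simp
  moreover have "v = (\<lambda>x. 0)" if "v \<in> V" for v
    using empty.prems(6)[OF that] by simp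
  ultimately show ?case
    using 0 by metis
next
  case (insert s S)
  note V = insert.prems(1) and B = insert.prems(2) and sym = insert.prems(3) and pos = insert.prems(4)
    and l = insert.prems(5)
  show ?case
  proof (cases "\<forall>v\<in>V. v s = 0")
    case True
    show ?thesis
    proof (rule insert.IH[OF V B sym pos l])
      fix v assume "v \<in> V" "\<And>x. x \<in> S \<Longrightarrow> v x = 0"
      then show "v = (\<lambda>x. 0)"
        using True by (intro insert.prems(6)) auto
    qed
  next
    case False
    then obtain e where e: "e \<in> V" "e s \<noteq> 0" by blast
    define W where "W = {v \<in> V. v s = 0}"
    have WV: "W \<subseteq> V" unfolding W_def by blast
    have W: "function_subspace W"
      using V unfolding function_subspace_def W_def by simp
    have res: "linear_form_on W k" if "linear_form_on V k" for k
      using that WV unfolding linear_form_on_def by blast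
    have IH: "\<exists>w\<in>W. \<forall>v\<in>W. B w v = k v" if "linear_form_on V k" for k
    proof (rule insert.IH[OF W _ _ _ res[OF that]])
      fix v assume v: "v \<in> W" "\<And>x. x \<in> S \<Longrightarrow> v x = 0"
      then show "v = (\<lambda>x. 0)"
        using WV by (intro insert.prems(6)) (auto simp: W_def)
    next
      show "linear_form_on W (B v)" if "v \<in> W" for v
        using res B that WV by blast
      show "B v w = B w v" if "v \<in> W" "w \<in> W" for v w
        using sym that WV by blast
      show "B v v > 0" if "v \<in> W" "v \<noteq> (\<lambda>x. 0)" for v
        using pos that WV by blast
    qed
    obtain w where w: "w \<in> W" "\<And>v. v \<in> W \<Longrightarrow> B w v = l v"
      using IH[OF l] by blast
    obtain e' where e': "e' \<in> W" "\<And>v. v \<in> W \<Longrightarrow> B e' v = B e v"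
      using IH[OF B[OF e(1)]] by blast
    \<comment> \<open>\<open>e'\<close> is the \<open>B\<close>-orthogonal projection of
      \<open>e\<close> onto the hyperplane \<open>W\<close>, so \<open>n\<close> is a normal to
      \<open>W\<close> that takes the same nonzero value at \<open>s\<close> as
      \<open>e\<close>.\<close>
    define n where "n x = e x + (-1) * e' x" for x
    have n: "n \<in> V"
      unfolding n_def by (rule function_subspaceD[OF V]) (use e e' WV in auto)
    have ns: "n s = e s"
      using e'(1) unfolding n_def W_def by simp
    have orth: "B n v = 0" if v: "v \<in> W" for v
    proof -
      have vV: "v \<in> V" and e'V: "e' \<in> V" using v e' WV by auto
      have "B n v = B v n"
        by (rule sym[OF n vV])
      also have "\<dots> = B v e + (-1) * B v e'"
        unfolding n_def by (rule linear_form_onD[OF V B[OF vV] e(1) e'V])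
      also have "\<dots> = 0"
        using e'(2)[OF v] sym[OF vV e(1)] sym[OF vV e'V] by simp
      finally show ?thesis .
    qed
    have "n \<noteq> (\<lambda>x. 0)"
      using ns e(2) by metis
    then have nn: "B n n > 0"
      using pos[OF n] by blast
    \<comment> \<open>\<open>w\<close> already represents \<open>l\<close> on \<open>W\<close>; the
      multiple of the normal is fixed by requiring the right value at \<open>n\<close>.\<close>
    define c where "c = l n / B n n"
    define z where "z x = w x + c * n x" for x
    have wV: "w \<in> V" using w WV by blast
    have z: "z \<in> V"
      unfolding z_def by (rule function_subspaceD[OF V wV n])
    have "B z v = l v" if v: "v \<in> V" for v
    proof -
      \<comment> \<open>This is the multiple of \<open>n\<close> whose subtraction makes
        \<open>v\<close> vanish at \<open>s\<close>.\<close>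
      define t where "t = v s / e s"
      define v' where "v' x = v x + (- t) * n x" for x
      have v'V: "v' \<in> V"
        unfolding v'_def by (rule function_subspaceD[OF V v n])
      then have v': "v' \<in> W"
        using e(2) ns unfolding W_def v'_def t_def by simp
      have v_eq: "v = (\<lambda>x. v' x + t * n x)"
        unfolding v'_def by (simp add: fun_eq_iff)
      have Bz: "B z y = B w y + c * B n y" if y: "y \<in> V" for y
      proof -
        have "B z y = B y z" by (rule sym[OF z y])
        also have "\<dots> = B y w + c * B y n"
          unfolding z_def by (rule linear_form_onD[OF V B[OF y] wV n])
        finally show ?thesis using sym[OF y wV] sym[OF y n] by simp
      qed
      have "B z v = B z v' + t * B z n"
        using linear_form_onD[OF V B[OF z] v'V n] v_eq by simp
      also have "\<dots> = l v' + t * l n"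
        using Bz[OF v'V] Bz[OF n] w(2)[OF v'] orth[OF v'] orth[OF w(1)] sym[OF wV n] nn
        by (simp add: c_def)
      also have "\<dots> = l v"
        using linear_form_onD[OF V l v'V n] v_eq by simp
      finally show ?thesis .
    qed
    then show ?thesis using z by blast
  qed
qed

text \<open>Two representatives differ by some \<open>d\<close> with \<open>B d d = 0\<close>, so
  definiteness gives uniqueness. The unique form is needed to unfold the definite descriptions of
  the projections.\<close>

lemma riesz_representation:
  fixes V :: "('a \<Rightarrow> real) set"
  assumes S: "finite S" and V: "function_subspace V" and B: "\<And>v. v \<in> V \<Longrightarrow> linear_form_on V (B v)"
    and sym: "\<And>v w. v \<in> V \<Longrightarrow> w \<in> V \<Longrightarrow> B v w = B w v"
    and pos: "\<And>v. v \<in> V \<Longrightarrow> v \<noteq> (\<lambda>x. 0) \<Longrightarrow> B v v > 0"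
    and l: "linear_form_on V l"
    and sep: "\<And>v. v \<in> V \<Longrightarrow> (\<And>x. x \<in> S \<Longrightarrow> v x = 0) \<Longrightarrow> v = (\<lambda>x. 0)"
  shows "\<exists>!w. w \<in> V \<and> (\<forall>v\<in>V. B w v = l v)"
proof -
  have "w = w'" if w: "w \<in> V" "\<forall>v\<in>V. B w v = l v" and w': "w' \<in> V" "\<forall>v\<in>V. B w' v = l v" for w w'
  proof -
    define d where "d x = w x + (-1) * w' x" for x
    have d: "d \<in> V"
      unfolding d_def by (rule function_subspaceD[OF V w(1) w'(1)])
    have "B d d = B d w + (-1) * B d w'"
      using linear_form_onD[OF V B[OF d] w(1) w'(1), of "-1"] unfolding d_def .
    also have "\<dots> = 0"
      using sym[OF d w(1)] sym[OF d w'(1)] w w' d by simp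
    finally have "d = (\<lambda>x. 0)"
      using pos[OF d] by fastforce
    then show ?thesis
      unfolding d_def fun_eq_iff by simp
  qed
  then show ?thesis
    using riesz_representation_exists[OF S V B sym pos l sep] by blast
qed

section \<open>Geometry of the mesh\<close>

locale simplicial_mesh_domain =
  fixes \<Omega> :: "(real^'d) set" and \<T> :: "(real^'d) set set"
  assumes polyhedral: "polyhedral_domain \<Omega>" and simplicial: "simplicial_mesh \<Omega> \<T>"
begin

lemma open_domain: "open \<Omega>" and compact_closure_domain: "compact (closure \<Omega>)"
  using polyhedral unfolding polyhedral_domain_def by (auto simp: compact_closure)

lemma finite_mesh: "finite \<T>"
  using simplicial unfolding simplicial_mesh_def triangulation_def by blast

lemma Union_mesh: "\<Union>\<T> = closure \<Omega>"
  using simplicial unfolding simplicial_mesh_def by blast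

lemma element_simplex: "K \<in> \<T> \<Longrightarrow> int CARD('d) simplex K"
  using simplicial unfolding simplicial_mesh_def by blast

lemma element_subset_closure: "K \<in> \<T> \<Longrightarrow> K \<subseteq> closure \<Omega>"
  using Union_mesh by blast

lemma interior_element_subset: "K \<in> \<T> \<Longrightarrow> interior K \<subseteq> \<Omega>"
  using simplicial unfolding simplicial_mesh_def by blast

lemma element_convex: "K \<in> \<T> \<Longrightarrow> convex K" and element_compact: "K \<in> \<T> \<Longrightarrow> compact K"
  using element_simplex convex_simplex compact_simplex by blast+

lemma element_aff_dim: "K \<in> \<T> \<Longrightarrow> aff_dim K = int CARD('d)"
  using element_simplex aff_dim_simplex by blast

text \<open>Full affine dimension makes the relative interior, which is nonempty for a nonempty
  convex set, the interior.\<close>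

lemma interior_element_nonempty: 
  assumes "K \<in> \<T>"
  shows "interior K \<noteq> {}"
proof -
  have "affine hull K = UNIV"
    using element_aff_dim[OF assms] aff_dim_eq_full[of K] by simp
  moreover have "K \<noteq> {}"
    using element_aff_dim[OF assms] by auto
  ultimately show ?thesis
    using rel_interior_eq_empty[OF element_convex[OF assms]] rel_interior_interior[of K] by auto
qed

lemma closure_interior_element: "K \<in> \<T> \<Longrightarrow> closure (interior K) = K"
  using convex_closure_interior[OF element_convex interior_element_nonempty] element_compact compact_imp_closed closure_closed
  by metis

text \<open>Elements of a triangulation meet in common faces. A proper face has smaller dimension,
  whereas a common interior point gives the intersection full dimension.\<close>

lemma interior_element_disjoint:
  assumes K: "K \<in> \<T>" and L: "L \<in> \<T>" and x: "x \<in> interior K" "x \<in> interior L"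
  shows "K = L"
proof -
  have *: "K \<inter> L = K" if "K \<in> \<T>" "L \<in> \<T>" "x \<in> interior K" "x \<in> interior L" for K L
  proof (rule ccontr)
    assume ne: "K \<inter> L \<noteq> K"
    have "(K \<inter> L) face_of K"
      using that simplicial unfolding simplicial_mesh_def triangulation_def by blast
    from face_of_aff_dim_lt[OF element_convex[OF that(1)] this ne]
    have "aff_dim (K \<inter> L) < int CARD('d)"
      using element_aff_dim[OF that(1)] by simp
    moreover have "interior (K \<inter> L) \<noteq> {}"
      using that by auto
    then have "aff_dim (K \<inter> L) = int CARD('d)"
      using aff_dim_nonempty_interior[of "K \<inter> L"] by simp
    ultimately show False by simp
  qed
  show ?thesis
    using *[OF K L x] *[OF L K x(2,1)] by blast
qed

text \<open>The frontier of a convex set is negligible and there are finitely many elements. Hence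
  almost everywhere statements on the domain reduce to the open elements.\<close>

lemma AE_interior_element: "AE x in lebesgue. x \<in> \<Omega> \<longrightarrow> (\<exists>K\<in>\<T>. x \<in> interior K)"
proof -
  have "negligible (\<Union>K\<in>\<T>. frontier K)"
    using finite_mesh element_convex by (intro negligible_Union) (auto intro: negligible_convex_frontier)
  then have "AE x in lebesgue. x \<notin> (\<Union>K\<in>\<T>. frontier K)"
    unfolding negligible_iff_null_sets by (rule AE_not_in)
  then show ?thesis
  proof eventually_elim
    case (elim x)
    show ?case
    proof
      assume "x \<in> \<Omega>"
      then obtain K where K: "K \<in> \<T>" "x \<in> K"
        using Union_mesh closure_subset[of \<Omega>] by blast
      then have "x \<in> interior K"
        using elim closure_subset[of K] unfolding frontier_def by blast
      then show "\<exists>K\<in>\<T>. x \<in> interior K"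
        using K by blast
    qed
  qed
qed

lemma AE_domainI:
  assumes "\<And>K. K \<in> \<T> \<Longrightarrow> AE x in lebesgue. x \<in> interior K \<longrightarrow> P x"
  shows "AE x in lebesgue. x \<in> \<Omega> \<longrightarrow> P x"
proof -
  have "AE x in lebesgue. \<forall>K\<in>\<T>. x \<in> interior K \<longrightarrow> P x"
    using assms finite_mesh by (intro AE_finite_allI)
  then show ?thesis
    using AE_interior_element by eventually_elim blast
qed

lemma set_integrable_domainI:
  fixes f :: "real^'d \<Rightarrow> 'b::euclidean_space"
  assumes "\<And>K. K \<in> \<T> \<Longrightarrow> set_integrable lebesgue (interior K) f"
  shows "set_integrable lebesgue \<Omega> f"
proof -
  have "set_integrable lebesgue (\<Union>K\<in>\<T>. interior K) f"
    using finite_mesh assms by (intro set_integrable_UN) auto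
  moreover have "AE x in lebesgue. indicator \<Omega> x *\<^sub>R f x = indicator (\<Union>K\<in>\<T>. interior K) x *\<^sub>R f x"
    using AE_interior_element by eventually_elim (use interior_element_subset in \<open>auto simp: indicator_def\<close>)
  ultimately show ?thesis
    unfolding set_integrable_def by (rule integrable_lebesgue_cong_AE[rotated])
qed

lemma set_integrable_interior_element:
  fixes h :: "real^'d \<Rightarrow> 'b::euclidean_space"
  assumes "continuous_on (closure \<Omega>) h" "K \<in> \<T>"
  shows "set_integrable lebesgue (interior K) h"
proof (rule set_integrable_subset)
  show "set_integrable lebesgue K h"
    using assms element_subset_closure element_compact
    by (intro set_integrable_continuous_compact) (auto intro: continuous_on_subset)
qed (auto simp: interior_subset)

lemma set_integrable_domain_continuous:
  fixes h :: "real^'d \<Rightarrow> 'b::euclidean_space"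
  assumes "continuous_on (closure \<Omega>) h"
  shows "set_integrable lebesgue \<Omega> h"
  by (rule set_integrable_domainI) (rule set_integrable_interior_element[OF assms])

section \<open>Piecewise constant functions and the projection \<open>Pi0\<close>\<close>

lemma P0disc_const: "v \<in> P0disc \<T> \<Longrightarrow> K \<in> \<T> \<Longrightarrow> \<exists>c. \<forall>x\<in>interior K. v x = c"
  unfolding P0disc_def by blast

lemma function_subspace_P0disc: "function_subspace (P0disc \<T>)"
  unfolding function_subspace_def
proof (intro conjI ballI allI)
  show "(\<lambda>x. 0) \<in> P0disc \<T>" unfolding P0disc_def by auto
  fix v w c assume v: "v \<in> P0disc \<T>"
  then show "(\<lambda>x. c * v x) \<in> P0disc \<T>"
    unfolding P0disc_def mem_Collect_eq by (metis mult_zero_right)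
  assume w: "w \<in> P0disc \<T>"
  with v show "(\<lambda>x. v x + w x) \<in> P0disc \<T>"
    unfolding P0disc_def mem_Collect_eq by (metis add.right_neutral)
qed

lemma P0disc_mult: "v \<in> P0disc \<T> \<Longrightarrow> w \<in> P0disc \<T> \<Longrightarrow> (\<lambda>x. v x * w x) \<in> P0disc \<T>"
  unfolding P0disc_def mem_Collect_eq by (metis mult_zero_right)

lemma set_integrable_P0disc_mult:
  fixes h :: "real^'d \<Rightarrow> real"
  assumes v: "v \<in> P0disc \<T>" and h: "\<And>K. K \<in> \<T> \<Longrightarrow> set_integrable lebesgue (interior K) h"
  shows "set_integrable lebesgue \<Omega> (\<lambda>x. h x * v x)"
proof (rule set_integrable_domainI)
  fix K assume K: "K \<in> \<T>"
  obtain c where c: "\<forall>x\<in>interior K. v x = c"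
    using P0disc_const[OF v K] by blast
  have "set_integrable lebesgue (interior K) (\<lambda>x. h x * c)"
    using h[OF K] by simp
  then show "set_integrable lebesgue (interior K) (\<lambda>x. h x * v x)"
    using c by (subst set_integrable_cong[OF refl refl, of _ _ "\<lambda>x. h x * c"]) auto
qed

lemma linear_form_on_ip:
  assumes V: "function_subspace V"
    and g: "\<And>v. v \<in> V \<Longrightarrow> set_integrable lebesgue \<Omega> (\<lambda>x. g x * v x)"
  shows "linear_form_on V (ip \<Omega> g)"
  unfolding linear_form_on_def
proof (intro conjI ballI allI)
  fix v w c assume v: "v \<in> V"
  show "ip \<Omega> g (\<lambda>x. c * v x) = c * ip \<Omega> g v"
    unfolding ip_def by (simp add: mult.left_commute)
  assume w: "w \<in> V"
  show "ip \<Omega> g (\<lambda>x. v x + w x) = ip \<Omega> g v + ip \<Omega> g w"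
    unfolding ip_def using g[OF v] g[OF w] by (simp add: distrib_left)
qed

lemma P0disc_interior_integrable:
  assumes "v \<in> P0disc \<T>" "K \<in> \<T>"
  shows "set_integrable lebesgue (interior K) v"
proof -
  obtain c where c: "\<forall>x\<in>interior K. v x = c"
    using P0disc_const[OF assms] by blast
  have "set_integrable lebesgue (interior K) (\<lambda>x. c)"
    by (rule set_integrable_interior_element[OF _ assms(2)]) simp
  then show ?thesis
    using c by (subst set_integrable_cong[OF refl refl, of _ _ "\<lambda>x. c"]) auto
qed

text \<open>Elements of \<open>P0disc\<close> vanish off the open elements, so a nonzero one is a
  nonzero constant on some open set of positive measure. This normalization makes the L^2 product
  definite on functions rather than on classes.\<close>

lemma ip_P0disc_pos:
  assumes v: "v \<in> P0disc \<T>" and ne: "v \<noteq> (\<lambda>x. 0)"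
  shows "ip \<Omega> v v > 0"
proof -
  obtain x where x: "v x \<noteq> 0"
    using ne by auto
  then obtain K where K: "K \<in> \<T>" "x \<in> interior K"
    using v unfolding P0disc_def by blast
  have const: "v y = v x" if "y \<in> interior K" for y
    using P0disc_const[OF v K(1)] K(2) that by metis
  have i: "set_integrable lebesgue \<Omega> (\<lambda>x. v x * v x)"
    using set_integrable_P0disc_mult[OF v P0disc_interior_integrable[OF v]] .
  have "0 < (v x)\<^sup>2 * measure lebesgue (interior K)"
  proof -
    have "interior K \<in> lmeasurable"
      using element_compact[OF K(1)] by (meson bounded_interior compact_imp_bounded lmeasurable_open open_interior)
    moreover have "\<not> negligible (interior K)"
      using K open_not_negligible[OF open_interior] by blast
    ultimately show ?thesis
      using x negligible_iff_measure zero_less_measure_iff by (metis mult_pos_pos zero_less_power2 fmeasurableD measure_nonneg less_le)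
  qed
  also have "\<dots> = (LINT y:interior K|lebesgue. (v x)\<^sup>2)"
    by (simp add: set_lebesgue_integral_def)
  also have "\<dots> = (LINT y:interior K|lebesgue. v y * v y)"
    using const by (intro set_lebesgue_integral_cong) (auto simp: power2_eq_square)
  also have "\<dots> \<le> (LINT y:\<Omega>|lebesgue. v y * v y)"
    unfolding set_lebesgue_integral_def
  proof (rule integral_mono)
    show "integrable lebesgue (\<lambda>x. indicator (interior K) x *\<^sub>R (v x * v x))"
      using set_integrable_subset[OF i _ interior_element_subset[OF K(1)]] unfolding set_integrable_def by auto
    show "integrable lebesgue (\<lambda>x. indicator \<Omega> x *\<^sub>R (v x * v x))"
      using i unfolding set_integrable_def .
  qed (use interior_element_subset[OF K(1)] in \<open>auto simp: indicator_def\<close>)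
  finally show ?thesis
    unfolding ip_def by simp
qed

lemma Pi0_spec:
  assumes g: "continuous_on (closure \<Omega>) g"
  shows "Pi0 \<Omega> \<T> g \<in> P0disc \<T> \<and> (\<forall>v\<in>P0disc \<T>. ip \<Omega> (Pi0 \<Omega> \<T> g) v = ip \<Omega> g v)"
proof -
  have "\<exists>!w. w \<in> P0disc \<T> \<and> (\<forall>v\<in>P0disc \<T>. ip \<Omega> w v = ip \<Omega> g v)"
  proof (rule riesz_representation)
  \<comment> \<open>One interior point per element separates the piecewise constants.\<close>
  let ?S = "(\<lambda>K. SOME x. x \<in> interior K) ` \<T>"
  show "finite ?S" using finite_mesh by simp
  show "function_subspace (P0disc \<T>)" by (rule function_subspace_P0disc)
  show "linear_form_on (P0disc \<T>) (ip \<Omega> v)" if "v \<in> P0disc \<T>" for v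
    by (intro linear_form_on_ip function_subspace_P0disc set_integrable_P0disc_mult P0disc_interior_integrable[OF that])
  show "linear_form_on (P0disc \<T>) (ip \<Omega> g)"
    by (intro linear_form_on_ip function_subspace_P0disc set_integrable_P0disc_mult set_integrable_interior_element[OF g])
  show "ip \<Omega> v w = ip \<Omega> w v" for v w :: "real^'d \<Rightarrow> real"
    by (simp add: ip_def mult.commute)
  show "ip \<Omega> v v > 0" if "v \<in> P0disc \<T>" "v \<noteq> (\<lambda>x. 0)" for v
    using ip_P0disc_pos[OF that] .
  fix v assume v: "v \<in> P0disc \<T>" and 0: "\<And>x. x \<in> ?S \<Longrightarrow> v x = 0"
  have "v x = 0" for x
  proof (cases "\<exists>K\<in>\<T>. x \<in> interior K")
    case True
    then obtain K where K: "K \<in> \<T>" "x \<in> interior K" by blast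
    have "(SOME x. x \<in> interior K) \<in> interior K"
      using K(2) by (rule someI)
    then show ?thesis
      using P0disc_const[OF v K(1)] K 0[of "SOME x. x \<in> interior K"] by auto
  next
    case False
    then show ?thesis using v unfolding P0disc_def by auto
  qed
  then show "v = (\<lambda>x. 0)" by blast
  qed
  from theI'[OF this] show ?thesis
    unfolding Pi0_def .
qed

section \<open>Continuous piecewise affine functions and the lumped projection\<close>

lemma P1cont_continuous: "v \<in> P1cont \<Omega> \<T> \<Longrightarrow> continuous_on (closure \<Omega>) v"
  unfolding P1cont_def by blast

lemma P1cont_affine: "v \<in> P1cont \<Omega> \<T> \<Longrightarrow> K \<in> \<T> \<Longrightarrow> \<exists>a b. \<forall>x\<in>K. v x = a \<bullet> x + b"
  unfolding P1cont_def by blast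

lemma function_subspace_P1cont: "function_subspace (P1cont \<Omega> \<T>)"
  unfolding function_subspace_def
proof (intro conjI ballI allI)
  show "(\<lambda>x. 0) \<in> P1cont \<Omega> \<T>"
    unfolding P1cont_def by (auto intro!: exI[of _ 0])
  fix v w c assume v: "v \<in> P1cont \<Omega> \<T>"
  have "\<exists>a b. \<forall>x\<in>K. c * v x = a \<bullet> x + b" if "K \<in> \<T>" for K
  proof -
    obtain a b where "\<forall>x\<in>K. v x = a \<bullet> x + b"
      using P1cont_affine[OF v \<open>K \<in> \<T>\<close>] by blast
    then have "\<forall>x\<in>K. c * v x = (c *\<^sub>R a) \<bullet> x + c * b"
      by (simp add: distrib_left)
    then show ?thesis by blast
  qed
  then show "(\<lambda>x. c * v x) \<in> P1cont \<Omega> \<T>"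
    using v unfolding P1cont_def by (auto intro!: continuous_intros)
  assume w: "w \<in> P1cont \<Omega> \<T>"
  have "\<exists>a b. \<forall>x\<in>K. v x + w x = a \<bullet> x + b" if "K \<in> \<T>" for K
  proof -
    obtain a b a' b' where "\<forall>x\<in>K. v x = a \<bullet> x + b" "\<forall>x\<in>K. w x = a' \<bullet> x + b'"
      using P1cont_affine[OF v \<open>K \<in> \<T>\<close>] P1cont_affine[OF w \<open>K \<in> \<T>\<close>] by blast
    then have "\<forall>x\<in>K. v x + w x = (a + a') \<bullet> x + (b + b')"
      by (simp add: inner_add_left)
    then show ?thesis by blast
  qed
  then show "(\<lambda>x. v x + w x) \<in> P1cont \<Omega> \<T>"
    using v w unfolding P1cont_def by (auto intro!: continuous_intros)
qed

lemma finite_verts: "K \<in> \<T> \<Longrightarrow> finite (verts K)"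
  unfolding verts_def using element_simplex simplex_imp_polyhedron finite_polyhedron_extreme_points by blast

lemma element_convex_hull_verts: "K \<in> \<T> \<Longrightarrow> K = convex hull (verts K)"
  unfolding verts_def by (intro Krein_Milman_Minkowski element_compact element_convex)

lemma measure_element_pos:
  assumes "K \<in> \<T>"
  shows "measure lebesgue K > 0"
proof -
  have "K \<in> lmeasurable"
    using element_compact[OF assms] by (rule lmeasurable_compact)
  moreover have "\<not> negligible K"
    using interior_element_nonempty[OF assms] open_not_negligible[OF open_interior] negligible_subset interior_subset by metis
  ultimately show ?thesis
    using negligible_iff_measure by (metis measure_nonneg less_le)
qed

text \<open>On an element the zero set of an affine function is convex; once it contains the
  vertices it contains their convex hull, the element itself.\<close>

lemma P1cont_eq_0:
  assumes v: "v \<in> P1cont \<Omega> \<T>" and 0: "\<And>K x. K \<in> \<T> \<Longrightarrow> x \<in> verts K \<Longrightarrow> v x = 0"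
  shows "v = (\<lambda>x. 0)"
proof
  fix x
  show "v x = 0"
  proof (cases "x \<in> closure \<Omega>")
    case True
    then obtain K where K: "K \<in> \<T>" "x \<in> K"
      using Union_mesh by blast
    obtain a b where ab: "\<forall>x\<in>K. v x = a \<bullet> x + b"
      using P1cont_affine[OF v K(1)] by blast
    have "verts K \<subseteq> {x. a \<bullet> x = - b}"
    proof
      fix y assume y: "y \<in> verts K"
      then have "y \<in> K" 
        unfolding verts_def extreme_point_of_def by blast
      then show "y \<in> {x. a \<bullet> x = - b}"
        using ab 0[OF K(1) y] by auto
    qed
    then have "convex hull (verts K) \<subseteq> {x. a \<bullet> x = - b}"
      by (rule hull_minimal) (rule convex_hyperplane)
    then show ?thesis
      using K(2) element_convex_hull_verts[OF K(1)] ab by auto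
  next
    case False
    then show ?thesis
      using v unfolding P1cont_def by blast
  qed
qed

lemma linear_form_on_lumped: "linear_form_on V (lumped \<T> v)"
  unfolding linear_form_on_def lumped_def
  by (simp add: distrib_left sum.distrib sum_distrib_left mult_ac)

lemma lumped_commute: "lumped \<T> v w = lumped \<T> w v"
  unfolding lumped_def by (simp add: mult.commute)

text \<open>A nonzero function is nonzero at some vertex, and that vertex enters the quadrature with
  the positive weight of its element.\<close>

lemma lumped_pos:
  assumes v: "v \<in> P1cont \<Omega> \<T>" and ne: "v \<noteq> (\<lambda>x. 0)"
  shows "lumped \<T> v v > 0"
proof -
  obtain K x where K: "K \<in> \<T>" "x \<in> verts K" "v x \<noteq> 0"
    using P1cont_eq_0[OF v] ne by blast
  have "0 < (\<Sum>K\<in>\<T>. measure lebesgue K * (\<Sum>x\<in>verts K. v x * v x))"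
  proof (rule sum_pos2[OF finite_mesh K(1)])
    have "0 < (\<Sum>x\<in>verts K. v x * v x)"
      using K by (intro sum_pos2[OF finite_verts[OF K(1)] K(2)]) (auto simp: zero_less_mult_iff linorder_neq_iff)
    then show "0 < measure lebesgue K * (\<Sum>x\<in>verts K. v x * v x)"
      using measure_element_pos[OF K(1)] by simp
  qed (intro mult_nonneg_nonneg sum_nonneg measure_nonneg zero_le_square)
  then show ?thesis
    unfolding lumped_def by (intro mult_pos_pos) auto
qed

text \<open>The finitely many vertices separate the space and make the lumped product definite, so
  the representation theorem applies to pairing with \<open>g\<close>.\<close>

lemma Pi1h_spec:
  assumes g: "g \<in> P0disc \<T>"
  shows "Pi1h \<Omega> \<T> g \<in> P1cont \<Omega> \<T> \<and> (\<forall>v\<in>P1cont \<Omega> \<T>. lumped \<T> (Pi1h \<Omega> \<T> g) v = ip \<Omega> g v)"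
proof -
  have "\<exists>!w. w \<in> P1cont \<Omega> \<T> \<and> (\<forall>v\<in>P1cont \<Omega> \<T>. lumped \<T> w v = ip \<Omega> g v)"
  proof (rule riesz_representation)
  show "finite (\<Union>K\<in>\<T>. verts K)"
    using finite_mesh finite_verts by blast
  show "linear_form_on (P1cont \<Omega> \<T>) (ip \<Omega> g)"
  proof (intro linear_form_on_ip function_subspace_P1cont)
    fix v assume "v \<in> P1cont \<Omega> \<T>"
    from set_integrable_P0disc_mult[OF g set_integrable_interior_element[OF P1cont_continuous[OF this]]]
    show "set_integrable lebesgue \<Omega> (\<lambda>x. g x * v x)"
      by (simp add: mult.commute)
  qed
  show "v = (\<lambda>x. 0)" if "v \<in> P1cont \<Omega> \<T>" "\<And>x. x \<in> (\<Union>K\<in>\<T>. verts K) \<Longrightarrow> v x = 0" for v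
    using that by (intro P1cont_eq_0) auto
  qed (auto intro: function_subspace_P1cont linear_form_on_lumped lumped_commute lumped_pos)
  from theI'[OF this] show ?thesis
    unfolding Pi1h_def .
qed

end

section \<open>Discrete forms and the energy law\<close>

lemma AE_finite_typeI:
  assumes "\<And>i::'i::finite. AE x in M. P i x"
  shows "AE x in M. \<forall>i. P i x"
  using AE_finite_allI[of "UNIV :: 'i set" P M] assms by simp

text \<open>The product rule is applied to the square of each component and summed. Quantifying over
  \<open>w\<close> inside the almost everywhere statement keeps the null set independent of
  \<open>w\<close>, so that a field depending on the point may be inserted.\<close>

lemma wgrad_inner_self:
  fixes u :: "real^'d \<Rightarrow> real^'d"
  assumes \<Omega>: "open \<Omega>" and u: "\<And>i. (\<lambda>x. u x $ i) \<in> H1_0 \<Omega>"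
  shows "AE x in lebesgue. x \<in> \<Omega> \<longrightarrow>
    (\<forall>w. w \<bullet> wgrad \<Omega> (\<lambda>x. u x \<bullet> u x) x = 2 * ((jac \<Omega> u x *v w) \<bullet> u x))"
proof -
  let ?g = "\<lambda>i. wgrad \<Omega> (\<lambda>x. u x $ i)"
  have "has_weak_grad \<Omega> (\<lambda>x. u x $ i * u x $ i) (\<lambda>x. u x $ i *\<^sub>R ?g i x + u x $ i *\<^sub>R ?g i x)" for i
    using u[of i] H1_0_subset_H1 by (intro has_weak_grad_mult \<Omega>) auto
  then have "has_weak_grad \<Omega> (\<lambda>x. \<Sum>i\<in>UNIV. u x $ i * u x $ i)
      (\<lambda>x. \<Sum>i\<in>UNIV. u x $ i *\<^sub>R ?g i x + u x $ i *\<^sub>R ?g i x)"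
    by (intro has_weak_grad_sum) auto
  then have "has_weak_grad \<Omega> (\<lambda>x. u x \<bullet> u x) (\<lambda>x. \<Sum>i\<in>UNIV. u x $ i *\<^sub>R ?g i x + u x $ i *\<^sub>R ?g i x)"
    by (simp add: inner_vec_def)
  from wgrad_AE_eq[OF \<Omega> this] show ?thesis
  proof eventually_elim
    case (elim x)
    have jac: "(jac \<Omega> u x *v w) $ i = w \<bullet> ?g i x" for w i
      by (simp add: jac_def matrix_vector_mult_def inner_vec_def mult.commute)
    show ?case
    proof (intro impI allI)
      fix w assume "x \<in> \<Omega>"
      with elim have "w \<bullet> wgrad \<Omega> (\<lambda>x. u x \<bullet> u x) x = (\<Sum>i\<in>UNIV. 2 * ((w \<bullet> ?g i x) * u x $ i))"
        by (simp only: inner_sum_right inner_add_right inner_scaleR_right) (simp add: mult.commute)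
      also have "\<dots> = 2 * ((jac \<Omega> u x *v w) \<bullet> u x)"
        unfolding inner_vec_def[of "jac \<Omega> u x *v w"] jac by (simp add: sum_distrib_left)
      finally show "w \<bullet> wgrad \<Omega> (\<lambda>x. u x \<bullet> u x) x = 2 * ((jac \<Omega> u x *v w) \<bullet> u x)" .
    qed
  qed
qed

section \<open>Integrals over faces\<close>

text \<open>The integrand is read only at closest points, and these lie in the closed nonempty
  face.\<close>

lemma face_integral_cong:
  assumes "closed e" "e \<noteq> {}" "\<And>x. x \<in> e \<Longrightarrow> F x = G x"
  shows "face_integral \<nu> e F = face_integral \<nu> e G"
  unfolding face_integral_def using assms closest_point_in_set by (intro LINT_lebesgue_cong_AE AE_I2) auto

text \<open>The prism is the continuous image of the compact product of face and unit interval, and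
  the closest point map onto a closed convex set is continuous.\<close>

lemma set_integrable_face:
  fixes e :: "(real^'d) set" and h :: "real^'d \<Rightarrow> real"
  assumes e: "compact e" "convex e" "e \<noteq> {}" and h: "continuous_on e h"
  shows "set_integrable lebesgue {x + t *\<^sub>R \<nu> | x t. x \<in> e \<and> t \<in> {0..1}} (\<lambda>y. h (closest_point e y))"
proof (rule set_integrable_continuous_compact)
  have "{x + t *\<^sub>R \<nu> | x t. x \<in> e \<and> t \<in> {0..1}} = (\<lambda>p. fst p + snd p *\<^sub>R \<nu>) ` (e \<times> {0..1})"
    by force
  moreover have "compact ((\<lambda>p. fst p + snd p *\<^sub>R \<nu>) ` (e \<times> {0..1::real}))"
    using e(1) by (intro compact_continuous_image continuous_intros compact_Times compact_Icc)
  ultimately show "compact {x + t *\<^sub>R \<nu> | x t. x \<in> e \<and> t \<in> {0..1}}" by simp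
  have "closed e" using e(1) by (rule compact_imp_closed)
  then show "continuous_on {x + t *\<^sub>R \<nu> | x t. x \<in> e \<and> t \<in> {0..1}} (\<lambda>y. h (closest_point e y))"
    using e closest_point_in_set
    by (intro continuous_on_compose2[OF h] continuous_on_closest_point) auto
qed

lemma face_integral_add_cmult:
  assumes e: "compact e" "convex e" "e \<noteq> {}" and "continuous_on e f" "continuous_on e g"
  shows "face_integral \<nu> e f + c * face_integral \<nu> e g = face_integral \<nu> e (\<lambda>x. f x + c * g x)"
proof -
  note i = set_integrable_face[OF e assms(4), of \<nu>] set_integrable_face[OF e assms(5), of \<nu>]
  show ?thesis
    unfolding face_integral_def using i by simp
qed

context simplicial_mesh_domain
begin

section \<open>Elementwise derivatives, traces and the upwind form\<close>

lemma egrad_interior_element: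
  assumes K: "K \<in> \<T>" "x \<in> interior K"
  shows "egrad \<T> f x = wgrad (interior K) f x"
proof -
  have "x \<notin> interior L" if "L \<in> \<T> - {K}" for L
    using interior_element_disjoint[OF K(1) _ K(2)] that by blast
  then have "(\<Sum>L\<in>\<T> - {K}. indicator (interior L) x *\<^sub>R wgrad (interior L) f x) = 0"
    by (intro sum.neutral) auto
  then show ?thesis
    unfolding egrad_def using K finite_mesh by (subst sum.remove[of _ K]) auto
qed

text \<open>On the element the function coincides with an affine function on the whole space, to
  which the \<open>C^1\<close> case applies.\<close>

lemma has_weak_grad_P1cont:
  assumes v: "v \<in> P1cont \<Omega> \<T>" and K: "K \<in> \<T>"
  shows "\<exists>a. has_weak_grad (interior K) v (\<lambda>_. a)"
proof -
  obtain a b where ab: "\<forall>x\<in>K. v x = a \<bullet> x + b"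
    using P1cont_affine[OF v K] by blast
  have "has_weak_grad (interior K) (\<lambda>x. a \<bullet> x + b) (\<lambda>_. a)"
    by (rule has_weak_grad_C1) (auto simp: gderiv_def inner_commute intro!: derivative_eq_intros)
  moreover have "a \<bullet> x + b = v x" if "x \<in> interior K" for x
    using bspec[OF ab subsetD[OF interior_subset that]] by simp
  ultimately have "has_weak_grad (interior K) v (\<lambda>_. a)"
    by (rule has_weak_grad_cong[OF open_interior, rotated])
  then show ?thesis by blast
qed

lemma AE_egrad_eq:
  assumes "has_weak_grad (interior K) f g" "K \<in> \<T>"
  shows "AE x in lebesgue. x \<in> interior K \<longrightarrow> egrad \<T> f x = g x"
  using wgrad_AE_eq[OF open_interior assms(1)]
  by eventually_elim (simp add: egrad_interior_element[OF assms(2)])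

lemma delta_P1cont:
  assumes "v \<in> P1cont \<Omega> \<T>" "w \<in> P1cont \<Omega> \<T>"
  shows "delta \<Delta>t v w \<in> P1cont \<Omega> \<T>"
proof -
  have "delta \<Delta>t v w = (\<lambda>x. inverse \<Delta>t * (v x + (-1) * w x))"
    by (simp add: delta_def fun_eq_iff)
  also have "\<dots> \<in> P1cont \<Omega> \<T>"
    by (intro function_subspaceD(2)[OF function_subspace_P1cont _ assms(1)] function_subspaceD(1)[OF function_subspace_P1cont assms])
  finally show ?thesis .
qed

lemma delta_P0disc:
  assumes "v \<in> P0disc \<T>" "w \<in> P0disc \<T>"
  shows "delta \<Delta>t v w \<in> P0disc \<T>"
proof -
  have "delta \<Delta>t v w = (\<lambda>x. inverse \<Delta>t * (v x + (-1) * w x))"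
    by (simp add: delta_def fun_eq_iff)
  also have "\<dots> \<in> P0disc \<T>"
    by (intro function_subspaceD(2)[OF function_subspace_P0disc _ assms(1)] function_subspaceD(1)[OF function_subspace_P0disc assms])
  finally show ?thesis .
qed

text \<open>The gradients of the increment and of the two functions are chosen independently of each
  other, so linearity holds only almost everywhere, by comparison with the constant gradients on
  each element.\<close>

lemma AE_egrad_delta:
  assumes v: "v \<in> P1cont \<Omega> \<T>" and w: "w \<in> P1cont \<Omega> \<T>"
  shows "AE x in lebesgue. x \<in> \<Omega> \<longrightarrow> egrad \<T> (delta \<Delta>t v w) x = delta \<Delta>t (egrad \<T> v) (egrad \<T> w) x"
proof (rule AE_domainI)
  fix K assume K: "K \<in> \<T>"
  obtain a where a: "has_weak_grad (interior K) v (\<lambda>_. a)"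
    using has_weak_grad_P1cont[OF v K] by blast
  obtain b where b: "has_weak_grad (interior K) w (\<lambda>_. b)"
    using has_weak_grad_P1cont[OF w K] by blast
  have "has_weak_grad (interior K) (\<lambda>x. inverse \<Delta>t * (v x + (-1) * w x)) (\<lambda>_. inverse \<Delta>t *\<^sub>R (a + (-1) *\<^sub>R b))"
    by (intro has_weak_grad_cmult has_weak_grad_add a b)
  moreover have "(\<lambda>x. inverse \<Delta>t * (v x + (-1) * w x)) = delta \<Delta>t v w"
    by (simp add: delta_def fun_eq_iff)
  ultimately have "has_weak_grad (interior K) (delta \<Delta>t v w) (\<lambda>_. (a - b) /\<^sub>R \<Delta>t)"
    by simp
  from AE_egrad_eq[OF this K] AE_egrad_eq[OF a K] AE_egrad_eq[OF b K]
  show "AE x in lebesgue. x \<in> interior K \<longrightarrow> egrad \<T> (delta \<Delta>t v w) x = delta \<Delta>t (egrad \<T> v) (egrad \<T> w) x"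
    by eventually_elim (simp add: delta_def)
qed

lemma set_integrable_egrad_inner:
  assumes v: "v \<in> P1cont \<Omega> \<T>" and w: "w \<in> P1cont \<Omega> \<T>"
  shows "set_integrable lebesgue \<Omega> (\<lambda>x. egrad \<T> v x \<bullet> egrad \<T> w x)"
proof (rule set_integrable_domainI)
  fix K assume K: "K \<in> \<T>"
  obtain a where a: "has_weak_grad (interior K) v (\<lambda>_. a)"
    using has_weak_grad_P1cont[OF v K] by blast
  obtain b where b: "has_weak_grad (interior K) w (\<lambda>_. b)"
    using has_weak_grad_P1cont[OF w K] by blast
  have "set_integrable lebesgue (interior K) (\<lambda>x. a \<bullet> b)"
    by (rule set_integrable_interior_element[OF _ K]) simp
  moreover have "AE x in lebesgue. x \<in> interior K \<longrightarrow> egrad \<T> v x \<bullet> egrad \<T> w x = a \<bullet> b"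
    using AE_egrad_eq[OF a K] AE_egrad_eq[OF b K] by eventually_elim simp
  ultimately show "set_integrable lebesgue (interior K) (\<lambda>x. egrad \<T> v x \<bullet> egrad \<T> w x)"
    by (rule set_integrable_lebesgue_cong_AE)
qed

text \<open>Inside an element the piecewise constant factor is a number, and the global weak
  gradient of each velocity component restricts to the element. Thus the incompressibility equation,
  stated with the global divergence, reaches the volume part of \<open>c_h\<close>.\<close>

lemma AE_ediv_P0disc_scaleR:
  fixes u :: "real^'d \<Rightarrow> real^'d"
  assumes \<phi>: "\<phi> \<in> P0disc \<T>" and u: "\<And>i. (\<lambda>x. u x $ i) \<in> H1 \<Omega>"
  shows "AE x in lebesgue. x \<in> \<Omega> \<longrightarrow> ediv \<T> (\<lambda>y. \<phi> y *\<^sub>R u y) x = \<phi> x * wdiv \<Omega> u x"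
proof (rule AE_domainI)
  fix K assume K: "K \<in> \<T>"
  obtain c where c: "\<forall>x\<in>interior K. \<phi> x = c"
    using P0disc_const[OF \<phi> K] by blast
  have "AE x in lebesgue. \<forall>i. x \<in> interior K \<longrightarrow>
      egrad \<T> (\<lambda>y. (\<phi> y *\<^sub>R u y) $ i) x = c *\<^sub>R wgrad \<Omega> (\<lambda>y. u y $ i) x"
  proof (intro AE_finite_typeI AE_egrad_eq[OF _ K])
    fix i
    have "has_weak_grad (interior K) (\<lambda>x. c * u x $ i) (\<lambda>x. c *\<^sub>R wgrad \<Omega> (\<lambda>y. u y $ i) x)"
      by (intro has_weak_grad_cmult has_weak_grad_subset[OF interior_element_subset[OF K]] H1_wgrad(3) open_domain u)
    then show "has_weak_grad (interior K) (\<lambda>y. (\<phi> y *\<^sub>R u y) $ i) (\<lambda>x. c *\<^sub>R wgrad \<Omega> (\<lambda>y. u y $ i) x)"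
      by (rule has_weak_grad_cong[OF open_interior, rotated]) (use c in auto)
  qed
  then show "AE x in lebesgue. x \<in> interior K \<longrightarrow> ediv \<T> (\<lambda>y. \<phi> y *\<^sub>R u y) x = \<phi> x * wdiv \<Omega> u x"
  proof eventually_elim
    case (elim x)
    then show ?case
      using c by (auto simp: ediv_def wdiv_def trace_def jac_def sum_distrib_left)
  qed
qed

text \<open>An element is the closure of its interior, so each of its points is a limit of interior
  points and the one-sided limit is determined by the constant value there.\<close>

lemma trace_on_P0disc:
  assumes "\<phi> \<in> P0disc \<T>" and K: "K \<in> \<T>"
  obtains c where "\<And>x. x \<in> K \<Longrightarrow> trace_on K \<phi> x = c"
proof -
  obtain c where c: "\<forall>x\<in>interior K. \<phi> x = c"
    using P0disc_const[OF assms] by blast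
  have "trace_on K \<phi> x = c" if x: "x \<in> K" for x
    unfolding trace_on_def
  proof (rule tendsto_Lim)
    have "x islimpt interior K"
    proof (cases "x \<in> interior K")
      case True
      then show ?thesis
        using interior_limit_point[of x "interior K"] by simp
    next
      case False
      then show ?thesis
        using x closure_interior_element[OF K] unfolding closure_def by blast
    qed
    then show "at x within interior K \<noteq> bot"
      using trivial_limit_within by blast
    show "(\<phi> \<longlongrightarrow> c) (at x within interior K)"
      using c by (intro tendsto_eventually) (auto simp: eventually_at_filter)
  qed
  then show thesis using that by blast
qed

text \<open>The upwind value is the average corrected by half the signed jump; on a face this turns the
  centered form and its stabilization into the upwind form.\<close>

lemma c_h_add_s2_h:
  fixes u :: "real^'d \<Rightarrow> real^'d"
  assumes u: "continuous_on (closure \<Omega>) u" and \<phi>: "\<phi> \<in> P0disc \<T>" and \<mu>: "\<mu> \<in> P0disc \<T>"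
  shows "c_h \<Omega> \<T> \<nu> \<phi> \<mu> u + s2_h \<Omega> \<T> \<nu> u \<phi> \<mu> u
    = - (LINT x:\<Omega>|lebesgue. ediv \<T> (\<lambda>y. \<phi> y *\<^sub>R u y) x * \<mu> x) - a_upw \<Omega> \<T> \<nu> u \<phi> \<mu>"
proof -
  let ?C = "\<lambda>K L x. (u x \<bullet> \<nu> (K \<inter> L)) * avg K L \<phi> x * jump K L \<mu> x"
  let ?S = "\<lambda>K L x. (u x \<bullet> \<nu> (K \<inter> L)) * sgn (u x \<bullet> \<nu> (K \<inter> L)) * jump K L \<phi> x * jump K L \<mu> x"
  let ?A = "\<lambda>K L x. (pos_part (u x \<bullet> \<nu> (K \<inter> L)) * trace_on K \<phi> x
            - neg_part (u x \<bullet> \<nu> (K \<inter> L)) * trace_on L \<phi> x) * jump K L \<mu> x"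
  let ?F = "\<lambda>K L. face_integral (\<nu> (K \<inter> L)) (K \<inter> L)"
  have face: "?F K L (?C K L) + 1/2 * ?F K L (?S K L) = ?F K L (?A K L)"
    if KL: "(K, L) \<in> oriented_faces \<Omega> \<T> \<nu>" for K L
  proof -
    have K: "K \<in> \<T>" and L: "L \<in> \<T>" and ne: "K \<inter> L \<noteq> {}"
      using KL unfolding oriented_faces_def facet_of_def by auto
    have e: "compact (K \<inter> L)" "convex (K \<inter> L)"
      using K L by (auto intro: compact_Int convex_Int element_compact element_convex)
    obtain a where a: "\<And>x. x \<in> K \<Longrightarrow> trace_on K \<phi> x = a" using trace_on_P0disc[OF \<phi> K] by blast
    obtain b where b: "\<And>x. x \<in> L \<Longrightarrow> trace_on L \<phi> x = b" using trace_on_P0disc[OF \<phi> L] by blast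
    obtain m where m: "\<And>x. x \<in> K \<Longrightarrow> trace_on K \<mu> x = m" using trace_on_P0disc[OF \<mu> K] by blast
    obtain n where n: "\<And>x. x \<in> L \<Longrightarrow> trace_on L \<mu> x = n" using trace_on_P0disc[OF \<mu> L] by blast
    have cu: "continuous_on (K \<inter> L) (\<lambda>x. u x \<bullet> \<nu> (K \<inter> L))"
      using element_subset_closure[OF K] by (intro continuous_intros continuous_on_subset[OF u]) auto
    have "?F K L (?C K L) = ?F K L (\<lambda>x. (u x \<bullet> \<nu> (K \<inter> L)) * ((a + b) / 2) * (m - n))"
      using a b m n by (intro face_integral_cong compact_imp_closed e ne) (auto simp: avg_def jump_def)
    \<comment> \<open>Multiplying the sign by the normal velocity itself gives an absolute value, so
      the integrand becomes continuous despite the jump of \<open>sgn\<close>.\<close>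
    moreover have "?F K L (?S K L) = ?F K L (\<lambda>x. \<bar>u x \<bullet> \<nu> (K \<inter> L)\<bar> * (a - b) * (m - n))"
      using a b m n by (intro face_integral_cong compact_imp_closed e ne) (auto simp: jump_def abs_sgn)
    moreover have "?F K L (\<lambda>x. (u x \<bullet> \<nu> (K \<inter> L)) * ((a + b) / 2) * (m - n)) 
        + 1/2 * ?F K L (\<lambda>x. \<bar>u x \<bullet> \<nu> (K \<inter> L)\<bar> * (a - b) * (m - n))
        = ?F K L (\<lambda>x. (u x \<bullet> \<nu> (K \<inter> L)) * ((a + b) / 2) * (m - n) + 1/2 * (\<bar>u x \<bullet> \<nu> (K \<inter> L)\<bar> * (a - b) * (m - n)))"
      by (intro face_integral_add_cmult e ne continuous_intros cu)
    \<comment> \<open>With normal velocity s: s (a + b) / 2 + |s| (a - b) / 2 equals s a for s >= 0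
      and s b for s <= 0.\<close>
    moreover have "\<dots> = ?F K L (?A K L)"
      using a b m n by (intro face_integral_cong compact_imp_closed e ne)
        (auto simp: jump_def pos_part_def neg_part_def max_def min_def abs_if field_simps)
    ultimately show ?thesis by simp
  qed
  have "(\<Sum>(K, L)\<in>oriented_faces \<Omega> \<T> \<nu>. ?F K L (?C K L)) + 1/2 * (\<Sum>(K, L)\<in>oriented_faces \<Omega> \<T> \<nu>. ?F K L (?S K L))
      = (\<Sum>(K, L)\<in>oriented_faces \<Omega> \<T> \<nu>. ?F K L (?A K L))"
    unfolding sum_distrib_left sum.distrib[symmetric] using face by (intro sum.cong) auto
  then show ?thesis
    unfolding c_h_def s2_h_def a_upw_def by simp
qed

end

section \<open>Discrete time increments and the energy balance\<close>

lemma linear_form_on_delta: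
  assumes V: "function_subspace V" and l: "linear_form_on V l" and v: "v \<in> V" "w \<in> V"
  shows "l (delta \<Delta>t v w) = (l v - l w) / \<Delta>t"
proof -
  have "delta \<Delta>t v w = (\<lambda>x. inverse \<Delta>t * (v x + (-1) * w x))"
    by (simp add: delta_def fun_eq_iff)
  then have "l (delta \<Delta>t v w) = inverse \<Delta>t * l (\<lambda>x. v x + (-1) * w x)"
    using l function_subspaceD(1)[OF V v, of "-1"] unfolding linear_form_on_def by metis
  also have "\<dots> = (l v - l w) / \<Delta>t"
    using linear_form_onD[OF V l v, of "-1"] by (simp add: divide_inverse)
  finally show ?thesis .
qed

text \<open>Eliminating \<open>deriv\<close> exhibits a polynomial in the two arguments, whose
  continuity, and hence integrability after substitution of discrete functions, is evident.\<close>

lemma f_pot_eq: "f_pot a b = 2 * a + b ^ 3 - 3 * b"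
proof -
  have "(F_i has_real_derivative 2 * a) (at a)"
    unfolding F_i_def[abs_def] by (auto intro!: derivative_eq_intros)
  moreover have "(F_e has_real_derivative b ^ 3 - 3 * b) (at b)"
    unfolding F_e_def[abs_def] by (auto intro!: derivative_eq_intros simp: field_simps)
  ultimately show ?thesis
    unfolding f_pot_def by (simp add: DERIV_imp_deriv)
qed

text \<open>This is 2 a . (a - b) = |a|^2 - |b|^2 + |a - b|^2 in scaled form; the last square is the
  origin of both numerical dissipation terms.\<close>

lemma inner_delta_right:
  fixes v w :: "'a \<Rightarrow> 'b::real_inner"
  assumes "\<Delta>t \<noteq> 0"
  shows "v x \<bullet> delta \<Delta>t v w x
    = ((norm (v x))\<^sup>2 / 2 - (norm (w x))\<^sup>2 / 2) / \<Delta>t + \<Delta>t / 2 * (norm (delta \<Delta>t v w x))\<^sup>2"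
proof -
  have "(norm (delta \<Delta>t v w x))\<^sup>2 = (norm (v x - w x))\<^sup>2 / \<Delta>t\<^sup>2"
    by (simp add: delta_def divide_inverse power_mult_distrib power_inverse)
  moreover have "(norm (v x - w x))\<^sup>2 = (norm (v x))\<^sup>2 - 2 * (v x \<bullet> w x) + (norm (w x))\<^sup>2"
    by (simp add: power2_norm_eq_inner inner_diff_left inner_diff_right inner_commute)
  moreover have "v x \<bullet> delta \<Delta>t v w x = ((norm (v x))\<^sup>2 - v x \<bullet> w x) / \<Delta>t"
    by (simp add: delta_def power2_norm_eq_inner inner_diff_right divide_inverse)
  ultimately show ?thesis
    using assms by (simp only:) (simp add: field_simps power2_eq_square)
qed

text \<open>\<open>a\<close> stands for the upwind transport, which cancels between momentum and
  phase equations, and \<open>s\<close> for the pairing of phase increment and chemical potential,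
  which cancels between phase and potential equations.\<close>

lemma energy_balance_sum:
  fixes K\<^sub>1 K\<^sub>0 N V a s b lam \<epsilon> \<Delta>t G\<^sub>1 G\<^sub>0 D f F\<^sub>1 F\<^sub>0 :: real
  assumes "(K\<^sub>1 - K\<^sub>0) / \<Delta>t + \<Delta>t / 2 * N + 2 * V - a = 0" and "s + a + b = 0"
    and "lam * \<epsilon> * ((G\<^sub>1 - G\<^sub>0) / (2 * \<Delta>t) + \<Delta>t / 2 * D) + lam / \<epsilon> * f - s = 0"
  shows "(K\<^sub>1 + lam * \<epsilon> / 2 * G\<^sub>1 + lam / \<epsilon> * F\<^sub>1 - (K\<^sub>0 + lam * \<epsilon> / 2 * G\<^sub>0 + lam / \<epsilon> * F\<^sub>0)) / \<Delta>t
    + 2 * V + b + \<Delta>t / 2 * N + \<Delta>t * lam * \<epsilon> / 2 * D + lam / \<epsilon> * (f - (F\<^sub>1 - F\<^sub>0) / \<Delta>t) = 0"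
    (is "?l = 0")
proof -
  have "?l = ((K\<^sub>1 - K\<^sub>0) / \<Delta>t + \<Delta>t / 2 * N + 2 * V - a) + (s + a + b)
      + (lam * \<epsilon> * ((G\<^sub>1 - G\<^sub>0) / (2 * \<Delta>t) + \<Delta>t / 2 * D) + lam / \<epsilon> * f - s)"
    by (simp add: add_divide_distrib diff_divide_distrib algebra_simps)
  then show ?thesis
    unfolding assms by simp
qed

context simplicial_mesh_domain
begin

text \<open>With variable density, polarization leaves the old density in front of both squares.
  Half of the density increment times the new square, supplied by \<open>s1_h\<close>, upgrades the
  first of them to the new density.\<close>

lemma kinetic_energy_increment:
  fixes u\<^sub>0 u\<^sub>1 :: "real^'d \<Rightarrow> real^'d"
  assumes u: "continuous_on (closure \<Omega>) u\<^sub>0" "continuous_on (closure \<Omega>) u\<^sub>1"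
    and r: "continuous_on (closure \<Omega>) r\<^sub>0" "continuous_on (closure \<Omega>) r\<^sub>1" and \<Delta>t: "\<Delta>t \<noteq> 0"
  shows "ip \<Omega> (\<lambda>x. r\<^sub>0 x *\<^sub>R delta \<Delta>t u\<^sub>1 u\<^sub>0 x) u\<^sub>1 + 1/2 * ip \<Omega> (\<lambda>x. (r\<^sub>1 x - r\<^sub>0 x) / \<Delta>t) (\<lambda>x. u\<^sub>1 x \<bullet> u\<^sub>1 x)
    = ((LINT x:\<Omega>|lebesgue. r\<^sub>1 x * ((norm (u\<^sub>1 x))\<^sup>2 / 2)) - (LINT x:\<Omega>|lebesgue. r\<^sub>0 x * ((norm (u\<^sub>0 x))\<^sup>2 / 2))) / \<Delta>t
      + \<Delta>t / 2 * (LINT x:\<Omega>|lebesgue. r\<^sub>0 x * (norm (delta \<Delta>t u\<^sub>1 u\<^sub>0 x))\<^sup>2)"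
    (is "?L1 + 1/2 * ?L2 = (?E1 - ?E0) / \<Delta>t + \<Delta>t / 2 * ?N")
proof -
  have d: "continuous_on (closure \<Omega>) (\<lambda>x. delta \<Delta>t u\<^sub>1 u\<^sub>0 x)"
    unfolding delta_def using u by (intro continuous_intros)
  have i: "set_integrable lebesgue \<Omega> (\<lambda>x. (r\<^sub>0 x *\<^sub>R delta \<Delta>t u\<^sub>1 u\<^sub>0 x) \<bullet> u\<^sub>1 x)"
      "set_integrable lebesgue \<Omega> (\<lambda>x. (r\<^sub>1 x - r\<^sub>0 x) / \<Delta>t * (u\<^sub>1 x \<bullet> u\<^sub>1 x))"
      "set_integrable lebesgue \<Omega> (\<lambda>x. r\<^sub>1 x * ((norm (u\<^sub>1 x))\<^sup>2 / 2))"
      "set_integrable lebesgue \<Omega> (\<lambda>x. r\<^sub>0 x * ((norm (u\<^sub>0 x))\<^sup>2 / 2))"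
      "set_integrable lebesgue \<Omega> (\<lambda>x. r\<^sub>0 x * (norm (delta \<Delta>t u\<^sub>1 u\<^sub>0 x))\<^sup>2)"
    using u r d \<Delta>t by (intro set_integrable_domain_continuous continuous_intros; simp)+
  have "?L1 + 1/2 * ?L2
      = (LINT x:\<Omega>|lebesgue. (r\<^sub>0 x *\<^sub>R delta \<Delta>t u\<^sub>1 u\<^sub>0 x) \<bullet> u\<^sub>1 x + 1/2 * ((r\<^sub>1 x - r\<^sub>0 x) / \<Delta>t * (u\<^sub>1 x \<bullet> u\<^sub>1 x)))"
    unfolding ip_def inner_real_def
    by (subst set_integral_add(2)[OF i(1) set_integrable_mult_right[OF i(2)]]) (simp only: set_integral_mult_right)
  also have "\<dots> = (LINT x:\<Omega>|lebesgue. inverse \<Delta>t * (r\<^sub>1 x * ((norm (u\<^sub>1 x))\<^sup>2 / 2) - r\<^sub>0 x * ((norm (u\<^sub>0 x))\<^sup>2 / 2))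
        + \<Delta>t / 2 * (r\<^sub>0 x * (norm (delta \<Delta>t u\<^sub>1 u\<^sub>0 x))\<^sup>2))"
  proof (intro LINT_lebesgue_cong_AE AE_I2 impI)
    fix x
    have "(r\<^sub>0 x *\<^sub>R delta \<Delta>t u\<^sub>1 u\<^sub>0 x) \<bullet> u\<^sub>1 x = r\<^sub>0 x * (u\<^sub>1 x \<bullet> delta \<Delta>t u\<^sub>1 u\<^sub>0 x)"
      by (simp add: inner_commute)
    then show "(r\<^sub>0 x *\<^sub>R delta \<Delta>t u\<^sub>1 u\<^sub>0 x) \<bullet> u\<^sub>1 x + 1/2 * ((r\<^sub>1 x - r\<^sub>0 x) / \<Delta>t * (u\<^sub>1 x \<bullet> u\<^sub>1 x))
      = inverse \<Delta>t * (r\<^sub>1 x * ((norm (u\<^sub>1 x))\<^sup>2 / 2) - r\<^sub>0 x * ((norm (u\<^sub>0 x))\<^sup>2 / 2))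
        + \<Delta>t / 2 * (r\<^sub>0 x * (norm (delta \<Delta>t u\<^sub>1 u\<^sub>0 x))\<^sup>2)"
      unfolding inner_delta_right[OF \<Delta>t] power2_norm_eq_inner[of "u\<^sub>1 x", symmetric]
      using \<Delta>t by (simp only:) (simp add: field_simps)
  qed
  also have "\<dots> = inverse \<Delta>t * (?E1 - ?E0) + \<Delta>t / 2 * ?N"
    using i(3-5) by (simp only: set_integral_add(2) set_integral_diff set_integral_mult_right set_integrable_mult_right simp_thms)
  finally show ?thesis
    by (simp only: divide_inverse_commute)
qed

lemma gradient_energy_increment:
  assumes \<Phi>: "\<Phi>\<^sub>1 \<in> P1cont \<Omega> \<T>" "\<Phi>\<^sub>0 \<in> P1cont \<Omega> \<T>" and \<Delta>t: "\<Delta>t \<noteq> 0"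
  shows "ip \<Omega> (egrad \<T> \<Phi>\<^sub>1) (egrad \<T> (delta \<Delta>t \<Phi>\<^sub>1 \<Phi>\<^sub>0))
    = ((LINT x:\<Omega>|lebesgue. (norm (egrad \<T> \<Phi>\<^sub>1 x))\<^sup>2) - (LINT x:\<Omega>|lebesgue. (norm (egrad \<T> \<Phi>\<^sub>0 x))\<^sup>2)) / (2 * \<Delta>t)
      + \<Delta>t / 2 * (LINT x:\<Omega>|lebesgue. (norm (delta \<Delta>t (egrad \<T> \<Phi>\<^sub>1) (egrad \<T> \<Phi>\<^sub>0) x))\<^sup>2)"
    (is "_ = (?E1 - ?E0) / (2 * \<Delta>t) + \<Delta>t / 2 * ?N")
proof -
  have i: "set_integrable lebesgue \<Omega> (\<lambda>x. (norm (egrad \<T> \<Phi>\<^sub>1 x))\<^sup>2)"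
      "set_integrable lebesgue \<Omega> (\<lambda>x. (norm (egrad \<T> \<Phi>\<^sub>0 x))\<^sup>2)"
    unfolding power2_norm_eq_inner by (intro set_integrable_egrad_inner \<Phi>)+
  have "set_integrable lebesgue \<Omega> (\<lambda>x. (norm (egrad \<T> (delta \<Delta>t \<Phi>\<^sub>1 \<Phi>\<^sub>0) x))\<^sup>2)"
    unfolding power2_norm_eq_inner by (intro set_integrable_egrad_inner delta_P1cont \<Phi>)
  moreover have ae: "AE x in lebesgue. x \<in> \<Omega> \<longrightarrow> egrad \<T> (delta \<Delta>t \<Phi>\<^sub>1 \<Phi>\<^sub>0) x = delta \<Delta>t (egrad \<T> \<Phi>\<^sub>1) (egrad \<T> \<Phi>\<^sub>0) x"
    by (rule AE_egrad_delta[OF \<Phi>])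
  ultimately have i3: "set_integrable lebesgue \<Omega> (\<lambda>x. (norm (delta \<Delta>t (egrad \<T> \<Phi>\<^sub>1) (egrad \<T> \<Phi>\<^sub>0) x))\<^sup>2)"
    by (rule set_integrable_lebesgue_cong_AE[OF _ eventually_mono]) auto
  have half: "(a / 2 - b / 2) / \<Delta>t = inverse (2 * \<Delta>t) * (a - b)" for a b :: real
    using \<Delta>t by (simp add: field_simps)
  have "AE x in lebesgue. x \<in> \<Omega> \<longrightarrow> egrad \<T> \<Phi>\<^sub>1 x \<bullet> egrad \<T> (delta \<Delta>t \<Phi>\<^sub>1 \<Phi>\<^sub>0) x
      = inverse (2 * \<Delta>t) * ((norm (egrad \<T> \<Phi>\<^sub>1 x))\<^sup>2 - (norm (egrad \<T> \<Phi>\<^sub>0 x))\<^sup>2)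
        + \<Delta>t / 2 * (norm (delta \<Delta>t (egrad \<T> \<Phi>\<^sub>1) (egrad \<T> \<Phi>\<^sub>0) x))\<^sup>2"
    using ae
  proof eventually_elim
    case (elim x)
    show ?case
    proof
      assume "x \<in> \<Omega>"
      then have "egrad \<T> (delta \<Delta>t \<Phi>\<^sub>1 \<Phi>\<^sub>0) x = delta \<Delta>t (egrad \<T> \<Phi>\<^sub>1) (egrad \<T> \<Phi>\<^sub>0) x"
        using elim by blast
      then show "egrad \<T> \<Phi>\<^sub>1 x \<bullet> egrad \<T> (delta \<Delta>t \<Phi>\<^sub>1 \<Phi>\<^sub>0) x
        = inverse (2 * \<Delta>t) * ((norm (egrad \<T> \<Phi>\<^sub>1 x))\<^sup>2 - (norm (egrad \<T> \<Phi>\<^sub>0 x))\<^sup>2)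
          + \<Delta>t / 2 * (norm (delta \<Delta>t (egrad \<T> \<Phi>\<^sub>1) (egrad \<T> \<Phi>\<^sub>0) x))\<^sup>2"
        by (simp only: inner_delta_right[OF \<Delta>t] half)
    qed
  qed
  then have "ip \<Omega> (egrad \<T> \<Phi>\<^sub>1) (egrad \<T> (delta \<Delta>t \<Phi>\<^sub>1 \<Phi>\<^sub>0))
      = (LINT x:\<Omega>|lebesgue. inverse (2 * \<Delta>t) * ((norm (egrad \<T> \<Phi>\<^sub>1 x))\<^sup>2 - (norm (egrad \<T> \<Phi>\<^sub>0 x))\<^sup>2)
        + \<Delta>t / 2 * (norm (delta \<Delta>t (egrad \<T> \<Phi>\<^sub>1) (egrad \<T> \<Phi>\<^sub>0) x))\<^sup>2)"
    unfolding ip_def by (rule LINT_lebesgue_cong_AE)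
  also have "\<dots> = inverse (2 * \<Delta>t) * (?E1 - ?E0) + \<Delta>t / 2 * ?N"
    using i i3 by (simp only: set_integral_add(2) set_integral_diff set_integral_mult_right set_integrable_mult_right simp_thms)
  finally show ?thesis
    by (simp only: divide_inverse_commute)
qed

text \<open>The increment of \<open>F_pot\<close> subtracted here is the one contained in the
  energy, so the splitting is exact and no convexity estimate enters.\<close>

lemma potential_energy_increment:
  assumes \<Phi>: "\<Phi>\<^sub>1 \<in> P1cont \<Omega> \<T>" "\<Phi>\<^sub>0 \<in> P1cont \<Omega> \<T>"
  shows "(LINT x:\<Omega>|lebesgue. f_pot (\<Phi>\<^sub>1 x) (\<Phi>\<^sub>0 x) * delta \<Delta>t \<Phi>\<^sub>1 \<Phi>\<^sub>0 x
      - delta \<Delta>t (\<lambda>y. F_pot (\<Phi>\<^sub>1 y)) (\<lambda>y. F_pot (\<Phi>\<^sub>0 y)) x)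
    = ip \<Omega> (\<lambda>x. f_pot (\<Phi>\<^sub>1 x) (\<Phi>\<^sub>0 x)) (delta \<Delta>t \<Phi>\<^sub>1 \<Phi>\<^sub>0)
      - ((LINT x:\<Omega>|lebesgue. F_pot (\<Phi>\<^sub>1 x)) - (LINT x:\<Omega>|lebesgue. F_pot (\<Phi>\<^sub>0 x))) / \<Delta>t"
proof -
  note c = P1cont_continuous[OF \<Phi>(1)] P1cont_continuous[OF \<Phi>(2)] P1cont_continuous[OF delta_P1cont[OF \<Phi>], of \<Delta>t]
  have i: "set_integrable lebesgue \<Omega> (\<lambda>x. f_pot (\<Phi>\<^sub>1 x) (\<Phi>\<^sub>0 x) * delta \<Delta>t \<Phi>\<^sub>1 \<Phi>\<^sub>0 x)"
    "set_integrable lebesgue \<Omega> (\<lambda>x. F_pot (\<Phi>\<^sub>1 x))" "set_integrable lebesgue \<Omega> (\<lambda>x. F_pot (\<Phi>\<^sub>0 x))"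
    unfolding f_pot_eq F_pot_def by (intro set_integrable_domain_continuous continuous_intros c)+
  have eq: "delta \<Delta>t (\<lambda>y. F_pot (\<Phi>\<^sub>1 y)) (\<lambda>y. F_pot (\<Phi>\<^sub>0 y)) x = inverse \<Delta>t * (F_pot (\<Phi>\<^sub>1 x) - F_pot (\<Phi>\<^sub>0 x))" for x
    by (simp add: delta_def)
  show ?thesis
    unfolding eq ip_def inner_real_def using i
    by (simp only: set_integral_diff set_integral_mult_right set_integrable_mult_right simp_thms divide_inverse mult.commute)
qed

end

theorem theorem3p8:
  fixes \<Omega> :: "(real^'d) set" and \<T> :: "(real^'d) set set" and \<nu> :: "(real^'d) set \<Rightarrow> real^'d"
    and \<sigma> \<rho>\<^sub>1 \<rho>\<^sub>2 lam \<epsilon> \<Delta>t :: real and \<eta> :: "real \<Rightarrow> real"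
    and U :: "(real^'d \<Rightarrow> real^'d) set" and P :: "(real^'d \<Rightarrow> real) set"
    and u\<^sub>0 u\<^sub>1 :: "real^'d \<Rightarrow> real^'d" and p\<^sub>1 \<phi>\<^sub>0 \<phi>\<^sub>1 \<mu>\<^sub>0 \<mu>\<^sub>1 :: "real^'d \<Rightarrow> real"
    and \<Phi>\<^sub>0 \<Phi>\<^sub>1 :: "real^'d \<Rightarrow> real" and J\<^sub>0 :: "real^'d \<Rightarrow> real^'d"
  assumes dim: "CARD('d) \<in> {2, 3}"
    and domain: "polyhedral_domain \<Omega>"
    and params: "0 < \<rho>\<^sub>1" "\<rho>\<^sub>1 < \<rho>\<^sub>2" "lam > 0" "\<epsilon> > 0" "\<Delta>t > 0"
    and eta: "continuous_on {-1..1} \<eta>" "\<exists>C>0. \<forall>z\<in>{-1..1}. \<eta> z \<ge> C"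
    and mesh: "simplicial_mesh \<Omega> \<T>" "shape_regular \<sigma> \<T>" "barycenters_orthogonal \<Omega> \<T>"
    and normals: "unit_normals \<Omega> \<T> \<nu>"
    and velocities: "fin_dim_space U"
      "\<forall>u\<in>U. continuous_on (closure \<Omega>) u \<and> (\<forall>i. (\<lambda>x. u x $ i) \<in> H1_0 \<Omega>)"
    and pressures: "fin_dim_space P" "P \<subseteq> L2 \<Omega>" "P0disc \<T> \<subseteq> P"
    and inf_sup: "inf_sup_compatible \<Omega> U P"
    and data: "u\<^sub>0 \<in> U" "\<phi>\<^sub>0 \<in> P0disc \<T>" "\<forall>x. \<phi>\<^sub>0 x \<in> {-1..1}" "\<mu>\<^sub>0 \<in> P1cont \<Omega> \<T>"
    and unknowns: "u\<^sub>1 \<in> U" "p\<^sub>1 \<in> P" "(LINT x:\<Omega>|lebesgue. p\<^sub>1 x) = 0"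
      "\<phi>\<^sub>1 \<in> P0disc \<T>" "\<mu>\<^sub>1 \<in> P1cont \<Omega> \<T>"
    and Phi: "\<Phi>\<^sub>0 = Pi1h \<Omega> \<T> \<phi>\<^sub>0" "\<Phi>\<^sub>1 = Pi1h \<Omega> \<T> \<phi>\<^sub>1"
    and J: "J\<^sub>0 = (\<lambda>x. (rho_dif \<rho>\<^sub>1 \<rho>\<^sub>2 * mob (\<Phi>\<^sub>0 x)) *\<^sub>R Pi1_vec \<Omega> \<T> (egrad \<T> \<mu>\<^sub>0) x)"
    and S1: "\<forall>v\<in>U.
        ip \<Omega> (\<lambda>x. rho \<rho>\<^sub>1 \<rho>\<^sub>2 (\<Phi>\<^sub>0 x) *\<^sub>R delta \<Delta>t u\<^sub>1 u\<^sub>0 x) v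
      + ip \<Omega> (\<lambda>x. jac \<Omega> u\<^sub>1 x *v (rho \<rho>\<^sub>1 \<rho>\<^sub>2 (\<Phi>\<^sub>0 x) *\<^sub>R u\<^sub>0 x - J\<^sub>0 x)) v
      + 2 * ip \<Omega> (\<lambda>x. \<eta> (\<phi>\<^sub>0 x) *\<^sub>R sym_grad \<Omega> u\<^sub>1 x) (sym_grad \<Omega> v)
      - ip \<Omega> p\<^sub>1 (wdiv \<Omega> v)
      + c_h \<Omega> \<T> \<nu> \<phi>\<^sub>1 (Pi0 \<Omega> \<T> \<mu>\<^sub>1) v
      + s1_h \<Omega> \<T> \<rho>\<^sub>1 \<rho>\<^sub>2 \<Delta>t u\<^sub>1 u\<^sub>0 \<Phi>\<^sub>1 \<Phi>\<^sub>0 \<mu>\<^sub>0 v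
      + s2_h \<Omega> \<T> \<nu> u\<^sub>1 \<phi>\<^sub>1 (Pi0 \<Omega> \<T> \<mu>\<^sub>1) v = 0"
    and S2: "\<forall>q\<in>P. ip \<Omega> (wdiv \<Omega> u\<^sub>1) q = 0"
    and S3: "\<forall>\<psi>\<in>P0disc \<T>.
        ip \<Omega> (delta \<Delta>t \<phi>\<^sub>1 \<phi>\<^sub>0) \<psi> + a_upw \<Omega> \<T> \<nu> u\<^sub>1 \<phi>\<^sub>1 \<psi> + b_upw \<Omega> \<T> \<nu> \<mu>\<^sub>1 \<phi>\<^sub>1 \<psi> = 0"
    and S4: "\<forall>\<psi>\<in>P1cont \<Omega> \<T>.
        lam * \<epsilon> * ip \<Omega> (egrad \<T> \<Phi>\<^sub>1) (egrad \<T> \<psi>)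
      + lam / \<epsilon> * ip \<Omega> (\<lambda>x. f_pot (\<Phi>\<^sub>1 x) (\<Phi>\<^sub>0 x)) \<psi>
      - lumped \<T> \<mu>\<^sub>1 \<psi> = 0"
  shows "(energy \<Omega> \<T> \<rho>\<^sub>1 \<rho>\<^sub>2 lam \<epsilon> u\<^sub>1 \<Phi>\<^sub>1 - energy \<Omega> \<T> \<rho>\<^sub>1 \<rho>\<^sub>2 lam \<epsilon> u\<^sub>0 \<Phi>\<^sub>0) / \<Delta>t
      + 2 * ip \<Omega> (\<lambda>x. \<eta> (\<phi>\<^sub>0 x) *\<^sub>R sym_grad \<Omega> u\<^sub>1 x) (sym_grad \<Omega> u\<^sub>1)
      + b_upw \<Omega> \<T> \<nu> \<mu>\<^sub>1 \<phi>\<^sub>1 (Pi0 \<Omega> \<T> \<mu>\<^sub>1)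
      + \<Delta>t / 2 * (LINT x:\<Omega>|lebesgue. rho \<rho>\<^sub>1 \<rho>\<^sub>2 (\<Phi>\<^sub>0 x) * (norm (delta \<Delta>t u\<^sub>1 u\<^sub>0 x))\<^sup>2)
      + \<Delta>t * lam * \<epsilon> / 2 *
          (LINT x:\<Omega>|lebesgue. (norm (delta \<Delta>t (egrad \<T> \<Phi>\<^sub>1) (egrad \<T> \<Phi>\<^sub>0) x))\<^sup>2)
      + lam / \<epsilon> * (LINT x:\<Omega>|lebesgue.
          f_pot (\<Phi>\<^sub>1 x) (\<Phi>\<^sub>0 x) * delta \<Delta>t \<Phi>\<^sub>1 \<Phi>\<^sub>0 x
          - delta \<Delta>t (\<lambda>y. F_pot (\<Phi>\<^sub>1 y)) (\<lambda>y. F_pot (\<Phi>\<^sub>0 y)) x) = 0"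
proof -
  interpret simplicial_mesh_domain \<Omega> \<T>
    using domain mesh(1) by unfold_locales
  note dt = \<open>\<Delta>t > 0\<close>
  have cu: "continuous_on (closure \<Omega>) u\<^sub>0" "continuous_on (closure \<Omega>) u\<^sub>1"
    and H0: "\<And>i. (\<lambda>x. u\<^sub>1 x $ i) \<in> H1_0 \<Omega>"
    using velocities(2) data(1) unknowns(1) by auto
  have H1: "\<And>i. (\<lambda>x. u\<^sub>1 x $ i) \<in> H1 \<Omega>"
    using H0 H1_0_subset_H1 by blast
  have P: "\<Phi>\<^sub>1 \<in> P1cont \<Omega> \<T>" "\<Phi>\<^sub>0 \<in> P1cont \<Omega> \<T>"
    and lump: "\<And>v. v \<in> P1cont \<Omega> \<T> \<Longrightarrow> lumped \<T> \<Phi>\<^sub>1 v = ip \<Omega> \<phi>\<^sub>1 v"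
      "\<And>v. v \<in> P1cont \<Omega> \<T> \<Longrightarrow> lumped \<T> \<Phi>\<^sub>0 v = ip \<Omega> \<phi>\<^sub>0 v"
    using Pi1h_spec[OF data(2)] Pi1h_spec[OF unknowns(4)] Phi by auto
  define \<pi> where "\<pi> = Pi0 \<Omega> \<T> \<mu>\<^sub>1"
  have \<pi>: "\<pi> \<in> P0disc \<T>" "\<And>v. v \<in> P0disc \<T> \<Longrightarrow> ip \<Omega> \<pi> v = ip \<Omega> \<mu>\<^sub>1 v"
    using Pi0_spec[OF P1cont_continuous[OF unknowns(5)]] unfolding \<pi>_def by auto
  have ip_commute: "ip \<Omega> v w = ip \<Omega> w v" for v w :: "real^'d \<Rightarrow> real"
    by (simp add: ip_def mult.commute)

  define W where "W x = rho \<rho>\<^sub>1 \<rho>\<^sub>2 (\<Phi>\<^sub>0 x) *\<^sub>R u\<^sub>0 x - J\<^sub>0 x" for x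
  define T where "T = ip \<Omega> (\<lambda>x. jac \<Omega> u\<^sub>1 x *v W x) u\<^sub>1"
  define X where "X = ip \<Omega> (\<lambda>x. (rho \<rho>\<^sub>1 \<rho>\<^sub>2 (\<Phi>\<^sub>1 x) - rho \<rho>\<^sub>1 \<rho>\<^sub>2 (\<Phi>\<^sub>0 x)) / \<Delta>t) (\<lambda>x. u\<^sub>1 x \<bullet> u\<^sub>1 x)"
  \<comment> \<open>The pointwise identity holds for every vector simultaneously, hence for
    \<open>W x\<close>; the two integrals then agree by almost everywhere equality alone.\<close>
  have conv: "ip \<Omega> W (wgrad \<Omega> (\<lambda>x. u\<^sub>1 x \<bullet> u\<^sub>1 x)) = 2 * T"
  proof -
    have "ip \<Omega> W (wgrad \<Omega> (\<lambda>x. u\<^sub>1 x \<bullet> u\<^sub>1 x)) = (LINT x:\<Omega>|lebesgue. 2 * ((jac \<Omega> u\<^sub>1 x *v W x) \<bullet> u\<^sub>1 x))"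
      unfolding ip_def
      by (rule LINT_lebesgue_cong_AE, use wgrad_inner_self[OF open_domain H0] in eventually_elim) blast
    then show ?thesis
      unfolding T_def ip_def by simp
  qed
  \<comment> \<open>Unfolding \<open>J\<^sub>0\<close> identifies the flux inside
    \<open>s1_h\<close> with \<open>W\<close>, and the prefactor 1/2 absorbs the 2 from
    \<open>conv\<close>.\<close>
  have s1: "s1_h \<Omega> \<T> \<rho>\<^sub>1 \<rho>\<^sub>2 \<Delta>t u\<^sub>1 u\<^sub>0 \<Phi>\<^sub>1 \<Phi>\<^sub>0 \<mu>\<^sub>0 u\<^sub>1 = 1/2 * X - T"
    using conv unfolding s1_h_def X_def W_def J by (simp add: right_diff_distrib)

  have pressure: "ip \<Omega> p\<^sub>1 (wdiv \<Omega> u\<^sub>1) = 0"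
    using S2 unknowns(2) ip_commute by metis
  have "(\<lambda>x. \<phi>\<^sub>1 x * \<pi> x) \<in> P"
    using P0disc_mult[OF unknowns(4) \<pi>(1)] pressures(3) by blast
  then have "ip \<Omega> (wdiv \<Omega> u\<^sub>1) (\<lambda>x. \<phi>\<^sub>1 x * \<pi> x) = 0"
    using S2 by blast
  moreover have "(LINT x:\<Omega>|lebesgue. ediv \<T> (\<lambda>y. \<phi>\<^sub>1 y *\<^sub>R u\<^sub>1 y) x * \<pi> x) = ip \<Omega> (wdiv \<Omega> u\<^sub>1) (\<lambda>x. \<phi>\<^sub>1 x * \<pi> x)"
    unfolding ip_def
    by (rule LINT_lebesgue_cong_AE, use AE_ediv_P0disc_scaleR[OF unknowns(4) H1] in eventually_elim) auto
  ultimately have c_s2: "c_h \<Omega> \<T> \<nu> \<phi>\<^sub>1 \<pi> u\<^sub>1 + s2_h \<Omega> \<T> \<nu> u\<^sub>1 \<phi>\<^sub>1 \<pi> u\<^sub>1 = - a_upw \<Omega> \<T> \<nu> u\<^sub>1 \<phi>\<^sub>1 \<pi>"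
    using c_h_add_s2_h[OF cu(2) unknowns(4) \<pi>(1), of \<nu>] by simp

  have momentum: "ip \<Omega> (\<lambda>x. rho \<rho>\<^sub>1 \<rho>\<^sub>2 (\<Phi>\<^sub>0 x) *\<^sub>R delta \<Delta>t u\<^sub>1 u\<^sub>0 x) u\<^sub>1 + 1/2 * X
      + 2 * ip \<Omega> (\<lambda>x. \<eta> (\<phi>\<^sub>0 x) *\<^sub>R sym_grad \<Omega> u\<^sub>1 x) (sym_grad \<Omega> u\<^sub>1) - a_upw \<Omega> \<T> \<nu> u\<^sub>1 \<phi>\<^sub>1 \<pi> = 0"
    using bspec[OF S1 unknowns(1)] c_s2 unfolding s1 pressure T_def W_def \<pi>_def by linarith
  have phase: "ip \<Omega> (delta \<Delta>t \<phi>\<^sub>1 \<phi>\<^sub>0) \<pi> + a_upw \<Omega> \<T> \<nu> u\<^sub>1 \<phi>\<^sub>1 \<pi> + b_upw \<Omega> \<T> \<nu> \<mu>\<^sub>1 \<phi>\<^sub>1 \<pi> = 0"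
    using bspec[OF S3 \<pi>(1)] .
  have potential: "lam * \<epsilon> * ip \<Omega> (egrad \<T> \<Phi>\<^sub>1) (egrad \<T> (delta \<Delta>t \<Phi>\<^sub>1 \<Phi>\<^sub>0))
      + lam / \<epsilon> * ip \<Omega> (\<lambda>x. f_pot (\<Phi>\<^sub>1 x) (\<Phi>\<^sub>0 x)) (delta \<Delta>t \<Phi>\<^sub>1 \<Phi>\<^sub>0)
      - lumped \<T> \<mu>\<^sub>1 (delta \<Delta>t \<Phi>\<^sub>1 \<Phi>\<^sub>0) = 0"
    using bspec[OF S4 delta_P1cont[OF P]] .
  \<comment> \<open>The three projections meet here: \<open>Pi1h\<close> at both time levels turns
    the lumped product into an L^2 product with the phases, and \<open>Pi0\<close> then replaces
    \<open>\<mu>\<^sub>1\<close>, since the phase increment is piecewise constant.\<close>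
  have lumping: "lumped \<T> \<mu>\<^sub>1 (delta \<Delta>t \<Phi>\<^sub>1 \<Phi>\<^sub>0) = ip \<Omega> (delta \<Delta>t \<phi>\<^sub>1 \<phi>\<^sub>0) \<pi>"
  proof -
    have "lumped \<T> \<mu>\<^sub>1 (delta \<Delta>t \<Phi>\<^sub>1 \<Phi>\<^sub>0) = (lumped \<T> \<mu>\<^sub>1 \<Phi>\<^sub>1 - lumped \<T> \<mu>\<^sub>1 \<Phi>\<^sub>0) / \<Delta>t"
      by (rule linear_form_on_delta[OF function_subspace_P1cont linear_form_on_lumped P])
    also have "\<dots> = (ip \<Omega> \<mu>\<^sub>1 \<phi>\<^sub>1 - ip \<Omega> \<mu>\<^sub>1 \<phi>\<^sub>0) / \<Delta>t"
      using lump[OF unknowns(5)] by (simp add: lumped_commute[of \<mu>\<^sub>1] ip_commute[of \<mu>\<^sub>1])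
    also have "\<dots> = ip \<Omega> \<mu>\<^sub>1 (delta \<Delta>t \<phi>\<^sub>1 \<phi>\<^sub>0)"
      using unknowns data
      by (intro linear_form_on_delta[OF function_subspace_P0disc, symmetric] linear_form_on_ip function_subspace_P0disc
          set_integrable_P0disc_mult set_integrable_interior_element[OF P1cont_continuous]) auto
    also have "\<dots> = ip \<Omega> (delta \<Delta>t \<phi>\<^sub>1 \<phi>\<^sub>0) \<pi>"
      using \<pi>(2)[OF delta_P0disc[OF unknowns(4) data(2)]] ip_commute by metis
    finally show ?thesis .
  qed
  have cr: "continuous_on (closure \<Omega>) (\<lambda>x. rho \<rho>\<^sub>1 \<rho>\<^sub>2 (\<Phi>\<^sub>0 x))" "continuous_on (closure \<Omega>) (\<lambda>x. rho \<rho>\<^sub>1 \<rho>\<^sub>2 (\<Phi>\<^sub>1 x))"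
    unfolding rho_def using P1cont_continuous[OF P(1)] P1cont_continuous[OF P(2)] by (auto intro!: continuous_intros)
  note kin = kinetic_energy_increment[OF cu cr less_imp_neq[OF dt, symmetric], folded X_def]
  note grad = gradient_energy_increment[OF P less_imp_neq[OF dt, symmetric]]
  note pot = potential_energy_increment[OF P, of \<Delta>t]
  show ?thesis
    unfolding pot energy_def \<pi>_def[symmetric]
    by (rule energy_balance_sum[OF momentum[unfolded kin] phase potential[unfolded grad lumping]])
qed

end
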